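(* Let $X$ be an Asplund space, let $A,B\subset X$ be closed, and let $a\in A$ and $b\in B$. Then the pair $\{A,B\}$ is approximately stationary relative to $a$ and $b$ if and only if the following two equivalent conditions hold: (i) for any $\varepsilon>0$ there exist points $a'\in A\cap\mathbb{B}_\varepsilon(a)$, $b'\in B\cap\mathbb{B}_\varepsilon(b)$ and $a^*\in X^*$ such that $$\|a^*\|=1,\quad d(a^*,N_A(a'))<\varepsilon\quad\text{and}\quad d(-a^*,N_B(b'))<\varepsilon;$$ (ii) for any $\varepsilon>0$ there exist points $a'\in A\cap\mathbb{B}_\varepsilon(a)$, $b'\in B\cap\mathbb{B}_\varepsilon(b)$, $a^*\in N_A(a')$ and $b^*\in N_B(b')$ such that $$\|a^*\|+\|b^*\|=1\quad\text{and}\quad\|a^*+b^*\|<\varepsilon.$$ (That is, (i) and (ii) are equivalent to each other, and each is equivalent to approximate stationarity relative to $a$ and $b$.)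
   Context: A Banach space is Asplund if every continuous convex function defined on an open convex set $D$ is Fréchet differentiable at each point of some dense subset of $D$; equivalently, the dual of each of its separable subspaces is separable. $X^*$ is the topological dual of $X$ with the dual norm. $\mathbb{B}$ is the closed unit ball of $X$, $\rho\mathbb{B}$ is the closed ball of radius $\rho$ centered at $0$, and $\mathbb{B}_\delta(x)$ is the open ball of radius $\delta$ centered at $x$. $d(x^*,K)=\inf_{k\in K}\|x^*-k\|$ is the distance. For $A\subset X$ and $a\in A$, the Fréchet normal cone to $A$ at $a$ is $$N_A(a)=\Big\{x^*\in X^*\;\Big|\;\limsup_{x\to a,\;x\in A\setminus\{a\}}\frac{\langle x^*,x-a\rangle}{\|x-a\|}\le0\Big\},$$ i.e. $x^*\in N_A(a)$ iff for every $\eta>0$ there is $\delta>0$ with $\langle x^*,x-a\rangle\le\eta\|x-a\|$ for all $x\in A\cap\mathbb{B}_\delta(a)$. The pair $\{A,B\}$ is approximately stationary relative to $a\in A$ and $b\in B$ if for any $\varepsilon>0$ there exist $\rho\in(0,\varepsilon)$, points $a'\in A\cap\mathbb{B}_\varepsilon(a)$, $b'\in B\cap\mathbb{B}_\varepsilon(b)$ and $u,v\in X$ such that $$(A-a'-u)\cap(B-b'-v)\cap(\rho\mathbb{B})=\emptyset\quad\text{and}\quad\max\{\|u\|,\|v\|\}<\varepsilon\rho.$$ *)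

theory Defs
  imports "HOL-Analysis.Analysis"
begin

(* The topological dual of 'a with the dual norm is the type 'a \<Rightarrow>\<^sub>L real. Differentiability in
   HOL-Analysis is Frechet differentiability; as D is open, the values of f outside D are
   irrelevant, so a total f loses no generality. *)
definition asplund_space :: "'a::banach itself \<Rightarrow> bool" where
  "asplund_space (_ :: 'a itself) \<longleftrightarrow>
     (\<forall>(D :: 'a set) (f :: 'a \<Rightarrow> real).
        open D \<and> convex D \<and> convex_on D f \<and> continuous_on D f \<longrightarrow>
        (\<exists>S. S \<subseteq> D \<and> D \<subseteq> closure S \<and> (\<forall>x\<in>S. f differentiable (at x))))"

(* The filter "at a within A" is punctured at a. It is trivial when a is isolated in A, where the
   upper limit is - \<infinity> and the cone is the whole dual. Meant for a \<in> A. *)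
definition frechet_normal_cone :: "'a::real_normed_vector set \<Rightarrow> 'a \<Rightarrow> ('a \<Rightarrow>\<^sub>L real) set" where
  "frechet_normal_cone A a =
     {x'. Limsup (at a within A)
            (\<lambda>x. ereal (blinfun_apply x' (x - a) / norm (x - a))) \<le> 0}"

lemma frechet_normal_cone_iff:
  assumes "a \<in> A"
  shows "x' \<in> frechet_normal_cone A a \<longleftrightarrow>
    (\<forall>\<eta>>0. \<exists>\<delta>>0. \<forall>x \<in> A \<inter> ball a \<delta>. blinfun_apply x' (x - a) \<le> \<eta> * norm (x - a))"
    (is "_ \<longleftrightarrow> ?R")
proof
  assume "x' \<in> frechet_normal_cone A a"
  then have L: "\<forall>y>0. \<forall>\<^sub>F x in at a within A.
      ereal (blinfun_apply x' (x - a) / norm (x - a)) < y"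
    by (simp add: frechet_normal_cone_def Limsup_le_iff)
  show ?R
  proof (intro allI impI)
    fix \<eta> :: real assume "\<eta> > 0"
    with L have "\<forall>\<^sub>F x in at a within A. blinfun_apply x' (x - a) / norm (x - a) < \<eta>"
      by (metis (no_types, lifting) ereal_less(2) eventually_mono less_ereal.simps(1))
    then obtain \<delta> where d: "\<delta> > 0"
      "\<And>x. x \<in> A \<Longrightarrow> x \<noteq> a \<Longrightarrow> dist x a < \<delta> \<Longrightarrow> blinfun_apply x' (x - a) / norm (x - a) < \<eta>"
      unfolding eventually_at by blast
    have "blinfun_apply x' (x - a) \<le> \<eta> * norm (x - a)" if "x \<in> A \<inter> ball a \<delta>" for x
    proof (cases "x = a")
      case False
      then show ?thesis using d(2)[of x] that by (auto simp: divide_less_eq dist_commute)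
    qed simp
    then show "\<exists>\<delta>>0. \<forall>x \<in> A \<inter> ball a \<delta>. blinfun_apply x' (x - a) \<le> \<eta> * norm (x - a)"
      using d(1) by blast
  qed
next
  assume R: ?R
  have "\<forall>\<^sub>F x in at a within A. ereal (blinfun_apply x' (x - a) / norm (x - a)) < y"
    if y: "y > 0" for y
  proof -
    obtain \<eta> where e: "\<eta> > 0" "ereal \<eta> < y"
      using ereal_dense2[OF y] by (metis ereal_less(2))
    obtain \<delta> where d: "\<delta> > 0"
      "\<forall>x \<in> A \<inter> ball a \<delta>. blinfun_apply x' (x - a) \<le> \<eta> * norm (x - a)"
      using R e(1) by blast
    have "ereal (blinfun_apply x' (x - a) / norm (x - a)) < y"
      if "x \<in> A" "x \<noteq> a" "dist x a < \<delta>" for x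
    proof -
      have "blinfun_apply x' (x - a) / norm (x - a) \<le> \<eta>"
        using d(2) that by (auto simp: divide_le_eq dist_commute)
      then show ?thesis using e(2) by (meson ereal_less_eq(3) le_less_trans)
    qed
    then show ?thesis using d(1) unfolding eventually_at by blast
  qed
  then show "x' \<in> frechet_normal_cone A a"
    by (simp add: frechet_normal_cone_def Limsup_le_iff)
qed

definition approximately_stationary ::
    "'a::real_normed_vector set \<Rightarrow> 'a set \<Rightarrow> 'a \<Rightarrow> 'a \<Rightarrow> bool" where
  "approximately_stationary A B a b \<longleftrightarrow>
     (\<forall>\<epsilon>>0. \<exists>\<rho>\<in>{0<..<\<epsilon>}. \<exists>a' \<in> A \<inter> ball a \<epsilon>. \<exists>b' \<in> B \<inter> ball b \<epsilon>. \<exists>u v.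
        (\<lambda>x. x - a' - u) ` A \<inter> (\<lambda>x. x - b' - v) ` B \<inter> cball 0 \<rho> = {} \<and>
        max (norm u) (norm v) < \<epsilon> * \<rho>)"

end

theory Submission
  imports Defs
begin

text \<open>
The equivalence of the two normal conditions is a rescaling: the Frechet normal cones are cones, and two
normals with a small sum have almost equal norms. A pair of normals \<open>x'\<close> and \<open>y'\<close> with small sum yields
stationarity, because a translation \<open>u\<close> of size proportional to \<open>\<rho>\<close> on which \<open>x'\<close> is large pushes the two
sets apart: a common point would make \<open>x'\<close> small on one side and \<open>y'\<close> small on the other.

The converse is where the Asplund property is needed. If \<open>A\<close> and \<open>B\<close> can be separated near \<open>a0\<close> and \<open>b0\<close> by
small translations \<open>u\<close> and \<open>v\<close>, then \<open>norm (x - y - w)\<close> with \<open>w = a0 + u - b0 - v\<close> is positive and almost minimal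
at \<open>(a0, b0)\<close> on the part of \<open>A \<times> B\<close> close to \<open>(a0, b0)\<close>. Were the norm Frechet differentiable off the origin, a
smooth variational principle would produce an exact minimum nearby, and the derivatives at this minimum
would be the required normals. A space with the Asplund property need not carry such a norm, but it
suffices to have one on a separable subspace \<open>Y\<close> that is large enough. The argument has four parts.

\<^item> The dual ball is separable for the seminorm of uniform convergence on bounded sets of \<open>Y\<close>
(\<open>separable_dual\<close>). Otherwise the sets of functionals that are covered by countably many small balls form a
proper \<open>\<sigma>\<close>-ideal, and the essential supremum of \<open>s \<mapsto> s x\<close> with respect to this \<open>\<sigma>\<close>-ideal is a continuous
sublinear function of \<open>x\<close> on the whole space that is Frechet differentiable nowhere.

\<^item> Separability of the dual gives an equivalent gauge whose restriction to \<open>Y\<close> is differentiable off the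
origin (\<open>smooth_gauge\<close>). It is the support function of a dual ball defined by a weighted sum of squares of
seminorms, which makes near-maximisers of evaluation at a point converge uniformly on \<open>Y\<close>.

\<^item> With this gauge, the variational principle of Borwein and Preiss yields a pair of functionals that are
normal to \<open>A \<inter> Y\<close> and \<open>B \<inter> Y\<close> (\<open>normals_along_separable_subspace\<close>).

\<^item> A functional that is normal only along \<open>Y\<close> can be replaced by one that is normal in the whole space
(\<open>normal_functional_lifting\<close>). By Hahn-Banach, a true normal subject to a sublinear bound fails to exist only if some
finite system of inequalities is inconsistent. Whether inconsistent systems of a given combinatorial type
exist depends on countably many data, so \<open>Y\<close> can be chosen to contain one whenever there is one; but the
functional that is normal along \<open>Y\<close> satisfies every system with points in \<open>Y\<close>.
\<close>

section \<open>Sublinear functionals and the Hahn-Banach theorem\<close>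

definition sublinear :: "('v::real_vector \<Rightarrow> real) \<Rightarrow> bool" where
  "sublinear p \<longleftrightarrow> (\<forall>x y. p (x + y) \<le> p x + p y) \<and> (\<forall>c x. c \<ge> 0 \<longrightarrow> p (c *\<^sub>R x) = c * p x)"

lemma sublinear_add: "sublinear p \<Longrightarrow> p (x + y) \<le> p x + p y"
  and sublinear_scale: "sublinear p \<Longrightarrow> c \<ge> 0 \<Longrightarrow> p (c *\<^sub>R x) = c * p x"
  by (auto simp: sublinear_def)

lemma sublinear_zero: "sublinear p \<Longrightarrow> p 0 = 0"
  using sublinear_scale[of p 0 0] by simp

lemma sublinear_minus: "sublinear p \<Longrightarrow> - p (- x) \<le> p x"
  using sublinear_add[of p x "- x"] sublinear_zero[of p] by simp

text \<open>Lower bounds of chains and infimal convolutions with a ray or a cone are infima of this shape. The members of the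
family need not be sublinear themselves: it suffices that sums and multiples of their values are dominated within the family.\<close>

lemma sublinear_INF:
  fixes G :: "'i set" and q :: "'i \<Rightarrow> 'v::real_vector \<Rightarrow> real"
  assumes ne: "G \<noteq> {}"
    and bd: "\<And>x. bdd_below ((\<lambda>i. q i x) ` G)"
    and add: "\<And>i j x y. i \<in> G \<Longrightarrow> j \<in> G \<Longrightarrow> \<exists>k\<in>G. q k (x + y) \<le> q i x + q j y"
    and scale: "\<And>i c x. i \<in> G \<Longrightarrow> c > 0 \<Longrightarrow> \<exists>k\<in>G. q k (c *\<^sub>R x) \<le> c * q i x"
    and zero: "(INF i\<in>G. q i 0) = 0"
  shows "sublinear (\<lambda>x. INF i\<in>G. q i x)"
proof -
  have le: "(INF k\<in>G. q k x) \<le> q i x" if "i \<in> G" for i x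
    by (rule cINF_lower[OF bd that])
  have "(INF k\<in>G. q k (x + y)) \<le> (INF k\<in>G. q k x) + (INF k\<in>G. q k y)" for x y
  proof -
    have "(INF k\<in>G. q k (x + y)) - (INF k\<in>G. q k y) \<le> q i x" if i: "i \<in> G" for i
    proof -
      have "(INF k\<in>G. q k (x + y)) - q i x \<le> q j y" if j: "j \<in> G" for j
      proof -
        obtain k where "k \<in> G" "q k (x + y) \<le> q i x + q j y" using add i j by blast
        with le[of k "x + y"] show ?thesis by simp
      qed
      then have "(INF k\<in>G. q k (x + y)) - q i x \<le> (INF k\<in>G. q k y)"
        by (intro cINF_greatest ne)
      then show ?thesis by simp
    qed
    then have "(INF k\<in>G. q k (x + y)) - (INF k\<in>G. q k y) \<le> (INF k\<in>G. q k x)"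
      by (intro cINF_greatest ne)
    then show ?thesis by simp
  qed
  moreover have le1: "(INF k\<in>G. q k (c *\<^sub>R x)) \<le> c * (INF k\<in>G. q k x)" if c: "c > 0" for c x
  proof -
    have "(INF k\<in>G. q k (c *\<^sub>R x)) / c \<le> q i x" if i: "i \<in> G" for i
    proof -
      obtain k where "k \<in> G" "q k (c *\<^sub>R x) \<le> c * q i x" using scale i c by blast
      with le[of k "c *\<^sub>R x"] show ?thesis using c by (simp add: field_simps)
    qed
    then have "(INF k\<in>G. q k (c *\<^sub>R x)) / c \<le> (INF k\<in>G. q k x)"
      by (intro cINF_greatest ne)
    then show ?thesis using c by (simp add: field_simps)
  qed
  moreover have "(INF k\<in>G. q k (c *\<^sub>R x)) = c * (INF k\<in>G. q k x)" if c: "c \<ge> 0" for c x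
  proof (cases "c = 0")
    case True then show ?thesis using zero by simp
  next
    case False
    then have "c > 0" using c by simp
    have "(INF k\<in>G. q k x) \<le> inverse c * (INF k\<in>G. q k (c *\<^sub>R x))"
      using le1[of "inverse c" "c *\<^sub>R x"] \<open>c > 0\<close> by simp
    then have "c * (INF k\<in>G. q k x) \<le> (INF k\<in>G. q k (c *\<^sub>R x))"
      using \<open>c > 0\<close> by (simp add: field_simps)
    with le1[OF \<open>c > 0\<close>, of x] show ?thesis by simp
  qed
  ultimately show ?thesis unfolding sublinear_def by blast
qed

text \<open>The pointwise infimum of a chain is again sublinear, and it is finite because \<open>- p (- x)\<close> bounds the chain from
below, so Zorn's lemma applies.\<close>

lemma minimal_sublinear_exists:
  fixes p :: "'v::real_vector \<Rightarrow> real"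
  assumes p: "sublinear p"
  obtains q where "sublinear q" "q \<le> p" "\<And>r. sublinear r \<Longrightarrow> r \<le> q \<Longrightarrow> r = q"
proof -
  define A where "A = {q. sublinear q \<and> q \<le> p}"
  have po: "partial_order_on A (relation_of (\<lambda>q r. r \<le> q) A)"
    by (rule partial_order_on_relation_ofI) auto
  have "\<exists>u\<in>A. \<forall>a\<in>C. u \<le> a" if C: "C \<in> Chains (relation_of (\<lambda>q r. r \<le> q) A)" for C
  proof (cases "C = {}")
    case True then show ?thesis using p by (auto simp: A_def)
  next
    case False
    have CA: "q \<in> A" if "q \<in> C" for q
      using C that unfolding Chains_def relation_of_def by auto
    have tot: "q \<le> r \<or> r \<le> q" if "q \<in> C" "r \<in> C" for q r
      using C that unfolding Chains_def relation_of_def by auto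
    have low: "- p (- x) \<le> q x" if "q \<in> C" for q x
    proof -
      have "sublinear q" "q (- x) \<le> p (- x)" using CA[OF that] by (auto simp: A_def le_fun_def)
      then show ?thesis using sublinear_minus[of q "- x"] sublinear_minus[of q x] by simp
    qed
    have bd: "bdd_below ((\<lambda>q. q x) ` C)" for x
      using low by (intro bdd_belowI2) auto
    have "sublinear (\<lambda>x. INF q\<in>C. q x)"
    proof (rule sublinear_INF[OF False bd])
      show "\<exists>k\<in>C. k (x + y) \<le> i x + j y" if "i \<in> C" "j \<in> C" for i j x y
      proof -
        have s: "sublinear i" "sublinear j" using CA that by (auto simp: A_def)
        have "i \<le> j \<or> j \<le> i" using tot that by blast
        then consider "i \<le> j" | "j \<le> i" by blast
        then show ?thesis
        proof cases
          case 1
          then have "i (x + y) \<le> i x + j y"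
            using sublinear_add[OF s(1), of x y] by (smt (verit) le_fun_def)
          then show ?thesis using that by blast
        next
          case 2
          then have "j (x + y) \<le> i x + j y"
            using sublinear_add[OF s(2), of x y] by (smt (verit) le_fun_def)
          then show ?thesis using that by blast
        qed
      qed
      show "\<exists>k\<in>C. k (c *\<^sub>R x) \<le> c * i x" if "i \<in> C" "c > 0" for i c x
      proof (intro bexI[of _ i])
        have "sublinear i" using CA that by (auto simp: A_def)
        then show "i (c *\<^sub>R x) \<le> c * i x" using sublinear_scale[of i c x] that(2) by simp
      qed (fact that(1))
      have "q 0 = 0" if "q \<in> C" for q
        using CA[OF that] sublinear_zero by (auto simp: A_def)
      then have "(\<lambda>q. q 0) ` C = {0}" using False by force
      then show "(INF q\<in>C. q 0) = 0" by simp
    qed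
    moreover have le: "(\<lambda>x. INF q\<in>C. q x) \<le> q" if "q \<in> C" for q
      unfolding le_fun_def using cINF_lower[OF bd that] by blast
    moreover obtain q0 where "q0 \<in> C" using False by blast
    ultimately have "(\<lambda>x. INF q\<in>C. q x) \<in> A"
      using CA[of q0] unfolding A_def by (auto intro: order_trans)
    then show ?thesis using le by blast
  qed
  then obtain q where "q \<in> A" "\<forall>r\<in>A. r \<le> q \<longrightarrow> r = q"
    using predicate_Zorn[OF po] by blast
  then show ?thesis
    by (intro that[of q]) (auto simp: A_def intro: order_trans)
qed

text \<open>A minimal sublinear functional \<open>q\<close> below \<open>p\<close> is linear: for fixed \<open>a\<close>, the infimum of \<open>q (x + t a) - t q a\<close> over
\<open>t \<ge> 0\<close> is a sublinear functional below \<open>q\<close>, hence equal to \<open>q\<close>, and \<open>t = 1\<close> gives superadditivity.\<close>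

theorem Hahn_Banach_sublinear:
  fixes p :: "'v::real_vector \<Rightarrow> real"
  assumes "sublinear p"
  shows "\<exists>L. linear L \<and> (\<forall>x. L x \<le> p x)"
proof -
  obtain q where q: "sublinear q" "q \<le> p"
    and min: "\<And>r. sublinear r \<Longrightarrow> r \<le> q \<Longrightarrow> r = q"
    using minimal_sublinear_exists[OF assms] by blast
  have ge: "q x + q a \<le> q (x + a)" for x a
  proof -
    define r where "r = (\<lambda>x. INF t\<in>{0::real..}. q (x + t *\<^sub>R a) - t * q a)"
    have low: "- q (- x) \<le> q (x + t *\<^sub>R a) - t * q a" if "t \<ge> 0" for x t
      using sublinear_add[OF q(1), of "x + t *\<^sub>R a" "- x"] sublinear_scale[OF q(1) that, of a] by simp
    have bd: "bdd_below ((\<lambda>t. q (x + t *\<^sub>R a) - t * q a) ` {0..})" for x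
      using low by (intro bdd_belowI2) auto
    have "sublinear r" unfolding r_def
    proof (rule sublinear_INF[OF _ bd])
      show "\<exists>k\<in>{0..}. q (x + y + k *\<^sub>R a) - k * q a \<le> q (x + i *\<^sub>R a) - i * q a + (q (y + j *\<^sub>R a) - j * q a)"
        if "i \<in> {0..}" "j \<in> {0..}" for i j x y
        using that sublinear_add[OF q(1), of "x + i *\<^sub>R a" "y + j *\<^sub>R a"]
        by (intro bexI[of _ "i + j"]) (auto simp: algebra_simps)
      show "\<exists>k\<in>{0..}. q (c *\<^sub>R x + k *\<^sub>R a) - k * q a \<le> c * (q (x + i *\<^sub>R a) - i * q a)"
        if "i \<in> {0..}" "c > 0" for i c x
        using that sublinear_scale[OF q(1), of c "x + i *\<^sub>R a"]
        by (intro bexI[of _ "c * i"]) (auto simp: algebra_simps)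
      have "q (0 + t *\<^sub>R a) - t * q a = 0" if "t \<in> {0..}" for t
        using sublinear_scale[OF q(1), of t a] that by simp
      then have "(\<lambda>t. q (0 + t *\<^sub>R a) - t * q a) ` {0..} = {0}" by force
      then show "(INF t\<in>{0..}. q (0 + t *\<^sub>R a) - t * q a) = 0" by simp
    qed auto
    moreover have "r x \<le> q x" for x
      using cINF_lower[OF bd, of 0 x] unfolding r_def by simp
    ultimately have "r = q" using min by (simp add: le_fun_def)
    moreover have "r x \<le> q (x + a) - q a"
      using cINF_lower[OF bd, of 1 x] unfolding r_def by simp
    ultimately show ?thesis by simp
  qed
  have add: "q (x + a) = q x + q a" for x a
    using ge[of x a] sublinear_add[OF q(1), of x a] by linarith
  have neg: "q (- x) = - q x" for x
    using add[of x "- x"] sublinear_zero[OF q(1)] by simp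
  have "q (c *\<^sub>R x) = c * q x" for c x
  proof (cases "c \<ge> 0")
    case True then show ?thesis using sublinear_scale[OF q(1)] by simp
  next
    case False
    then have "q ((- c) *\<^sub>R x) = - c * q x" using sublinear_scale[OF q(1), of "- c" x] by simp
    then show ?thesis using neg[of "c *\<^sub>R x"] by simp
  qed
  then have "linear q" using add by (auto intro!: linearI)
  then show ?thesis using q(2) by (auto simp: le_fun_def)
qed

text \<open>The pairs \<open>(g, r)\<close> in \<open>Q\<close> are linear constraints \<open>L g \<le> r\<close>, closed under addition and scaling. The hypothesis
says that no constraint contradicts the bound \<open>L \<le> p\<close>. It makes the infimal convolution of \<open>p\<close> with \<open>Q\<close>
finite, and any linear functional below this convolution is a solution (Mazur-Orlicz).\<close>

theorem Hahn_Banach_consistency: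
  fixes p :: "'v::real_vector \<Rightarrow> real" and Q :: "('v \<times> real) set"
  assumes p: "sublinear p"
    and Q0: "(0, 0) \<in> Q"
    and Qadd: "\<And>z w. z \<in> Q \<Longrightarrow> w \<in> Q \<Longrightarrow> z + w \<in> Q"
    and Qscale: "\<And>c z. c > 0 \<Longrightarrow> z \<in> Q \<Longrightarrow> c *\<^sub>R z \<in> Q"
    and cons: "\<And>g r. (g, r) \<in> Q \<Longrightarrow> 0 \<le> r + p (- g)"
  obtains L where "linear L" "\<And>x. L x \<le> p x" "\<And>g r. (g, r) \<in> Q \<Longrightarrow> L g \<le> r"
proof -
  define P where "P = (\<lambda>x. INF z\<in>Q. p (x - fst z) + snd z)"
  have low: "- p (- x) \<le> p (x - fst z) + snd z" if "z \<in> Q" for x z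
  proof -
    have "p (- fst z) \<le> p (x - fst z) + p (- x)"
      using sublinear_add[OF p, of "x - fst z" "- x"] by simp
    then show ?thesis using cons[of "fst z" "snd z"] that by simp
  qed
  have bd: "bdd_below ((\<lambda>z. p (x - fst z) + snd z) ` Q)" for x
    using low by (intro bdd_belowI2) auto
  have "sublinear P" unfolding P_def
  proof (rule sublinear_INF[OF _ bd])
    show "Q \<noteq> {}" using Q0 by blast
    show "\<exists>k\<in>Q. p (x + y - fst k) + snd k \<le> p (x - fst i) + snd i + (p (y - fst j) + snd j)"
      if "i \<in> Q" "j \<in> Q" for i j x y
      using sublinear_add[OF p, of "x - fst i" "y - fst j"] Qadd[OF that]
      by (intro bexI[of _ "i + j"]) (auto simp: algebra_simps)
    show "\<exists>k\<in>Q. p (c *\<^sub>R x - fst k) + snd k \<le> c * (p (x - fst i) + snd i)"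
      if "i \<in> Q" "c > 0" for i c x
      using sublinear_scale[OF p, of c "x - fst i"] Qscale[OF that(2,1)] that(2)
      by (intro bexI[of _ "c *\<^sub>R i"]) (auto simp: algebra_simps)
    have "(INF z\<in>Q. p (0 - fst z) + snd z) \<le> 0"
      using cINF_lower[OF bd Q0, of 0] sublinear_zero[OF p] by simp
    moreover have "0 \<le> (INF z\<in>Q. p (0 - fst z) + snd z)"
      using Q0 cons by (intro cINF_greatest) (auto simp: add.commute)
    ultimately show "(INF z\<in>Q. p (0 - fst z) + snd z) = 0" by simp
  qed
  then obtain L where L: "linear L" "\<And>x. L x \<le> P x" using Hahn_Banach_sublinear by blast
  have P: "P x \<le> p (x - fst z) + snd z" if "z \<in> Q" for x z
    unfolding P_def by (rule cINF_lower[OF bd that])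
  show ?thesis
  proof
    show "L x \<le> p x" for x using L(2)[of x] P[OF Q0, of x] by simp
    show "L g \<le> r" if "(g, r) \<in> Q" for g r
      using L(2)[of g] P[OF that, of g] sublinear_zero[OF p] by simp
  qed (fact L(1))
qed

lemma norming_functional:
  fixes y :: "'a::real_normed_vector"
  obtains f where "linear f" "\<And>x. \<bar>f x\<bar> \<le> norm x" "f y = norm y"
proof -
  define Q where "Q = (\<lambda>t. (- (t *\<^sub>R y), - (t * norm y))) ` {0::real..}"
  have sub: "sublinear (norm :: 'a \<Rightarrow> real)"
    by (simp add: sublinear_def norm_triangle_ineq)
  have Q: "(0, 0) \<in> Q" unfolding Q_def by (intro image_eqI[of _ _ 0]) auto
  have "z + w \<in> Q" if zw: "z \<in> Q" "w \<in> Q" for z w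
  proof -
    obtain s t where "s \<ge> 0" "t \<ge> 0" "z = (- (s *\<^sub>R y), - (s * norm y))" "w = (- (t *\<^sub>R y), - (t * norm y))"
      using zw by (auto simp: Q_def)
    then show ?thesis unfolding Q_def by (intro image_eqI[of _ _ "s + t"]) (auto simp: algebra_simps)
  qed
  moreover have "c *\<^sub>R z \<in> Q" if cz: "c > 0" "z \<in> Q" for c z
  proof -
    obtain s where "s \<ge> 0" "z = (- (s *\<^sub>R y), - (s * norm y))"
      using cz by (auto simp: Q_def)
    then show ?thesis unfolding Q_def using cz(1) by (intro image_eqI[of _ _ "c * s"]) auto
  qed
  moreover have "0 \<le> r + norm (- g)" if "(g, r) \<in> Q" for g r
    using that by (auto simp: Q_def)
  ultimately obtain L where L: "linear L" "\<And>x. L x \<le> norm x" "\<And>g r. (g, r) \<in> Q \<Longrightarrow> L g \<le> r"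
    using Hahn_Banach_consistency[OF sub Q] by blast
  have "(- y, - norm y) \<in> Q" unfolding Q_def by (intro image_eqI[of _ _ 1]) auto
  then have "L y \<ge> norm y" using L(3) linear_neg[OF L(1), of y] by force
  moreover have "\<bar>L x\<bar> \<le> norm x" for x
    using L(2)[of x] L(2)[of "- x"] linear_neg[OF L(1), of x] by simp
  ultimately show ?thesis using that[OF L(1)] L(2)[of y] by (metis antisym)
qed

section \<open>Separability of the dual ball on separable subspaces\<close>

text \<open>Functionals are treated as plain functions until the final section, so that pointwise convergence is convergence in the
product topology.\<close>

definition dual_ball :: "('a::real_normed_vector \<Rightarrow> real) set" where
  "dual_ball = {f. linear f \<and> (\<forall>x. \<bar>f x\<bar> \<le> norm x)}"

lemma dual_ballD:
  assumes "f \<in> dual_ball"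
  shows "linear f" "\<bar>f x\<bar> \<le> norm x" "f (x + y) = f x + f y" "f (x - y) = f x - f y"
    "f (c *\<^sub>R x) = c * f x" "f (- x) = - f x" "f 0 = 0"
proof -
  show l: "linear f" and "\<bar>f x\<bar> \<le> norm x" using assms by (auto simp: dual_ball_def)
  show "f (x + y) = f x + f y" "f (x - y) = f x - f y" "f (c *\<^sub>R x) = c * f x" "f (- x) = - f x" "f 0 = 0"
    using l by (simp_all add: linear_add linear_diff linear_scale linear_neg linear_0)
qed

definition close_on :: "'a::real_normed_vector set \<Rightarrow> real \<Rightarrow> ('a \<Rightarrow> real) \<Rightarrow> ('a \<Rightarrow> real) \<Rightarrow> bool" where
  "close_on Y \<eta> s c \<longleftrightarrow> (\<forall>y\<in>Y. \<bar>s y - c y\<bar> \<le> \<eta> * norm y)"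

text \<open>For fixed \<open>Y\<close> and \<open>\<eta>\<close> the covered sets form a \<open>\<sigma>\<close>-ideal; they take the place of null sets below.\<close>

definition countably_covered ::
    "'a::real_normed_vector set \<Rightarrow> real \<Rightarrow> ('a \<Rightarrow> real) set \<Rightarrow> bool" where
  "countably_covered Y \<eta> T \<longleftrightarrow>
     (\<exists>C. countable C \<and> C \<subseteq> dual_ball \<and> (\<forall>s\<in>T. \<exists>c\<in>C. close_on Y \<eta> s c))"

lemma countably_covered_subset: "countably_covered Y \<eta> T \<Longrightarrow> T' \<subseteq> T \<Longrightarrow> countably_covered Y \<eta> T'"
  unfolding countably_covered_def by blast

lemma countably_covered_empty: "countably_covered Y \<eta> {}"
  unfolding countably_covered_def by blast

lemma countably_covered_UN:
  assumes "countable I" "\<And>i. i \<in> I \<Longrightarrow> countably_covered Y \<eta> (T i)"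
  shows "countably_covered Y \<eta> (\<Union>i\<in>I. T i)"
proof -
  define P where "P = (\<lambda>i C. countable C \<and> C \<subseteq> dual_ball \<and>
    (\<forall>s\<in>T i. \<exists>c\<in>C. close_on Y \<eta> s c))"
  have "\<forall>i\<in>I. \<exists>C. P i C"
    using assms(2) by (simp add: countably_covered_def P_def)
  from bchoice[OF this] obtain C where C: "\<forall>i\<in>I. P i (C i)" by (rule exE)
  have 1: "countable (\<Union>i\<in>I. C i)" using assms(1) C by (simp add: P_def)
  have 2: "(\<Union>i\<in>I. C i) \<subseteq> dual_ball" using C by (auto simp: P_def)
  have "\<exists>c\<in>\<Union>i\<in>I. C i. close_on Y \<eta> s c" if "s \<in> (\<Union>i\<in>I. T i)" for s
    using that C unfolding P_def by blast
  then have 3: "\<forall>s\<in>(\<Union>i\<in>I. T i). \<exists>c\<in>(\<Union>i\<in>I. C i). close_on Y \<eta> s c" by (rule ballI)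
  show ?thesis unfolding countably_covered_def
    by (rule exI[of _ "\<Union>i\<in>I. C i"], rule conjI[OF 1 conjI[OF 2 3]])
qed

lemma countably_covered_Un:
  assumes "countably_covered Y \<eta> T" "countably_covered Y \<eta> T'"
  shows "countably_covered Y \<eta> (T \<union> T')"
proof -
  have "countably_covered Y \<eta> (\<Union>X\<in>{T, T'}. X)"
    using assms by (intro countably_covered_UN) auto
  then show ?thesis by simp
qed

text \<open>The essential supremum of \<open>s \<mapsto> s x\<close> over \<open>s \<in> T\<close>, with the covered sets as null sets.\<close>

definition ess_sup ::
    "'a::real_normed_vector set \<Rightarrow> real \<Rightarrow> ('a \<Rightarrow> real) set \<Rightarrow> 'a \<Rightarrow> real" where
  "ess_sup Y \<eta> T x = Inf {r. countably_covered Y \<eta> {s\<in>T. s x > r}}"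

context
  fixes Y :: "'a::real_normed_vector set" and \<eta> :: real and T :: "('a \<Rightarrow> real) set"
  assumes T: "T \<subseteq> dual_ball" "\<not> countably_covered Y \<eta> T"
begin

lemma ess_sup_ball: "s \<in> T \<Longrightarrow> \<bar>s x\<bar> \<le> norm x"
  using T(1) dual_ballD(2) by blast

lemma ess_sup_lower: "countably_covered Y \<eta> {s\<in>T. s x > r} \<Longrightarrow> - norm x \<le> r"
proof (rule ccontr)
  assume "countably_covered Y \<eta> {s\<in>T. s x > r}" "\<not> - norm x \<le> r"
  moreover have "s x > r" if "s \<in> T" for s
    using ess_sup_ball[OF that, of x] \<open>\<not> - norm x \<le> r\<close> by simp
  then have "{s\<in>T. s x > r} = T" by blast
  ultimately show False using T(2) by simp
qed

lemma ess_sup_norm_mem: "countably_covered Y \<eta> {s\<in>T. s x > norm x}"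
proof -
  have "\<not> s x > norm x" if "s \<in> T" for s
    using ess_sup_ball[OF that, of x] by simp
  then have "{s\<in>T. s x > norm x} = {}" by blast
  then show ?thesis using countably_covered_empty by metis
qed

lemma ess_sup_bdd: "bdd_below {r. countably_covered Y \<eta> {s\<in>T. s x > r}}"
  using ess_sup_lower by (intro bdd_belowI[of _ "- norm x"]) blast

lemma ess_sup_le: "countably_covered Y \<eta> {s\<in>T. s x > r} \<Longrightarrow> ess_sup Y \<eta> T x \<le> r"
  unfolding ess_sup_def using ess_sup_bdd by (intro cInf_lower) auto

lemma ess_sup_ge:
  assumes "\<And>r'. r' < r \<Longrightarrow> \<not> countably_covered Y \<eta> {s\<in>T. s x > r'}"
  shows "r \<le> ess_sup Y \<eta> T x"
  unfolding ess_sup_def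
proof (rule cInf_greatest)
  show "{r. countably_covered Y \<eta> {s\<in>T. s x > r}} \<noteq> {}" using ess_sup_norm_mem[of x] by blast
  show "r \<le> r'" if "r' \<in> {r. countably_covered Y \<eta> {s\<in>T. s x > r}}" for r'
    using assms[of r'] that by (cases "r' < r") auto
qed

lemma ess_sup_gt:
  assumes "r < ess_sup Y \<eta> T x"
  shows "\<not> countably_covered Y \<eta> {s\<in>T. s x > r}"
  using ess_sup_le assms by force

lemma ess_sup_null: "countably_covered Y \<eta> {s\<in>T. s x > ess_sup Y \<eta> T x}"
proof -
  let ?r = "\<lambda>n::nat. ess_sup Y \<eta> T x + inverse (real (Suc n))"
  have "countably_covered Y \<eta> {s\<in>T. s x > ?r n}" for n
  proof -
    let ?I = "{r. countably_covered Y \<eta> {s\<in>T. s x > r}}"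
    have "norm x \<in> ?I" using ess_sup_norm_mem[of x] by simp
    then have "?I \<noteq> {}" by (metis empty_iff)
    moreover have "Inf ?I < ?r n" by (simp add: ess_sup_def)
    ultimately have "\<exists>r\<in>?I. r < ?r n" by (rule cInf_lessD)
    then obtain r where "r \<in> ?I" and r2: "r < ?r n" by (rule bexE)
    then have r1: "countably_covered Y \<eta> {s\<in>T. s x > r}" by simp
    have "{s\<in>T. s x > ?r n} \<subseteq> {s\<in>T. s x > r}"
      using less_trans[OF r2] by blast
    with r1 show ?thesis by (rule countably_covered_subset)
  qed
  then have "countably_covered Y \<eta> (\<Union>n. {s\<in>T. s x > ?r n})"
    by (intro countably_covered_UN) auto
  moreover have "{s\<in>T. s x > ess_sup Y \<eta> T x} \<subseteq> (\<Union>n. {s\<in>T. s x > ?r n})"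
  proof
    fix s assume s: "s \<in> {s\<in>T. s x > ess_sup Y \<eta> T x}"
    then obtain n where "inverse (real (Suc n)) < s x - ess_sup Y \<eta> T x"
      using reals_Archimedean[of "s x - ess_sup Y \<eta> T x"] by auto
    then have "s x > ?r n" by linarith
    then have "s \<in> {s\<in>T. s x > ?r n}" using s by simp
    then show "s \<in> (\<Union>n. {s\<in>T. s x > ?r n})" by (rule UN_I[OF UNIV_I])
  qed
  ultimately show ?thesis by (rule countably_covered_subset)
qed

lemma ess_sup_abs_le: "\<bar>ess_sup Y \<eta> T x\<bar> \<le> norm x"
proof -
  have "- norm x \<le> ess_sup Y \<eta> T x" 
    using ess_sup_lower by (intro ess_sup_ge) force
  then show ?thesis using ess_sup_le[OF ess_sup_norm_mem, of x] by simp
qed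

lemma ess_sup_add: "ess_sup Y \<eta> T (x + y) \<le> ess_sup Y \<eta> T x + ess_sup Y \<eta> T y"
proof (rule ess_sup_le, rule countably_covered_subset[OF countably_covered_Un[OF ess_sup_null[of x] ess_sup_null[of y]]])
  show "{s \<in> T. ess_sup Y \<eta> T x + ess_sup Y \<eta> T y < s (x + y)}
    \<subseteq> {s \<in> T. ess_sup Y \<eta> T x < s x} \<union> {s \<in> T. ess_sup Y \<eta> T y < s y}"
  proof
    fix s assume s: "s \<in> {s \<in> T. ess_sup Y \<eta> T x + ess_sup Y \<eta> T y < s (x + y)}"
    then have "s (x + y) = s x + s y" using T(1) dual_ballD(3)[of s x y] by blast
    then show "s \<in> {s \<in> T. ess_sup Y \<eta> T x < s x} \<union> {s \<in> T. ess_sup Y \<eta> T y < s y}"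
      using s by auto
  qed
qed

lemma ess_sup_scale_le:
  assumes "c > 0" shows "ess_sup Y \<eta> T (c *\<^sub>R x) \<le> c * ess_sup Y \<eta> T x"
proof (rule ess_sup_le, rule countably_covered_subset[OF ess_sup_null[of x]])
  show "{s \<in> T. c * ess_sup Y \<eta> T x < s (c *\<^sub>R x)} \<subseteq> {s \<in> T. ess_sup Y \<eta> T x < s x}"
  proof
    fix s assume s: "s \<in> {s \<in> T. c * ess_sup Y \<eta> T x < s (c *\<^sub>R x)}"
    then have "s (c *\<^sub>R x) = c * s x" using T(1) dual_ballD(5)[of s c x] by blast
    then show "s \<in> {s \<in> T. ess_sup Y \<eta> T x < s x}" using s assms by simp
  qed
qed

lemma sublinear_ess_sup: "sublinear (ess_sup Y \<eta> T)"
proof -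
  have "ess_sup Y \<eta> T (c *\<^sub>R x) = c * ess_sup Y \<eta> T x" if "c \<ge> 0" for c x
  proof (cases "c = 0")
    case True then show ?thesis using ess_sup_abs_le[of 0] by simp
  next
    case False
    then have c: "c > 0" using that by simp
    then have "ess_sup Y \<eta> T x \<le> inverse c * ess_sup Y \<eta> T (c *\<^sub>R x)"
      using ess_sup_scale_le[of "inverse c" "c *\<^sub>R x"] by simp
    then have "c * ess_sup Y \<eta> T x \<le> ess_sup Y \<eta> T (c *\<^sub>R x)"
      using c by (simp add: field_simps)
    then show ?thesis using ess_sup_scale_le[OF c, of x] by simp
  qed
  then show ?thesis using ess_sup_add by (simp add: sublinear_def)
qed

text \<open>If the essential oscillation over \<open>T\<close> were at most \<open>\<eta> * norm y\<close> at every point \<open>y\<close> of the countable set \<open>D\<close>,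
then after removal of countably many null sets any two members of \<open>T\<close> would be \<open>\<eta>\<close>-close on \<open>D\<close>, hence on \<open>Y\<close>, and
\<open>T\<close> would be covered by a null set and a single ball.\<close>

lemma ess_sup_oscillation:
  assumes D: "countable D" "Y \<subseteq> closure D" and \<eta>: "\<eta> > 0"
  shows "\<exists>y\<in>D. ess_sup Y \<eta> T y + ess_sup Y \<eta> T (- y) > \<eta> * norm y"
proof (rule ccontr)
  assume "\<not> ?thesis"
  then have osc: "ess_sup Y \<eta> T y + ess_sup Y \<eta> T (- y) \<le> \<eta> * norm y" if "y \<in> D" for y
    using that by force
  define R where "R = (\<Union>y\<in>D. {s\<in>T. s y > ess_sup Y \<eta> T y} \<union> {s\<in>T. s (- y) > ess_sup Y \<eta> T (- y)})"
  have R: "countably_covered Y \<eta> R" unfolding R_def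
    by (intro countably_covered_UN D countably_covered_Un ess_sup_null)
  have "\<not> T \<subseteq> R" using T(2) R countably_covered_subset by blast
  then obtain c where c: "c \<in> T" "c \<notin> R" by blast
  have close: "\<bar>s y - c y\<bar> \<le> \<eta> * norm y" if s: "s \<in> T - R" and y: "y \<in> closure D" for s y
  proof -
    have D': "s z - c z \<le> \<eta> * norm z \<and> c z - s z \<le> \<eta> * norm z" if "z \<in> D" for z
    proof -
      have "s (- z) = - s z" "c (- z) = - c z"
        using dual_ballD(6)[of s z] dual_ballD(6)[of c z] s c T(1) by auto
      moreover have "s z \<le> ess_sup Y \<eta> T z" "s (- z) \<le> ess_sup Y \<eta> T (- z)"
        "c z \<le> ess_sup Y \<eta> T z" "c (- z) \<le> ess_sup Y \<eta> T (- z)"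
        using s c that by (auto simp: R_def not_less)
      ultimately show ?thesis using osc[OF that] by simp
    qed
    obtain z where z: "\<And>n. z n \<in> D" "z \<longlonglongrightarrow> y" using y closure_sequential by blast
    have cont: "(\<lambda>n. f (z n)) \<longlonglongrightarrow> f y" if "f \<in> dual_ball" for f
    proof -
      have "bounded_linear f" using dual_ballD(1,2)[OF that]
        by (intro bounded_linear_intro[of f 1]) (auto simp: linear_add linear_scale)
      then show ?thesis using z(2) by (rule bounded_linear.tendsto)
    qed
    have "(\<lambda>n. \<bar>s (z n) - c (z n)\<bar>) \<longlonglongrightarrow> \<bar>s y - c y\<bar>"
      using s c(1) T(1) by (intro tendsto_intros cont) auto
    moreover have "(\<lambda>n. \<eta> * norm (z n)) \<longlonglongrightarrow> \<eta> * norm y" by (intro tendsto_intros z)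
    ultimately show ?thesis
      using D'[OF z(1)] by (intro LIMSEQ_le) (auto simp: abs_le_iff)
  qed
  have "countably_covered Y \<eta> (T - R)"
    unfolding countably_covered_def close_on_def
    using close c(1) T(1) D(2) by (intro exI[of _ "{c}"]) auto
  from countably_covered_Un[OF this R] have "countably_covered Y \<eta> T"
    by (rule countably_covered_subset) blast
  then show False using T(2) by blast
qed

end

text \<open>Let \<open>h\<close> be the essential supremum over the dual ball. The functionals that almost attain \<open>h x\<close> are not
null, so by the previous lemma they oscillate by more than \<open>\<eta>\<close> in some direction \<open>y \<in> D\<close>. Hence
\<open>h (x + \<tau> y) + h (x - \<tau> y) - 2 h x\<close> is at least \<open>\<eta> \<tau> norm y\<close> up to an arbitrarily small error, at every
\<open>x\<close> and every scale, and \<open>h\<close> is nowhere Frechet differentiable.\<close>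

lemma dual_ball_countably_covered:
  fixes D :: "'a::banach set"
  assumes asp: "asplund_space TYPE('a)" and D: "countable D" "Y \<subseteq> closure D" and \<eta>: "\<eta> > 0"
  shows "countably_covered Y \<eta> (dual_ball :: ('a \<Rightarrow> real) set)"
proof (rule ccontr)
  let ?B = "dual_ball :: ('a \<Rightarrow> real) set"
  assume B: "\<not> countably_covered Y \<eta> ?B"
  define h where "h = ess_sup Y \<eta> ?B"
  note B' = subset_refl[of ?B] B
  have sub: "sublinear h" unfolding h_def by (rule sublinear_ess_sup[OF B'])
  have conv: "convex_on UNIV h"
  proof (rule convex_onI)
    fix t :: real and x y assume "0 < t" "t < 1"
    then show "h ((1 - t) *\<^sub>R x + t *\<^sub>R y) \<le> (1 - t) * h x + t * h y"
      using sublinear_add[OF sub, of "(1 - t) *\<^sub>R x" "t *\<^sub>R y"]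
        sublinear_scale[OF sub, of "1 - t" x] sublinear_scale[OF sub, of t y] by simp
  qed simp
  have lip: "\<bar>h x - h y\<bar> \<le> norm (x - y)" for x y
    using sublinear_add[OF sub, of "x - y" y] sublinear_add[OF sub, of "y - x" x]
      ess_sup_abs_le[OF B', of "x - y"] ess_sup_abs_le[OF B', of "y - x"]
    by (simp add: h_def[symmetric] norm_minus_commute)
  have cont: "continuous_on UNIV h"
  proof (rule lipschitz_on_continuous_on[of 1])
    show "1-lipschitz_on UNIV h"
      by (rule lipschitz_onI) (use lip in \<open>auto simp: dist_norm\<close>)
  qed
  obtain S where S: "UNIV \<subseteq> closure S" "\<forall>x\<in>S. h differentiable (at x)"
    using asp[unfolded asplund_space_def, rule_format, of UNIV h] conv cont by auto
  then have "S \<noteq> {}" by auto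
  then obtain x where "h differentiable (at x)" using S(2) by blast
  then obtain L where L: "(h has_derivative L) (at x)" unfolding differentiable_def by blast
  then have "bounded_linear L" by (rule has_derivative_bounded_linear)
  then have Lneg: "L (- k) = - L k" for k by (simp add: linear_simps)
  obtain \<delta> where \<delta>: "\<delta> > 0" "\<And>z. norm (z - x) < \<delta> \<Longrightarrow> norm (h z - h x - L (z - x)) \<le> \<eta> / 4 * norm (z - x)"
    using L \<eta> unfolding has_derivative_at_alt by (metis divide_pos_pos zero_less_numeral)
  define \<sigma> where "\<sigma> = \<delta> / 2"
  have \<sigma>: "\<sigma> > 0" "\<sigma> < \<delta>" using \<delta> by (auto simp: \<sigma>_def)
  define T where "T = {s\<in>?B. s x > h x - \<eta> * \<sigma> / 8}"
  have "\<eta> * \<sigma> / 8 > 0" using \<eta> \<sigma> by simp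
  then have T: "T \<subseteq> ?B" "\<not> countably_covered Y \<eta> T"
    unfolding T_def using ess_sup_gt[OF B', of "h x - \<eta> * \<sigma> / 8" x] by (auto simp: h_def)
  obtain y where y: "ess_sup Y \<eta> T y + ess_sup Y \<eta> T (- y) > \<eta> * norm y"
    using ess_sup_oscillation[OF T D \<eta>] by blast
  have "y \<noteq> 0" using y sublinear_zero[OF sublinear_ess_sup[OF T]] by auto
  \<comment> \<open>Restricting to the near-maximisers \<open>T\<close> costs the margin in the definition of \<open>T\<close> and bounds \<open>h\<close> from below on the line through \<open>x\<close>.\<close>
  have step: "h (x + \<tau> *\<^sub>R z) \<ge> h x - \<eta> * \<sigma> / 8 + \<tau> * ess_sup Y \<eta> T z" if \<tau>: "\<tau> > 0" for \<tau> z
    unfolding h_def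
  proof (rule ess_sup_ge[OF B'], fold h_def)
    fix r assume r: "r < h x - \<eta> * \<sigma> / 8 + \<tau> * ess_sup Y \<eta> T z"
    define r' where "r' = (r - h x + \<eta> * \<sigma> / 8) / \<tau>"
    have "r' < ess_sup Y \<eta> T z" using r \<tau> by (simp add: r'_def field_simps)
    from ess_sup_gt[OF T this] have n: "\<not> countably_covered Y \<eta> {s \<in> T. r' < s z}" .
    have "{s \<in> T. r' < s z} \<subseteq> {s \<in> ?B. r < s (x + \<tau> *\<^sub>R z)}"
    proof
      fix s assume s: "s \<in> {s \<in> T. r' < s z}"
      then have sB: "s \<in> ?B" and "s x > h x - \<eta> * \<sigma> / 8" "r' < s z" by (auto simp: T_def)
      moreover from this(3) have "r - h x + \<eta> * \<sigma> / 8 < \<tau> * s z"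
        using \<tau> by (simp add: r'_def field_simps)
      ultimately show "s \<in> {s \<in> ?B. r < s (x + \<tau> *\<^sub>R z)}"
        using dual_ballD(3,5)[OF sB] by simp
    qed
    then show "\<not> countably_covered Y \<eta> {s \<in> ?B. r < s (x + \<tau> *\<^sub>R z)}"
      using n countably_covered_subset by blast
  qed
  define \<tau> where "\<tau> = \<sigma> / norm y"
  have \<tau>: "\<tau> > 0" "\<tau> * norm y = \<sigma>" using \<sigma> \<open>y \<noteq> 0\<close> by (auto simp: \<tau>_def)
  have "h (x + \<tau> *\<^sub>R y) + h (x + \<tau> *\<^sub>R (- y)) \<ge> 2 * h x - \<eta> * \<sigma> / 4 + \<tau> * (ess_sup Y \<eta> T y + ess_sup Y \<eta> T (- y))"
    using step[OF \<tau>(1), of y] step[OF \<tau>(1), of "- y"] by (simp add: algebra_simps)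
  moreover have "\<tau> * (ess_sup Y \<eta> T y + ess_sup Y \<eta> T (- y)) \<ge> \<eta> * \<sigma>"
  proof -
    have "\<tau> * (\<eta> * norm y) \<le> \<tau> * (ess_sup Y \<eta> T y + ess_sup Y \<eta> T (- y))"
      using y \<tau>(1) by (intro mult_left_mono) auto
    then show ?thesis using \<tau>(2) by (metis mult.left_commute)
  qed
  moreover have "\<bar>h (x + \<tau> *\<^sub>R y) - h x - L (\<tau> *\<^sub>R y)\<bar> \<le> \<eta> / 4 * \<sigma>"
    "\<bar>h (x + \<tau> *\<^sub>R (- y)) - h x + L (\<tau> *\<^sub>R y)\<bar> \<le> \<eta> / 4 * \<sigma>"
    using \<delta>(2)[of "x + \<tau> *\<^sub>R y"] \<delta>(2)[of "x + \<tau> *\<^sub>R (- y)"] \<tau> \<sigma> Lneg[of "\<tau> *\<^sub>R y"] by auto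
  ultimately have "\<eta> * \<sigma> \<le> \<eta> * \<sigma> / 4 + \<eta> / 4 * \<sigma> + \<eta> / 4 * \<sigma>" by linarith
  then show False using \<eta> \<sigma> by (simp add: field_simps)
qed

lemma separable_dual:
  fixes D :: "'a::banach set"
  assumes asp: "asplund_space TYPE('a)" and D: "countable D" "Y \<subseteq> closure D"
  shows "\<exists>c :: nat \<Rightarrow> 'a \<Rightarrow> real. (\<forall>n. c n \<in> dual_ball) \<and>
    (\<forall>s\<in>dual_ball. \<forall>\<eta>>0. \<exists>n. close_on Y \<eta> s (c n))"
proof -
  define P where "P = (\<lambda>(k::nat) C. countable C \<and> C \<subseteq> dual_ball \<and>
    (\<forall>s\<in>dual_ball. \<exists>c\<in>C. close_on Y (inverse (real (Suc k))) s c))"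
  have "\<forall>k. \<exists>C. P k C"
    using dual_ball_countably_covered[OF asp D] by (simp add: countably_covered_def P_def)
  from choice[OF this] obtain C where "\<forall>k. P k (C k)" by (rule exE)
  then have C: "\<And>k. countable (C k)" "\<And>k. C k \<subseteq> dual_ball"
    "\<And>k s. s \<in> dual_ball \<Longrightarrow> \<exists>c\<in>C k. close_on Y (inverse (real (Suc k))) s c"
    by (simp_all add: P_def)
  have "(\<lambda>x. 0) \<in> (dual_ball :: ('a \<Rightarrow> real) set)" by (simp add: dual_ball_def linear_zero)
  then have ne: "(\<Union>k. C k) \<noteq> {}" using C(3) by blast
  have cnt: "countable (\<Union>k. C k)" using C(1) by simp
  let ?c = "from_nat_into (\<Union>k. C k)"
  show ?thesis
  proof (intro exI[of _ ?c] conjI)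
    show "\<forall>n. ?c n \<in> dual_ball" using from_nat_into[OF ne] C(2) by blast
    have "\<exists>n. close_on Y \<eta> s (?c n)" if s: "s \<in> dual_ball" "\<eta> > 0" for s :: "'a \<Rightarrow> real" and \<eta> :: real
    proof -
    obtain k where k: "inverse (real (Suc k)) < \<eta>" using reals_Archimedean[OF s(2)] by blast
    obtain c where c: "c \<in> C k" "close_on Y (inverse (real (Suc k))) s c"
      using C(3)[OF s(1)] by blast
    obtain n where n: "?c n = c" using from_nat_into_surj[OF cnt, of c] c(1) by blast
    have "\<bar>s y - c y\<bar> \<le> \<eta> * norm y" if "y \<in> Y" for y
    proof -
      have "inverse (real (Suc k)) * norm y \<le> \<eta> * norm y"
        using k by (intro mult_right_mono) auto
      then show ?thesis using c(2) that by (force simp: close_on_def)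
    qed
    then show ?thesis using n by (intro exI[of _ n]) (simp add: close_on_def)
    qed
    then show "\<forall>s\<in>dual_ball. \<forall>\<eta>>0. \<exists>n. close_on Y \<eta> s (?c n)" by simp
  qed
qed

section \<open>A gauge that is differentiable along a separable subspace\<close>

lemma dual_ballI: "linear f \<Longrightarrow> (\<And>x. \<bar>f x\<bar> \<le> norm x) \<Longrightarrow> f \<in> dual_ball"
  by (simp add: dual_ball_def)

lemma dual_ball_scale:
  assumes f: "f \<in> dual_ball" and le: "\<And>x. \<bar>c\<bar> * \<bar>f x\<bar> \<le> norm x"
  shows "(\<lambda>x. c * f x) \<in> dual_ball"
proof (rule dual_ballI)
  show "linear (\<lambda>x. c * f x)"
    by (rule linearI) (simp_all add: dual_ballD(3,5)[OF f] algebra_simps)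
qed (simp add: le abs_mult)

lemma dual_ball_mid:
  assumes f: "f \<in> dual_ball" and g: "g \<in> dual_ball"
  shows "(\<lambda>x. (f x + g x) / 2) \<in> dual_ball"
proof (rule dual_ballI)
  show "linear (\<lambda>x. (f x + g x) / 2)"
    by (rule linearI) (simp_all add: dual_ballD(3,5)[OF f] dual_ballD(3,5)[OF g] field_simps)
  show "\<bar>(f x + g x) / 2\<bar> \<le> norm x" for x
    using dual_ballD(2)[OF f, of x] dual_ballD(2)[OF g, of x] by (simp add: abs_le_iff)
qed

lemma dual_ball_bounded_linear:
  assumes f: "f \<in> dual_ball" shows "bounded_linear f"
  using dual_ballD(2)[OF f] by (intro bounded_linear_intro[of f 1]) (simp_all add: dual_ballD(3,5)[OF f])

text \<open>Banach-Alaoglu.\<close>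

lemma compact_dual_ball: "compact (dual_ball :: ('a::real_normed_vector \<Rightarrow> real) set)"
proof -
  let ?P = "PiE UNIV (\<lambda>x::'a. {- norm x..norm x})"
  have "compactin (product_topology (\<lambda>i. euclidean) UNIV) ?P"
    by (simp add: compactin_PiE)
  then have P: "compact ?P" by (simp add: euclidean_product_topology)
  have ev: "continuous_on UNIV (\<lambda>f::'a \<Rightarrow> real. f x)" for x
    by (rule continuous_on_product_coordinates)
  have eq: "dual_ball = ?P \<inter> (\<Inter>x. \<Inter>y. {f. f (x + y) = f x + f y}) \<inter> (\<Inter>c. \<Inter>x. {f. f (c *\<^sub>R x) = c * f x})"
  proof -
    have "f \<in> dual_ball \<longleftrightarrow> (f \<in> ?P \<and> (\<forall>x y. f (x + y) = f x + f y)) \<and> (\<forall>c x. f (c *\<^sub>R x) = c * f x)"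
      for f :: "'a \<Rightarrow> real"
    proof -
      have P: "(\<forall>x. \<bar>f x\<bar> \<le> norm x) \<longleftrightarrow> f \<in> ?P"
        by (simp add: PiE_UNIV_domain Pi_def abs_le_iff minus_le_iff conj_commute)
      have L: "linear f \<longleftrightarrow> (\<forall>x y. f (x + y) = f x + f y) \<and> (\<forall>c x. f (c *\<^sub>R x) = c * f x)"
        by (simp add: linear_iff)
      show ?thesis unfolding dual_ball_def mem_Collect_eq L P by (simp only: conj_ac)
    qed
    then show ?thesis by (intro set_eqI) (simp only: Int_iff INT_iff mem_Collect_eq ball_UNIV)
  qed
  have cl: "closed ((\<Inter>x. \<Inter>y. {f::'a \<Rightarrow> real. f (x + y) = f x + f y}) \<inter> (\<Inter>c. \<Inter>x. {f::'a \<Rightarrow> real. f (c *\<^sub>R x) = c * f x}))"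
    by (intro closed_Int closed_INT ballI closed_Collect_eq continuous_intros ev)
  from compact_Int_closed[OF P cl] show ?thesis by (simp only: eq Int_assoc)
qed

definition sup_on :: "'a set \<Rightarrow> ('a \<Rightarrow> real) \<Rightarrow> real" where
  "sup_on W f = (SUP w\<in>W. \<bar>f w\<bar>)"

context
  fixes W :: "'a::real_normed_vector set"
  assumes W: "0 \<in> W" "W \<subseteq> cball 0 1"
begin

lemma sup_on_bdd: "f \<in> dual_ball \<Longrightarrow> bdd_above ((\<lambda>w. \<bar>f w\<bar>) ` W)"
proof (intro bdd_aboveI2)
  fix w assume f: "f \<in> dual_ball" "w \<in> W"
  then show "\<bar>f w\<bar> \<le> 1" using dual_ballD(2)[OF f(1), of w] W(2) by auto
qed

lemma sup_on_upper: "f \<in> dual_ball \<Longrightarrow> w \<in> W \<Longrightarrow> \<bar>f w\<bar> \<le> sup_on W f"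
  unfolding sup_on_def by (rule cSUP_upper[OF _ sup_on_bdd])

lemma sup_on_least: "(\<And>w. w \<in> W \<Longrightarrow> \<bar>f w\<bar> \<le> r) \<Longrightarrow> sup_on W f \<le> r"
  unfolding sup_on_def using W(1) by (intro cSUP_least) auto

lemma sup_on_nonneg: "f \<in> dual_ball \<Longrightarrow> 0 \<le> sup_on W f"
  using sup_on_upper[OF _ W(1)] abs_ge_zero order_trans by blast

lemma sup_on_le_1: "f \<in> dual_ball \<Longrightarrow> sup_on W f \<le> 1"
proof (rule sup_on_least)
  fix w assume f: "f \<in> dual_ball" "w \<in> W"
  then show "\<bar>f w\<bar> \<le> 1" using dual_ballD(2)[OF f(1), of w] W(2) by auto
qed

lemma sup_on_scale:
  assumes f: "f \<in> dual_ball"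
  shows "sup_on W (\<lambda>x. c * f x) = \<bar>c\<bar> * sup_on W f"
proof (cases "c = 0")
  case True
  moreover have "W \<noteq> {}" using W(1) by blast
  ultimately show ?thesis by (simp add: sup_on_def cSUP_const)
next
  case False
  have "sup_on W (\<lambda>x. c * f x) \<le> \<bar>c\<bar> * sup_on W f"
    by (rule sup_on_least) (simp add: abs_mult mult_left_mono sup_on_upper[OF f])
  moreover have "sup_on W f \<le> sup_on W (\<lambda>x. c * f x) / \<bar>c\<bar>"
  proof (rule sup_on_least)
    fix w assume w: "w \<in> W"
    have "bdd_above ((\<lambda>w. \<bar>c * f w\<bar>) ` W)"
    proof (intro bdd_aboveI2)
      fix w assume "w \<in> W"
      then show "\<bar>c * f w\<bar> \<le> \<bar>c\<bar> * sup_on W f"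
        by (simp add: abs_mult mult_left_mono sup_on_upper[OF f])
    qed
    then have "\<bar>c * f w\<bar> \<le> sup_on W (\<lambda>x. c * f x)"
      unfolding sup_on_def using w by (intro cSUP_upper)
    then show "\<bar>f w\<bar> \<le> sup_on W (\<lambda>x. c * f x) / \<bar>c\<bar>"
      using False by (simp add: field_simps abs_mult)
  qed
  then have "\<bar>c\<bar> * sup_on W f \<le> sup_on W (\<lambda>x. c * f x)"
    using False by (simp add: field_simps)
  ultimately show ?thesis by simp
qed

lemma sup_on_mid_le:
  assumes f: "f \<in> dual_ball" and g: "g \<in> dual_ball"
  shows "sup_on W (\<lambda>x. (f x + g x) / 2) \<le> (sup_on W f + sup_on W g) / 2"
proof (rule sup_on_least)
  fix w assume w: "w \<in> W"
  show "\<bar>(f w + g w) / 2\<bar> \<le> (sup_on W f + sup_on W g) / 2"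
    using sup_on_upper[OF f w] sup_on_upper[OF g w] by (simp add: abs_le_iff)
qed

text \<open>Quantitative strict convexity of the square: if the midpoint is almost as large as \<open>f\<close> and \<open>g\<close>, then the two
seminorm values almost agree.\<close>

lemma sup_on_gap:
  assumes f: "f \<in> dual_ball" and g: "g \<in> dual_ball"
  shows "((sup_on W f - sup_on W g) / 2)\<^sup>2 \<le>
    (sup_on W f)\<^sup>2 / 2 + (sup_on W g)\<^sup>2 / 2 - (sup_on W (\<lambda>x. (f x + g x) / 2))\<^sup>2"
proof -
  have "(sup_on W (\<lambda>x. (f x + g x) / 2))\<^sup>2 \<le> ((sup_on W f + sup_on W g) / 2)\<^sup>2"
    by (intro power_mono sup_on_mid_le f g sup_on_nonneg dual_ball_mid)
  then show ?thesis by (simp add: power2_eq_square field_simps)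
qed

lemma sup_on_approx:
  assumes f: "f \<in> dual_ball"
  obtains v :: "nat \<Rightarrow> 'a" where "\<And>k. v k \<in> W" "(\<lambda>k. \<bar>f (v k)\<bar>) \<longlonglongrightarrow> sup_on W f"
proof -
  have "\<exists>w\<in>W. sup_on W f - inverse (real (Suc k)) < \<bar>f w\<bar>" for k :: nat
    using less_cSUP_iff[OF _ sup_on_bdd[OF f], of "sup_on W f - inverse (real (Suc k))"] W(1)
    by (auto simp: sup_on_def)
  then obtain v where v: "\<And>k. v k \<in> W" "\<And>k. sup_on W f - inverse (real (Suc k)) < \<bar>f (v k)\<bar>"
    by metis
  have "(\<lambda>k. sup_on W f - inverse (real (Suc k))) \<longlonglongrightarrow> sup_on W f - 0"
    by (intro tendsto_intros LIMSEQ_inverse_real_of_nat)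
  then have lim: "(\<lambda>k. sup_on W f - inverse (real (Suc k))) \<longlonglongrightarrow> sup_on W f" by simp
  have "(\<lambda>k. \<bar>f (v k)\<bar>) \<longlonglongrightarrow> sup_on W f"
  proof (rule tendsto_sandwich[OF _ _ lim tendsto_const])
    show "\<forall>\<^sub>F k in sequentially. sup_on W f - inverse (real (Suc k)) \<le> \<bar>f (v k)\<bar>"
      using v(2) by (intro always_eventually allI less_imp_le)
    show "\<forall>\<^sub>F k in sequentially. \<bar>f (v k)\<bar> \<le> sup_on W f"
      using sup_on_upper[OF f v(1)] by (intro always_eventually allI)
  qed
  then show ?thesis using that v(1) by blast
qed

end

lemma sup_on_pair:
  assumes "f \<in> dual_ball"
  shows "sup_on {0, d} f = \<bar>f d\<bar>"
  unfolding sup_on_def using dual_ballD(7)[OF assms] by (intro cSup_eq_maximum) auto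

definition square_sum :: "(nat \<Rightarrow> 'a set) \<Rightarrow> ('a \<Rightarrow> real) \<Rightarrow> real" where
  "square_sum W f = (\<Sum>n. (1/2)^n * (sup_on (W n) f)\<^sup>2)"

text \<open>The unit ball of the dual norm whose square is \<open>square_sum W\<close>.\<close>

definition square_ball :: "(nat \<Rightarrow> 'a::real_normed_vector set) \<Rightarrow> ('a \<Rightarrow> real) set" where
  "square_ball W = {f \<in> dual_ball. square_sum W f \<le> 1}"

lemma square_ballD: "f \<in> square_ball W \<Longrightarrow> f \<in> dual_ball" "f \<in> square_ball W \<Longrightarrow> square_sum W f \<le> 1"
  by (auto simp: square_ball_def)

text \<open>The support function of \<open>square_ball W\<close>, that is, the predual gauge.\<close>

definition square_gauge :: "(nat \<Rightarrow> 'a::real_normed_vector set) \<Rightarrow> 'a \<Rightarrow> real" where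
  "square_gauge W x = (SUP f\<in>square_ball W. f x)"

context
  fixes W :: "nat \<Rightarrow> 'a::real_normed_vector set"
  assumes W: "\<And>n. 0 \<in> W n" "\<And>n. W n \<subseteq> cball 0 1" and W0: "W 0 = cball 0 1"
begin

lemma square_term_le: "f \<in> dual_ball \<Longrightarrow> (1/2)^n * (sup_on (W n) f)\<^sup>2 \<le> (1/2)^n"
  using sup_on_nonneg[OF W] sup_on_le_1[OF W] by (simp add: abs_square_le_1)

lemma summable_half: "summable (\<lambda>n. (1/2::real)^n)" 
  by (rule summable_geometric) simp

lemma square_summable: "f \<in> dual_ball \<Longrightarrow> summable (\<lambda>n. (1/2)^n * (sup_on (W n) f)\<^sup>2)"
  using square_term_le by (intro summable_comparison_test'[OF summable_half, of 0]) simp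

lemma square_sum_le_2: "f \<in> dual_ball \<Longrightarrow> square_sum W f \<le> 2"
proof -
  assume f: "f \<in> dual_ball"
  have "square_sum W f \<le> (\<Sum>n. (1/2)^n)" unfolding square_sum_def
    by (rule suminf_le[OF square_term_le[OF f] square_summable[OF f] summable_half])
  also have "\<dots> = 2" using suminf_geometric[of "1/2::real"] by simp
  finally show ?thesis .
qed

lemma square_term_le_sum: "f \<in> dual_ball \<Longrightarrow> (1/2)^n * (sup_on (W n) f)\<^sup>2 \<le> square_sum W f"
  unfolding square_sum_def
  using sum_le_suminf[OF square_summable, of f "{n}"] by simp

lemma square_sum_nonneg: "f \<in> dual_ball \<Longrightarrow> 0 \<le> square_sum W f"
  unfolding square_sum_def by (rule suminf_nonneg[OF square_summable]) auto

lemma square_sum_scale: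
  assumes f: "f \<in> dual_ball"
  shows "square_sum W (\<lambda>x. c * f x) = c\<^sup>2 * square_sum W f"
  unfolding square_sum_def
  by (subst suminf_mult[OF square_summable[OF f], symmetric])
    (simp add: sup_on_scale[OF W f] power_mult_distrib mult.left_commute)

lemma abs_le_square_sum:
  assumes f: "f \<in> dual_ball"
  shows "\<bar>f x\<bar> \<le> sqrt (square_sum W f) * norm x"
proof (cases "x = 0")
  case False
  define w where "w = x /\<^sub>R norm x"
  have "w \<in> W 0" using False by (simp add: W0 w_def)
  then have "\<bar>f w\<bar> \<le> sup_on (W 0) f" by (rule sup_on_upper[OF W f])
  then have "\<bar>f w\<bar>\<^sup>2 \<le> (sup_on (W 0) f)\<^sup>2" by (intro power_mono) auto
  also have "\<dots> \<le> square_sum W f" using square_term_le_sum[OF f, of 0] by simp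
  finally have "\<bar>f w\<bar> \<le> sqrt (square_sum W f)" by (rule real_le_rsqrt)
  moreover have "f x = norm x * f w" using dual_ballD(5)[OF f, of "norm x" w] False by (simp add: w_def)
  ultimately show ?thesis by (simp add: abs_mult mult.commute mult_left_mono)
qed (simp add: dual_ballD(7)[OF f])

text \<open>Only finitely many evaluations occur in each of the inequalities on the right, so this displays the ball as a closed
set for pointwise convergence.\<close>

lemma square_ball_eq:
  "square_ball W = dual_ball \<inter> (\<Inter>M. \<Inter>v\<in>{v. \<forall>n. v n \<in> W n}. {f. (\<Sum>n<M. (1/2)^n * (f (v n))\<^sup>2) \<le> 1})"
  (is "_ = ?R")
proof
  show "square_ball W \<subseteq> ?R"
  proof
    fix f assume f: "f \<in> square_ball W"
    note fb = square_ballD(1)[OF f]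
    have "(\<Sum>n<M. (1/2)^n * (f (v n))\<^sup>2) \<le> 1" if v: "\<forall>n. v n \<in> W n" for M :: nat and v
    proof -
      have "(\<Sum>n<M. (1/2)^n * (f (v n))\<^sup>2) \<le> (\<Sum>n<M. (1/2)^n * (sup_on (W n) f)\<^sup>2)"
      proof (intro sum_mono mult_left_mono)
        fix n
        have "\<bar>f (v n)\<bar> \<le> sup_on (W n) f" using v sup_on_upper[OF W fb] by blast
        then have "\<bar>f (v n)\<bar>\<^sup>2 \<le> (sup_on (W n) f)\<^sup>2" by (intro power_mono) auto
        then show "(f (v n))\<^sup>2 \<le> (sup_on (W n) f)\<^sup>2" by simp
      qed simp
      also have "\<dots> \<le> square_sum W f" unfolding square_sum_def
        by (rule sum_le_suminf[OF square_summable[OF fb]]) auto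
      finally show ?thesis using square_ballD(2)[OF f] by simp
    qed
    then show "f \<in> ?R" using fb by blast
  qed
  show "?R \<subseteq> square_ball W"
  proof
    fix f assume "f \<in> ?R"
    then have fb: "f \<in> dual_ball"
      and le: "\<And>M v. (\<forall>n. v n \<in> W n) \<Longrightarrow> (\<Sum>n<M. (1/2)^n * (f (v n))\<^sup>2) \<le> 1" by blast+
    have "\<forall>n. \<exists>v::nat \<Rightarrow> 'a. (\<forall>k. v k \<in> W n) \<and> (\<lambda>k. \<bar>f (v k)\<bar>) \<longlonglongrightarrow> sup_on (W n) f"
      using sup_on_approx[OF W fb] by metis
    from choice[OF this] obtain v :: "nat \<Rightarrow> nat \<Rightarrow> 'a" where v: "\<And>n k. v n k \<in> W n"
      "\<And>n. (\<lambda>k. \<bar>f (v n k)\<bar>) \<longlonglongrightarrow> sup_on (W n) f" by blast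
    have "(\<Sum>n<M. (1/2)^n * (sup_on (W n) f)\<^sup>2) \<le> 1" for M
    proof (rule LIMSEQ_le_const2)
      show "(\<lambda>k. \<Sum>n<M. (1/2)^n * \<bar>f (v n k)\<bar>\<^sup>2) \<longlonglongrightarrow> (\<Sum>n<M. (1/2)^n * (sup_on (W n) f)\<^sup>2)"
        by (intro tendsto_intros v)
      show "\<exists>N. \<forall>k\<ge>N. (\<Sum>n<M. (1/2)^n * \<bar>f (v n k)\<bar>\<^sup>2) \<le> 1"
        using le[of "\<lambda>n. v n k" M for k] v(1) by simp
    qed
    then have "square_sum W f \<le> 1" unfolding square_sum_def
      by (intro suminf_le_const square_summable fb)
    then show "f \<in> square_ball W" using fb by (simp add: square_ball_def)
  qed
qed

lemma compact_square_ball: "compact (square_ball W)"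
proof -
  have ev: "continuous_on UNIV (\<lambda>f::'a \<Rightarrow> real. f x)" for x
    by (rule continuous_on_product_coordinates)
  have "closed (\<Inter>M. \<Inter>v\<in>{v. \<forall>n. v n \<in> W n}. {f. (\<Sum>n<M. (1/2)^n * (f (v n))\<^sup>2) \<le> (1::real)})"
    by (intro closed_INT ballI closed_Collect_le continuous_intros ev)
  then show ?thesis unfolding square_ball_eq
    by (rule compact_Int_closed[OF compact_dual_ball])
qed

text \<open>The weights add up to \<open>2\<close>, so halving a functional divides the sum of squares, at most \<open>2\<close>, by \<open>4\<close>.\<close>

lemma half_mem_square_ball:
  assumes f: "f \<in> dual_ball" shows "(\<lambda>x. (1/2) * f x) \<in> square_ball W"
proof -
  have "(\<lambda>x. (1/2) * f x) \<in> dual_ball"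
  proof (rule dual_ball_scale[OF f])
    show "\<bar>1/2\<bar> * \<bar>f x\<bar> \<le> norm x" for x using dual_ballD(2)[OF f, of x] by simp
  qed
  then show ?thesis using square_sum_scale[OF f, of "1/2"] square_sum_le_2[OF f]
    by (simp add: square_ball_def power2_eq_square)
qed

lemma square_gauge_attained:
  obtains f where "f \<in> square_ball W" "f x = square_gauge W x"
proof -
  obtain f0 :: "'a \<Rightarrow> real" where "linear f0" "\<And>x. \<bar>f0 x\<bar> \<le> norm x" using norming_functional[of 0] by blast
  from half_mem_square_ball[OF dual_ballI[OF this]] have "square_ball W \<noteq> {}" by (metis empty_iff)
  moreover have "continuous_on (square_ball W) (\<lambda>f. f x)"
    by (rule continuous_on_subset[OF continuous_on_product_coordinates subset_UNIV])
  ultimately obtain f where f: "f \<in> square_ball W" "\<forall>g\<in>square_ball W. g x \<le> f x"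
    using continuous_attains_sup[OF compact_square_ball] by blast
  then have "f x = square_gauge W x" unfolding square_gauge_def
    by (intro cSup_eq_maximum[symmetric]) auto
  then show ?thesis using that f(1) by blast
qed

lemma square_gauge_upper:
  assumes "f \<in> square_ball W" shows "f x \<le> square_gauge W x"
proof -
  have "f x \<le> norm x" if "f \<in> square_ball W" for f
    using dual_ballD(2)[OF square_ballD(1)[OF that], of x] by simp
  then have "bdd_above ((\<lambda>f. f x) ` square_ball W)" by (intro bdd_aboveI2)
  then show ?thesis unfolding square_gauge_def using assms by (rule cSUP_upper[rotated])
qed

lemma square_gauge_le_norm: "square_gauge W x \<le> norm x"
proof -
  obtain f where f: "f \<in> square_ball W" "f x = square_gauge W x" by (rule square_gauge_attained)
  then show ?thesis using dual_ballD(2)[OF square_ballD(1)[OF f(1)], of x] by simp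
qed

lemma square_gauge_ge_norm: "norm x / 2 \<le> square_gauge W x"
proof -
  obtain f where f: "linear f" "\<And>z. \<bar>f z\<bar> \<le> norm z" "f x = norm x" using norming_functional by blast
  show ?thesis using square_gauge_upper[OF half_mem_square_ball[OF dual_ballI[OF f(1,2)]], of x] f(3) by simp
qed

lemma square_gauge_add: "square_gauge W (x + y) \<le> square_gauge W x + square_gauge W y"
proof -
  obtain f where f: "f \<in> square_ball W" "f (x + y) = square_gauge W (x + y)" by (rule square_gauge_attained)
  then show ?thesis
    using dual_ballD(3)[OF square_ballD(1)[OF f(1)], of x y] square_gauge_upper[OF f(1), of x] square_gauge_upper[OF f(1), of y]
    by simp
qed

lemma square_gauge_neg: "square_gauge W (- x) = square_gauge W x"
proof -
  have le: "square_gauge W (- x) \<le> square_gauge W x" for x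
  proof -
    obtain f where f: "f \<in> square_ball W" "f (- x) = square_gauge W (- x)" by (rule square_gauge_attained)
    note fb = square_ballD(1)[OF f(1)]
    have "(\<lambda>x. (-1) * f x) \<in> dual_ball" using dual_ballD(2)[OF fb] by (intro dual_ball_scale[OF fb]) simp
    moreover have "square_sum W (\<lambda>x. (-1) * f x) \<le> 1"
      using square_sum_scale[OF fb, of "-1"] square_ballD(2)[OF f(1)] by simp
    ultimately have "(\<lambda>x. (-1) * f x) \<in> square_ball W" by (simp add: square_ball_def)
    from square_gauge_upper[OF this, of x] show ?thesis using f(2) dual_ballD(6)[OF fb, of x] by simp
  qed
  show ?thesis using le[of x] le[of "- x"] by simp
qed

lemma functional_le_gauge:
  assumes f: "f \<in> dual_ball"
  shows "f x \<le> sqrt (square_sum W f) * square_gauge W x"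
proof (cases "square_sum W f \<le> 0")
  case True
  then have "sqrt (square_sum W f) \<le> 0" by simp
  moreover have nn: "0 \<le> square_sum W f" by (rule square_sum_nonneg[OF f])
  ultimately show ?thesis using abs_le_square_sum[OF f, of x] True by simp
next
  case False
  define s where "s = sqrt (square_sum W f)"
  have s: "s > 0" "s\<^sup>2 = square_sum W f" using False by (auto simp: s_def)
  have "(\<lambda>x. inverse s * f x) \<in> dual_ball"
  proof (rule dual_ball_scale[OF f])
    show "\<bar>inverse s\<bar> * \<bar>f x\<bar> \<le> norm x" for x
      using abs_le_square_sum[OF f, of x] s by (simp add: s_def[symmetric] field_simps)
  qed
  moreover have "square_sum W (\<lambda>x. inverse s * f x) \<le> 1"
    using square_sum_scale[OF f, of "inverse s"] s False by (simp add: power_inverse)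
  ultimately have "(\<lambda>x. inverse s * f x) \<in> square_ball W" by (simp add: square_ball_def)
  from square_gauge_upper[OF this, of x] show ?thesis using s by (simp add: s_def[symmetric] field_simps)
qed

text \<open>If \<open>f\<close> attains the gauge at \<open>y\<close> and \<open>g\<close> attains it up to \<open>\<kappa>\<close>, then their midpoint attains it up to
\<open>\<kappa> / 2\<close>, so its sum of squares is close to \<open>1\<close>. All the convexity gaps are nonnegative and have a small sum, hence each of
them is small.\<close>

lemma square_gap:
  assumes f: "f \<in> square_ball W" and g: "g \<in> square_ball W"
    and y: "square_gauge W y > 0" "f y = square_gauge W y"
    and \<kappa>: "g y \<ge> square_gauge W y - \<kappa>" "\<kappa> \<le> square_gauge W y"
  shows "(1/2)^n * ((sup_on (W n) f)\<^sup>2 / 2 + (sup_on (W n) g)\<^sup>2 / 2 - (sup_on (W n) (\<lambda>x. (f x + g x) / 2))\<^sup>2)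
    \<le> \<kappa> / square_gauge W y"
proof -
  define m where "m = (\<lambda>x. (f x + g x) / 2)"
  define p where "p = square_gauge W y"
  note fb = square_ballD(1)[OF f] and gb = square_ballD(1)[OF g]
  have mb: "m \<in> dual_ball" unfolding m_def by (rule dual_ball_mid[OF fb gb])
  define G where "G = (\<lambda>n. (sup_on (W n) f)\<^sup>2 / 2 + (sup_on (W n) g)\<^sup>2 / 2 - (sup_on (W n) m)\<^sup>2)"
  have G: "0 \<le> G n" for n
    unfolding G_def m_def by (rule order_trans[OF _ sup_on_gap[OF W fb gb]]) simp
  have sums: "(\<lambda>n. (1/2)^n * G n) sums (square_sum W f / 2 + square_sum W g / 2 - square_sum W m)"
  proof -
    have "(\<lambda>n. (1/2)^n * (sup_on (W n) f)\<^sup>2 / 2 + (1/2)^n * (sup_on (W n) g)\<^sup>2 / 2 - (1/2)^n * (sup_on (W n) m)\<^sup>2)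
      sums (square_sum W f / 2 + square_sum W g / 2 - square_sum W m)"
      unfolding square_sum_def by (intro sums_diff sums_add sums_divide summable_sums square_summable fb gb mb)
    then show ?thesis by (simp add: G_def algebra_simps)
  qed
  have "(1/2)^n * G n \<le> (\<Sum>n. (1/2)^n * G n)"
    using sum_le_suminf[OF sums_summable[OF sums], of "{n}"] G by simp
  also have "\<dots> = square_sum W f / 2 + square_sum W g / 2 - square_sum W m"
    using sums by (rule sums_unique[symmetric])
  also have "\<dots> \<le> 1 - square_sum W m" using square_ballD(2)[OF f] square_ballD(2)[OF g] by simp
  also have "\<dots> \<le> \<kappa> / p"
  proof -
    have p: "p > 0" using y by (simp add: p_def)
    have "p - \<kappa> / 2 \<le> m y" using y(2) \<kappa>(1) by (simp add: m_def p_def field_simps)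
    also have "\<dots> \<le> sqrt (square_sum W m) * p" unfolding p_def by (rule functional_le_gauge[OF mb])
    finally have "1 - \<kappa> / (2 * p) \<le> sqrt (square_sum W m)" using p by (simp add: field_simps)
    moreover have "0 \<le> 1 - \<kappa> / (2 * p)" using \<kappa>(2) p by (simp add: p_def[symmetric] field_simps)
    ultimately have "(1 - \<kappa> / (2 * p))\<^sup>2 \<le> (sqrt (square_sum W m))\<^sup>2" by (intro power_mono)
    moreover have "0 \<le> square_sum W m" by (rule square_sum_nonneg[OF mb])
    moreover have "1 - \<kappa> / p \<le> (1 - \<kappa> / (2 * p))\<^sup>2" using p by (simp add: power2_eq_square field_simps)
    ultimately show ?thesis by simp
  qed
  finally show ?thesis unfolding G_def m_def p_def .
qed

end


text \<open>Provides a direction in \<open>D\<close> that complements the kernel of \<open>c\<close> in \<open>Y\<close> with a projection of norm at most \<open>2\<close>.\<close>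

lemma closure_linear_bound:
  assumes Y: "Y = closure D" "subspace Y" and c: "c \<in> dual_ball"
  obtains "\<And>y. y \<in> Y \<Longrightarrow> c y = 0"
  | d where "d \<in> D" "c d \<noteq> 0" "\<And>y. y \<in> Y \<Longrightarrow> \<bar>c y\<bar> * norm d \<le> 2 * \<bar>c d\<bar> * norm y"
proof -
  define U where "U = Y \<inter> cball 0 1"
  define s where "s = sup_on U c"
  have U: "0 \<in> U" "U \<subseteq> cball 0 1" using subspace_0[OF Y(2)] by (auto simp: U_def)
  have le: "\<bar>c y\<bar> \<le> s * norm y" if y: "y \<in> Y" for y
  proof (cases "y = 0")
    case False
    define u where "u = y /\<^sub>R norm y"
    have "u \<in> U" using False y subspace_scale[OF Y(2)] by (simp add: U_def u_def)
    then have "\<bar>c u\<bar> \<le> s" unfolding s_def by (rule sup_on_upper[OF U c])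
    moreover have "c y = norm y * c u" using dual_ballD(5)[OF c, of "norm y" u] False by (simp add: u_def)
    ultimately show ?thesis by (simp add: abs_mult mult.commute[of s] mult_left_mono)
  qed (simp add: dual_ballD(7)[OF c])
  show ?thesis
  proof (cases "s = 0")
    case True
    then show ?thesis using that(1) le by simp
  next
    case False
    then have s: "s > 0" using sup_on_nonneg[OF U c] by (simp add: s_def)
    then obtain w where w: "w \<in> U" "s / 2 < \<bar>c w\<bar>"
      using less_cSUP_iff[OF _ sup_on_bdd[OF U c], of "s/2"] U(1) by (auto simp: s_def sup_on_def)
    have contc: "continuous_on UNIV c"
      by (rule linear_continuous_on[OF dual_ball_bounded_linear[OF c]])
    have "open {z. s / 2 * norm z < \<bar>c z\<bar>}"
      by (intro open_Collect_less continuous_intros contc)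
    moreover have "s / 2 * norm w \<le> s / 2 * 1" using w(1) s by (intro mult_left_mono) (auto simp: U_def)
    then have "w \<in> {z. s / 2 * norm z < \<bar>c z\<bar>} \<inter> closure D" using w Y(1) by (auto simp: U_def)
    ultimately have "{z. s / 2 * norm z < \<bar>c z\<bar>} \<inter> D \<noteq> {}"
      by (metis open_Int_closure_eq_empty empty_iff)
    then obtain d where d: "d \<in> D" "s / 2 * norm d < \<bar>c d\<bar>" by blast
    have "c d \<noteq> 0"
    proof
      assume "c d = 0"
      then have "s * norm d < 0" using d(2) by simp
      then show False using s by (simp add: mult_less_0_iff)
    qed
    moreover have "\<bar>c y\<bar> * norm d \<le> 2 * \<bar>c d\<bar> * norm y" if y: "y \<in> Y" for y
    proof -
      have "\<bar>c y\<bar> * norm d \<le> (s * norm y) * norm d" by (intro mult_right_mono le y) simp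
      also have "\<dots> = (s * norm d) * norm y" by simp
      also have "\<dots> \<le> (2 * \<bar>c d\<bar>) * norm y" using d(2) by (intro mult_right_mono) auto
      finally show ?thesis by simp
    qed
    ultimately show ?thesis using that(2) d(1) by blast
  qed
qed

text \<open>The even positive indices make near-maximisers converge at each point \<open>d n\<close>. The odd ones control the seminorm on the
kernel of \<open>c n\<close> in \<open>Y\<close>, which is small for the functionals that are close to a multiple of \<open>c n\<close>. Index \<open>0\<close> makes the gauge
equivalent to the norm.\<close>

definition smoothing_sets ::
    "'a::real_normed_vector set \<Rightarrow> (nat \<Rightarrow> 'a \<Rightarrow> real) \<Rightarrow> (nat \<Rightarrow> 'a) \<Rightarrow> nat \<Rightarrow> 'a set" where
  "smoothing_sets Y c d n =
    (if n = 0 then cball 0 1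
     else if odd n then {y \<in> Y. norm y \<le> 1 \<and> c (n div 2) y = 0}
     else {0, d (n div 2 - 1) /\<^sub>R (1 + norm (d (n div 2 - 1)))})"

lemma smoothing_sets_simps:
  "smoothing_sets Y c d 0 = cball 0 1"
  "smoothing_sets Y c d (2 * n + 1) = {y \<in> Y. norm y \<le> 1 \<and> c n y = 0}"
  "smoothing_sets Y c d (2 * n + 2) = {0, d n /\<^sub>R (1 + norm (d n))}"
  by (simp_all add: smoothing_sets_def)

lemma smoothing_sets_ok:
  assumes "\<And>n. c n \<in> dual_ball" "subspace Y"
  shows "0 \<in> smoothing_sets Y c d n" "smoothing_sets Y c d n \<subseteq> cball 0 1"
proof -
  have "norm (x /\<^sub>R (1 + norm x)) \<le> 1" for x :: 'a
    by (simp add: divide_simps add_pos_nonneg)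
  then show "0 \<in> smoothing_sets Y c d n" "smoothing_sets Y c d n \<subseteq> cball 0 1"
    using dual_ballD(7)[OF assms(1)] subspace_0[OF assms(2)] by (auto simp: smoothing_sets_def)
qed

text \<open>Choose \<open>c n\<close> close to \<open>f\<close> on \<open>Y\<close>. Then \<open>f\<close> is small on the unit ball of the kernel of \<open>c n\<close>, and by \<open>square_gap\<close> so is
every near-maximiser \<open>g\<close>. On a single direction of \<open>D\<close> that complements this kernel, \<open>f\<close> and \<open>g\<close> are close, again
by \<open>square_gap\<close>. Together this bounds \<open>g - f\<close> on all of \<open>Y\<close>.\<close>

lemma near_maximisers_close:
  fixes Y :: "'a::real_normed_vector set"
  assumes Y: "Y = closure (range d)" "subspace Y" and c: "\<And>n. c n \<in> dual_ball"
    and dense: "\<forall>s\<in>dual_ball. \<forall>\<eta>>0. \<exists>n. close_on Y \<eta> s (c n)"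
    and W: "W = smoothing_sets Y c d"
    and f: "f \<in> square_ball W" "f y = square_gauge W y" and y: "square_gauge W y > 0"
    and \<eta>: "\<eta> > 0"
  shows "\<exists>\<kappa>>0. \<forall>g\<in>square_ball W. g y \<ge> square_gauge W y - \<kappa> \<longrightarrow> (\<forall>h\<in>Y. \<bar>g h - f h\<bar> \<le> \<eta> * norm h)"
proof -
  define p where "p = square_gauge W y"
  have p: "p > 0" using y by (simp add: p_def)
  have W1: "0 \<in> W n" "W n \<subseteq> cball 0 1" for n
    unfolding W by (rule smoothing_sets_ok[OF c Y(2)])+
  have W0: "W 0 = cball 0 1" unfolding W by (rule smoothing_sets_simps)
  note ball = square_ballD[where W = W]
  note fb = ball(1)[OF f(1)]
  \<comment> \<open>The final estimate is \<open>3 e\<close> on a kernel component of norm at most \<open>3 * norm h\<close> plus \<open>2 e\<close> on the complement.\<close>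
  define e where "e = \<eta> / 11"
  have e: "e > 0" using \<eta> by (simp add: e_def)
  obtain n where n: "\<And>y. y \<in> Y \<Longrightarrow> \<bar>f y - c n y\<bar> \<le> e * norm y" using dense fb e unfolding close_on_def by meson
  define Kn where "Kn = W (2 * n + 1)"
  have Kn: "Kn = {y \<in> Y. norm y \<le> 1 \<and> c n y = 0}" unfolding Kn_def W by (rule smoothing_sets_simps)
  note KW = W1[of "2 * n + 1", folded Kn_def]
  have Sf: "sup_on Kn f \<le> e"
  proof (rule sup_on_least[OF KW])
    fix w assume w: "w \<in> Kn"
    then have "\<bar>f w\<bar> \<le> e * norm w" using n[of w] by (simp add: Kn)
    also have "\<dots> \<le> e * 1" using w e by (intro mult_left_mono) (auto simp: Kn)
    finally show "\<bar>f w\<bar> \<le> e" by simp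
  qed
  have Sg: "sup_on Kn g \<le> 2 * e"
    if g: "g \<in> square_ball W" "g y \<ge> p - \<kappa>" "\<kappa> \<le> p" "\<kappa> \<le> p * (1/2)^(2 * n + 1) * (e / 2)\<^sup>2" for g \<kappa>
  proof -
    note gb = ball(1)[OF g(1)]
    have "(1/2)^(2 * n + 1) * ((sup_on Kn f - sup_on Kn g) / 2)\<^sup>2 \<le> (1/2)^(2 * n + 1) *
      ((sup_on Kn f)\<^sup>2 / 2 + (sup_on Kn g)\<^sup>2 / 2 - (sup_on Kn (\<lambda>x. (f x + g x) / 2))\<^sup>2)"
      by (intro mult_left_mono sup_on_gap[OF KW fb gb]) simp
    also have "\<dots> \<le> \<kappa> / p"
      unfolding Kn_def p_def
      by (rule square_gap[where W = W, OF W1 W0 f(1) g(1) y f(2)]) (use g in \<open>auto simp: p_def\<close>)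
    also have "\<dots> \<le> (1/2)^(2 * n + 1) * (e / 2)\<^sup>2"
      using g(4) p by (simp add: pos_divide_le_eq mult.commute mult.left_commute)
    finally have "((sup_on Kn f - sup_on Kn g) / 2)\<^sup>2 \<le> (e / 2)\<^sup>2"
      by (rule mult_left_le_imp_le) simp
    then have "\<bar>(sup_on Kn f - sup_on Kn g) / 2\<bar> \<le> e / 2"
      using e by (simp add: abs_le_square_iff[symmetric])
    then show ?thesis using Sf by (simp add: abs_le_iff)
  qed
  have ker: "\<bar>g h - f h\<bar> \<le> 3 * e * norm h"
    if g: "g \<in> dual_ball" "sup_on Kn g \<le> 2 * e" and h: "h \<in> Y" "c n h = 0" for g h
  proof (cases "h = 0")
    case True then show ?thesis using dual_ballD(7)[OF g(1)] dual_ballD(7)[OF fb] by simp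
  next
    case False
    define w where "w = h /\<^sub>R norm h"
    have w: "w \<in> Kn" using h False subspace_scale[OF Y(2)] dual_ballD(5)[OF c] by (simp add: Kn w_def)
    have "\<bar>g w\<bar> \<le> 2 * e" "\<bar>f w\<bar> \<le> e"
      using sup_on_upper[OF KW g(1) w] sup_on_upper[OF KW fb w] g(2) Sf by linarith+
    then have "\<bar>g w - f w\<bar> \<le> 3 * e" by linarith
    moreover have "g h = norm h * g w" "f h = norm h * f w"
      using dual_ballD(5)[OF g(1), of "norm h" w] dual_ballD(5)[OF fb, of "norm h" w] False by (simp_all add: w_def)
    then have "\<bar>g h - f h\<bar> = norm h * \<bar>g w - f w\<bar>" by (simp add: abs_mult right_diff_distrib[symmetric])
    ultimately show ?thesis by (simp add: mult.commute[of "3 * e"] mult_left_mono)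
  qed
  from c[of n] consider (zero) "\<And>y. y \<in> Y \<Longrightarrow> c n y = 0"
    | (nonzero) d' where "d' \<in> range d" "c n d' \<noteq> 0" "\<And>y. y \<in> Y \<Longrightarrow> \<bar>c n y\<bar> * norm d' \<le> 2 * \<bar>c n d'\<bar> * norm y"
    using closure_linear_bound[OF Y, of "c n"] by metis
  then show ?thesis
  proof cases
    case zero
    define \<kappa> where "\<kappa> = min p (p * (1/2)^(2 * n + 1) * (e / 2)\<^sup>2)"
    have "\<kappa> > 0" using p e by (simp add: \<kappa>_def)
    moreover have "\<bar>g h - f h\<bar> \<le> \<eta> * norm h" if g: "g \<in> square_ball W" "g y \<ge> p - \<kappa>" and h: "h \<in> Y" for g h
    proof -
      have "sup_on Kn g \<le> 2 * e" by (rule Sg[OF g]) (auto simp: \<kappa>_def)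
      then have "\<bar>g h - f h\<bar> \<le> 3 * e * norm h" by (intro ker ball(1) g h zero)
      also have "\<dots> \<le> \<eta> * norm h" using \<eta> by (intro mult_right_mono) (auto simp: e_def)
      finally show ?thesis .
    qed
    ultimately show ?thesis unfolding p_def by blast
  next
    case nonzero
    then obtain m where m: "d' = d m" by blast
    define t where "t = 1 + norm d'"
    have t: "t > 0" by (simp add: t_def add_pos_nonneg)
    have "d' \<noteq> 0" using nonzero(2) dual_ballD(7)[OF c[of n]] by auto
    have d'Y: "d' \<in> Y" using nonzero(1) closure_subset[of "range d"] unfolding Y(1) by blast
    have Wm: "W (2 * m + 2) = {0, d' /\<^sub>R t}" unfolding W m t_def by (rule smoothing_sets_simps)
    define e2 where "e2 = e * norm d' / t"
    have e2: "e2 > 0" using e t \<open>d' \<noteq> 0\<close> by (simp add: e2_def)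
    define \<kappa> where "\<kappa> = Min {p, p * (1/2)^(2 * n + 1) * (e / 2)\<^sup>2, p * (1/2)^(2 * m + 2) * (e2 / 2)\<^sup>2}"
    have "\<kappa> > 0" using p e e2 by (simp add: \<kappa>_def)
    moreover have "\<bar>g h - f h\<bar> \<le> \<eta> * norm h" if g: "g \<in> square_ball W" "g y \<ge> p - \<kappa>" and h: "h \<in> Y" for g h
    proof -
      note gb = ball(1)[OF g(1)]
      have Sg': "sup_on Kn g \<le> 2 * e" by (rule Sg[OF g]) (auto simp: \<kappa>_def)
      have d'close: "\<bar>g d' - f d'\<bar> \<le> e * norm d'"
      proof -
        define w where "w = d' /\<^sub>R t"
        note mb = dual_ball_mid[OF fb gb]
        have "(1/2)^(2 * m + 2) * ((g w - f w) / 2)\<^sup>2 = (1/2)^(2 * m + 2) *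
          ((sup_on (W (2 * m + 2)) f)\<^sup>2 / 2 + (sup_on (W (2 * m + 2)) g)\<^sup>2 / 2
            - (sup_on (W (2 * m + 2)) (\<lambda>x. (f x + g x) / 2))\<^sup>2)"
          unfolding Wm w_def[symmetric] sup_on_pair[OF fb] sup_on_pair[OF gb] sup_on_pair[OF mb]
          by (simp add: power2_eq_square field_simps)
        also have "\<dots> \<le> \<kappa> / p" unfolding p_def
          by (rule square_gap[where W = W, OF W1 W0 f(1) g(1) y f(2)]) (use g in \<open>auto simp: p_def \<kappa>_def\<close>)
        also have "\<dots> \<le> (1/2)^(2 * m + 2) * (e2 / 2)\<^sup>2"
        proof -
          have "\<kappa> \<le> p * (1/2)^(2 * m + 2) * (e2 / 2)\<^sup>2" by (simp add: \<kappa>_def)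
          then show ?thesis using p by (simp add: pos_divide_le_eq mult.commute mult.left_commute)
        qed
        finally have "((g w - f w) / 2)\<^sup>2 \<le> (e2 / 2)\<^sup>2" by (rule mult_left_le_imp_le) simp
        then have "\<bar>(g w - f w) / 2\<bar> \<le> e2 / 2" using e2 by (simp add: abs_le_square_iff[symmetric])
        then have w: "\<bar>g w - f w\<bar> \<le> e2" by (simp add: abs_le_iff)
        have "g d' = t * g w" "f d' = t * f w"
          using dual_ballD(5)[OF gb, of t w] dual_ballD(5)[OF fb, of t w] t by (simp_all add: w_def)
        then have "\<bar>g d' - f d'\<bar> = t * \<bar>g w - f w\<bar>" using t by (simp add: abs_mult right_diff_distrib[symmetric])
        also have "\<dots> \<le> t * e2" using w t by (intro mult_left_mono) auto
        finally show ?thesis using t by (simp add: e2_def)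
      qed
      define r where "r = c n h / c n d'"
      define h' where "h' = h - r *\<^sub>R d'"
      have h': "h' \<in> Y" "c n h' = 0"
        using h d'Y nonzero(2) subspace_scale[OF Y(2)] subspace_diff[OF Y(2)]
        by (simp_all add: h'_def r_def dual_ballD(4,5)[OF c])
      have r: "\<bar>r\<bar> * norm d' \<le> 2 * norm h"
        using nonzero(3)[OF h] nonzero(2) by (simp add: r_def divide_le_eq mult.commute mult.left_commute)
      have "norm h' \<le> norm h + \<bar>r\<bar> * norm d'" unfolding h'_def
        using norm_triangle_ineq4[of h "r *\<^sub>R d'"] by simp
      then have nh': "norm h' \<le> 3 * norm h" using r by simp
      have "g h - f h = (g h' - f h') + r * (g d' - f d')"
        by (simp add: h'_def dual_ballD(4,5)[OF gb] dual_ballD(4,5)[OF fb] right_diff_distrib)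
      then have "\<bar>g h - f h\<bar> \<le> \<bar>g h' - f h'\<bar> + \<bar>r\<bar> * \<bar>g d' - f d'\<bar>"
        by (metis abs_mult abs_triangle_ineq)
      also have "\<dots> \<le> 3 * e * norm h' + \<bar>r\<bar> * (e * norm d')"
        by (intro add_mono mult_left_mono ker gb Sg' h' d'close) simp
      also have "\<dots> \<le> 3 * e * (3 * norm h) + e * (2 * norm h)"
      proof (intro add_mono mult_left_mono nh')
        show "\<bar>r\<bar> * (e * norm d') \<le> e * (2 * norm h)"
          using mult_left_mono[OF r, of e] e by (simp add: mult.commute mult.left_commute)
      qed (use e in simp)
      also have "\<dots> = \<eta> * norm h" by (simp add: e_def)
      finally show ?thesis .
    qed
    ultimately show ?thesis unfolding p_def by blast
  qed
qed

text \<open>Only the upper estimate of differentiability is stated, as minimality arguments use nothing else. It follows from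
\<open>near_maximisers_close\<close> (Smulian's criterion): a functional that attains the gauge at \<open>y + h\<close> almost attains it at
\<open>y\<close>.\<close>

theorem smooth_gauge:
  fixes D :: "'a::banach set"
  assumes asp: "asplund_space TYPE('a)" and D: "countable D"
    and Y: "Y = closure D" "subspace Y"
  obtains p :: "'a \<Rightarrow> real" where
    "\<And>x. norm x / 2 \<le> p x" "\<And>x. p x \<le> norm x" "\<And>x y. p (x + y) \<le> p x + p y" "\<And>x. p (- x) = p x"
    "\<And>y. y \<noteq> 0 \<Longrightarrow> \<exists>f\<in>dual_ball. f y = p y \<and>
       (\<forall>\<eta>>0. \<exists>\<delta>>0. \<forall>h\<in>Y. norm h < \<delta> \<longrightarrow> p (y + h) \<le> p y + f h + \<eta> * norm h)"
proof -
  have "D \<noteq> {}" using subspace_0[OF Y(2)] Y(1) by auto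
  then obtain d :: "nat \<Rightarrow> 'a" where d: "range d = D"
    using range_from_nat_into[OF _ D] by blast
  have Yd: "Y = closure (range d)" using Y d by simp
  from separable_dual[OF asp D equalityD1[OF Y(1)]]
  obtain c :: "nat \<Rightarrow> 'a \<Rightarrow> real" where cd: "(\<forall>n. c n \<in> dual_ball) \<and> (\<forall>s\<in>dual_ball. \<forall>\<eta>>0. \<exists>n. close_on Y \<eta> s (c n))"
    by (rule exE)
  note c = spec[OF conjunct1[OF cd]] and dense = conjunct2[OF cd]
  define W where "W = smoothing_sets Y c d"
  have W1: "0 \<in> W n" "W n \<subseteq> cball 0 1" for n
    unfolding W_def by (rule smoothing_sets_ok[OF c Y(2)])+
  have W0: "W 0 = cball 0 1" unfolding W_def by (rule smoothing_sets_simps)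
  define p where "p = square_gauge W"
  show ?thesis
  proof (rule that[of p])
    show "norm x / 2 \<le> p x" "p x \<le> norm x" "p (x + y) \<le> p x + p y" "p (- x) = p x" for x y
      unfolding p_def
      by (rule square_gauge_ge_norm[where W = W, OF W1 W0] square_gauge_le_norm[where W = W, OF W1 W0]
          square_gauge_add[where W = W, OF W1 W0] square_gauge_neg[where W = W, OF W1 W0])+
    fix y :: 'a assume "y \<noteq> 0"
    then have "0 < norm y / 2" by simp
    also have "norm y / 2 \<le> p y" unfolding p_def by (rule square_gauge_ge_norm[where W = W, OF W1 W0])
    finally have py: "p y > 0" .
    obtain f where f: "f \<in> square_ball W" "f y = p y"
      using square_gauge_attained[where W = W, OF W1 W0, of y] unfolding p_def by blast
    note fb = square_ballD(1)[OF f(1)]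
    have "\<exists>\<delta>>0. \<forall>h\<in>Y. norm h < \<delta> \<longrightarrow> p (y + h) \<le> p y + f h + \<eta> * norm h" if \<eta>: "\<eta> > 0" for \<eta>
    proof -
      obtain \<kappa> where \<kappa>: "\<kappa> > 0" "\<And>g h. g \<in> square_ball W \<Longrightarrow> g y \<ge> p y - \<kappa> \<Longrightarrow> h \<in> Y \<Longrightarrow> \<bar>g h - f h\<bar> \<le> \<eta> * norm h"
        using near_maximisers_close[OF Yd Y(2) c dense W_def f(1) f(2)[unfolded p_def] py[unfolded p_def] \<eta>]
        unfolding p_def by blast
      have "p (y + h) \<le> p y + f h + \<eta> * norm h" if h: "h \<in> Y" "norm h < \<kappa> / 2" for h
      proof -
        obtain g where g: "g \<in> square_ball W" "g (y + h) = p (y + h)"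
          using square_gauge_attained[where W = W, OF W1 W0, of "y + h"] unfolding p_def by blast
        note gb = square_ballD(1)[OF g(1)]
        have gy: "g y = p (y + h) - g h" using g(2) dual_ballD(3)[OF gb, of y h] by simp
        have "p y \<le> p (y + h) + p (- h)"
          using square_gauge_add[where W = W, OF W1 W0, of "y + h" "- h"] by (simp add: p_def)
        also have "p (- h) \<le> norm h" using square_gauge_le_norm[where W = W, OF W1 W0, of "- h"] by (simp add: p_def)
        finally have "g y \<ge> p y - \<kappa>" using gy dual_ballD(2)[OF gb, of h] h(2) by simp
        then have "\<bar>g h - f h\<bar> \<le> \<eta> * norm h" using \<kappa>(2) g(1) h(1) by blast
        moreover have "g y \<le> p y" unfolding p_def by (rule square_gauge_upper[where W = W, OF W1 W0 g(1)])
        ultimately show ?thesis using gy by simp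
      qed
      then show ?thesis using \<kappa>(1) by (intro exI[of _ "\<kappa> / 2"]) simp
    qed
    then show "\<exists>f\<in>dual_ball. f y = p y \<and>
       (\<forall>\<eta>>0. \<exists>\<delta>>0. \<forall>h\<in>Y. norm h < \<delta> \<longrightarrow> p (y + h) \<le> p y + f h + \<eta> * norm h)"
      using fb f(2) by blast
  qed
qed

section \<open>A smooth variational principle and normals along a subspace\<close>

text \<open>The points \<open>xs n\<close> are successive near-minimisers of the perturbed function in closed sets that decrease to a
single point \<open>z\<close>. The weights \<open>\<mu> / 2^n\<close> are fixed in advance, and the \<open>n\<close>-th near-minimiser is chosen up to
\<open>\<mu> / 8^n\<close>, so that the \<open>n\<close>-th set has diameter of order \<open>1 / 2^n\<close>. Points that leave the sets at stage \<open>n\<close> have a larger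
value than the perturbed function takes at \<open>xs n\<close>, hence a larger value than at \<open>z\<close>.\<close>

lemma Borwein_Preiss:
  fixes f :: "'z::banach \<Rightarrow> real" and \<rho> :: "'z \<Rightarrow> 'z \<Rightarrow> real"
  assumes S: "closed S" "x0 \<in> S" and f: "continuous_on UNIV f" "\<And>x. x \<in> S \<Longrightarrow> 0 \<le> f x"
    and \<rho>: "\<And>x y. (norm (x - y))\<^sup>2 \<le> 4 * \<rho> x y" "\<And>x y. \<rho> x y \<le> (norm (x - y))\<^sup>2"
      "\<And>y. continuous_on UNIV (\<lambda>x. \<rho> x y)"
    and \<mu>: "\<mu> > 0"
  obtains z xs where "z \<in> S" "\<And>k. xs k \<in> S" "\<And>k. \<mu> * \<rho> (xs k) x0 \<le> f x0" "\<mu> * \<rho> z x0 \<le> f x0"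
    "\<And>x. summable (\<lambda>k. \<mu> * (1/2)^k * \<rho> x (xs k))"
    "\<And>x. x \<in> S \<Longrightarrow> f z + (\<Sum>k. \<mu> * (1/2)^k * \<rho> z (xs k)) \<le> f x + (\<Sum>k. \<mu> * (1/2)^k * \<rho> x (xs k))"
proof -
  have \<rho>0: "0 \<le> \<rho> x y" for x y
    using \<rho>(1)[of x y] zero_le_power2[of "norm (x - y)"] by linarith
  have \<rho>xx: "\<rho> x x = 0" for x
    using \<rho>(2)[of x x] \<rho>0[of x x] by simp
  \<comment> \<open>A state consists of the function perturbed so far, the set that still contains the limit, and a near-minimiser.\<close>
  define P where "P = (\<lambda>n::nat. \<lambda>(G::'z \<Rightarrow> real, T, x). closed T \<and> T \<subseteq> S \<and> x \<in> T \<and> continuous_on UNIV G \<and>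
     (\<forall>z\<in>S. 0 \<le> G z) \<and> (n = 0 \<longrightarrow> G = f \<and> T = S \<and> x = x0) \<and>
     (n > 0 \<longrightarrow> (\<forall>z\<in>T. G x \<le> G z + \<mu> * (1/2)^n * (1/4)^n)))"
  define Q where "Q = (\<lambda>n::nat. \<lambda>(G::'z \<Rightarrow> real, T, x) (G', T', x').
     G' = (\<lambda>z. G z + \<mu> * (1/2)^n * \<rho> z x) \<and> T' = {z\<in>T. G' z \<le> G x} \<and> x' \<in> T')"
  have "\<exists>s. P 0 s" using S f by (intro exI[of _ "(f, S, x0)"]) (simp add: P_def)
  moreover have "\<exists>s'. P (Suc n) s' \<and> Q n s s'" if Ps: "P n s" for n s
  proof -
    obtain G T x where s: "s = (G, T, x)" by (cases s)
    from Ps have G: "closed T" "T \<subseteq> S" "x \<in> T" "continuous_on UNIV G" "\<forall>z\<in>S. 0 \<le> G z"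
      by (simp_all add: P_def s)
    define G' where "G' = (\<lambda>z. G z + \<mu> * (1/2)^n * \<rho> z x)"
    define T' where "T' = {z\<in>T. G' z \<le> G x}"
    define e where "e = \<mu> * (1/2)^(Suc n) * (1/4)^(Suc n)"
    have e: "e > 0" using \<mu> by (simp add: e_def)
    have G'c: "continuous_on UNIV G'" unfolding G'_def by (intro continuous_intros G \<rho>)
    have G'0: "0 \<le> G' z" if "z \<in> S" for z
      using G(5) that \<rho>0[of z x] \<mu> by (simp add: G'_def)
    have T': "closed T'" "T' \<subseteq> S" "x \<in> T'"
    proof -
      have "closed {z. G' z \<le> G x}" by (intro closed_Collect_le G'c continuous_on_const)
      moreover have "T' = T \<inter> {z. G' z \<le> G x}" by (auto simp: T'_def)
      ultimately show "closed T'" using G(1) by (simp add: closed_Int)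
      show "T' \<subseteq> S" using G(2) by (auto simp: T'_def)
      show "x \<in> T'" using G(3) by (simp add: T'_def G'_def \<rho>xx)
    qed
    have "Inf (G' ` T') < Inf (G' ` T') + e" using e by simp
    moreover have "G' ` T' \<noteq> {}" using T'(3) by blast
    ultimately obtain x' where x': "x' \<in> T'" "G' x' < Inf (G' ` T') + e"
      using cInf_lessD[of "G' ` T'"] by (metis imageE)
    have bd: "bdd_below (G' ` T')" using G'0 T'(2) by (intro bdd_belowI2[of _ 0]) auto
    have "G' x' \<le> G' z + e" if "z \<in> T'" for z
      using cINF_lower[OF bd that] x'(2) by simp
    then have "P (Suc n) (G', T', x')"
      using T' x'(1) G'c G'0 by (simp add: P_def e_def)
    moreover have "Q n s (G', T', x')"
      using x'(1) by (simp add: Q_def s G'_def T'_def)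
    ultimately show ?thesis by blast
  qed
  ultimately obtain st where st: "\<And>n. P n (st n)" "\<And>n. Q n (st n) (st (Suc n))"
    using dependent_nat_choice[of P Q] by blast
  define G where "G = (\<lambda>n. fst (st n))"
  define T where "T = (\<lambda>n. fst (snd (st n)))"
  define xs where "xs = (\<lambda>n. snd (snd (st n)))"
  have st_eq: "st n = (G n, T n, xs n)" for n by (simp add: G_def T_def xs_def)
  have PP: "closed (T n)" "T n \<subseteq> S" "xs n \<in> T n" for n
    using st(1)[of n] by (simp_all add: P_def st_eq)
  have P0: "G 0 = f" "T 0 = S" "xs 0 = x0" using st(1)[of 0] by (simp_all add: P_def st_eq)
  have Pn: "G n (xs n) \<le> G n z + \<mu> * (1/2)^n * (1/4)^n" if "n > 0" "z \<in> T n" for n z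
    using st(1)[of n] that by (simp add: P_def st_eq)
  have GS: "G (Suc n) = (\<lambda>z. G n z + \<mu> * (1/2)^n * \<rho> z (xs n))" and
    TS: "T (Suc n) = {z\<in>T n. G (Suc n) z \<le> G n (xs n)}" for n
    using st(2)[of n] by (auto simp: Q_def st_eq)
  have Gsum: "G n z = f z + (\<Sum>k<n. \<mu> * (1/2)^k * \<rho> z (xs k))" for n z
    by (induction n) (simp_all add: P0 GS)
  have Tanti: "T n \<subseteq> T m" if "m \<le> n" for m n
    using that by (induction rule: dec_induct) (auto simp: TS)
  have close0: "\<mu> * \<rho> z x0 \<le> f x0" if "z \<in> T 1" for z
  proof -
    have "G 1 z \<le> f x0" "z \<in> S" using that PP(2)[of 1] by (auto simp: TS P0)
    then show ?thesis using f(2)[of z] by (simp add: Gsum P0)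
  qed
  have close: "norm (z - xs n) \<le> 2 * (1/2)^n" if "n > 0" "z \<in> T (Suc n)" for n z
  proof -
    have z: "z \<in> T n" "G n z + \<mu> * (1/2)^n * \<rho> z (xs n) \<le> G n (xs n)"
      using that(2) by (auto simp: TS GS)
    then have "\<mu> * (1/2)^n * \<rho> z (xs n) \<le> \<mu> * (1/2)^n * (1/4)^n" using Pn[OF that(1) z(1)] by simp
    then have "\<rho> z (xs n) \<le> (1/4)^n" using \<mu> by simp
    then have "(norm (z - xs n))\<^sup>2 \<le> 4 * (1/4)^n" using \<rho>(1)[of z "xs n"] by simp
    also have "\<dots> = (2 * (1/2)^n)\<^sup>2" by (simp add: power_mult_distrib power2_eq_square power_mult_distrib[symmetric])
    finally show ?thesis by (rule power2_le_imp_le) simp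
  qed
  have lim0: "(\<lambda>n. 2 * (1/2)^n :: real) \<longlonglongrightarrow> 0"
    using tendsto_mult[OF tendsto_const[of "2::real"] LIMSEQ_power_zero[of "1/2::real"]] by simp
  have "Cauchy xs"
  proof (rule metric_CauchyI)
    fix e :: real assume "e > 0"
    then have "\<forall>\<^sub>F n in sequentially. 2 * (1/2)^n < e / 2" by (intro order_tendstoD(2)[OF lim0]) simp
    then obtain N0 where N0: "\<And>n. n \<ge> N0 \<Longrightarrow> 2 * (1/2)^n < e / 2" by (auto simp: eventually_sequentially)
    define N where "N = Suc N0"
    have "dist (xs n) (xs N) < e / 2" if "n \<ge> N" for n
    proof (cases "n = N")
      case False
      then have "xs n \<in> T (Suc N)" using that PP(3) Tanti[of "Suc N" n] by auto
      then have "norm (xs n - xs N) \<le> 2 * (1/2)^N" by (intro close) (simp add: N_def)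
      then show ?thesis using N0[of N] by (simp add: dist_norm N_def)
    qed (use \<open>e > 0\<close> in simp)
    then have "dist (xs m) (xs n) < e" if "m \<ge> N" "n \<ge> N" for m n
      using that dist_triangle_half_l[of "xs m" "xs N" e "xs n"] by blast
    then show "\<exists>M. \<forall>m\<ge>M. \<forall>n\<ge>M. dist (xs m) (xs n) < e" by blast
  qed
  then obtain z where z: "xs \<longlonglongrightarrow> z" using Cauchy_convergent convergentD by blast
  have zT: "z \<in> T n" for n
  proof (rule Lim_in_closed_set[OF PP(1) _ _ z])
    show "\<forall>\<^sub>F k in sequentially. xs k \<in> T n"
      using PP(3) Tanti unfolding eventually_sequentially by blast
  qed simp
  obtain R where R: "\<And>k. norm (xs k) \<le> R" using convergent_imp_bounded[OF z] by (auto simp: bounded_iff)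
  have smb: "summable (\<lambda>k. \<mu> * (1/2)^k * \<rho> x (xs k))" for x
  proof (rule summable_comparison_test'[where N = 0])
    show "summable (\<lambda>k. \<mu> * (1/2)^k * (norm x + R)\<^sup>2)"
      by (intro summable_mult2 summable_mult summable_geometric) simp
    fix k :: nat
    have "norm (x - xs k) \<le> norm x + R" using norm_triangle_ineq4[of x "xs k"] R[of k] by simp
    then have "(norm (x - xs k))\<^sup>2 \<le> (norm x + R)\<^sup>2" by (intro power_mono) auto
    then have "\<rho> x (xs k) \<le> (norm x + R)\<^sup>2" using \<rho>(2)[of x "xs k"] by simp
    then show "norm (\<mu> * (1/2)^k * \<rho> x (xs k)) \<le> \<mu> * (1/2)^k * (norm x + R)\<^sup>2"
      using \<rho>0[of x "xs k"] \<mu> by simp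
  qed
  define F where "F = (\<lambda>x. f x + (\<Sum>k. \<mu> * (1/2)^k * \<rho> x (xs k)))"
  have GF: "G n x \<le> F x" for n x
    unfolding Gsum F_def using \<mu> \<rho>0 by (intro add_left_mono sum_le_suminf smb) auto
  have Glim: "(\<lambda>n. G n x) \<longlonglongrightarrow> F x" for x
    unfolding Gsum F_def by (intro tendsto_intros summable_LIMSEQ smb)
  have v: "G n (xs n) \<le> G m (xs m)" if "m \<le> n" for m n
    using that
  proof (induction rule: dec_induct)
    case (step n)
    have "xs (Suc n) \<in> T (Suc n)" by (rule PP(3))
    then have "G (Suc n) (xs (Suc n)) \<le> G n (xs n)" by (simp add: TS)
    then show ?case using step by simp
  qed simp
  have Fz: "F z \<le> G n (xs n)" for n
  proof (rule LIMSEQ_le_const2[OF LIMSEQ_Suc[OF Glim]])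
    have "G (Suc m) z \<le> G n (xs n)" if "m \<ge> n" for m
      using zT[of "Suc m"] v[OF that] by (simp add: TS)
    then show "\<exists>N. \<forall>m\<ge>N. G (Suc m) z \<le> G n (xs n)" by blast
  qed
  have "F z \<le> F x" if x: "x \<in> S" for x
  proof (cases "\<forall>n. x \<in> T n")
    case True
    have "xs \<longlonglongrightarrow> x"
    proof (rule LIM_zero_cancel, rule Lim_null_comparison[OF _ lim0])
      have "norm (xs n - x) \<le> 2 * (1/2)^n" if "n \<ge> 1" for n
        using close[of n x] that True by (simp add: norm_minus_commute)
      then show "\<forall>\<^sub>F n in sequentially. norm (xs n - x) \<le> 2 * (1/2)^n"
        unfolding eventually_sequentially by blast
    qed
    then show ?thesis using z LIMSEQ_unique by blast
  next
    case False
    define n where "n = (LEAST n. x \<notin> T n)"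
    have n: "x \<notin> T n" unfolding n_def using False by (metis LeastI)
    moreover have "n \<noteq> 0" using n x P0(2) by metis
    ultimately obtain m where m: "n = Suc m" using not0_implies_Suc by blast
    then have "x \<in> T m" using not_less_Least[of m "\<lambda>n. x \<notin> T n"] unfolding n_def by auto
    then have "G m (xs m) < G (Suc m) x" using n m by (simp add: TS)
    then show ?thesis using Fz[of m] GF[of "Suc m" x] by linarith
  qed
  then show ?thesis
  proof (intro that[of z xs])
    show "z \<in> S" using zT[of 0] P0 by simp
    show "xs k \<in> S" for k using PP by blast
    show "\<mu> * \<rho> z x0 \<le> f x0" by (rule close0[OF zT])
    show "\<mu> * \<rho> (xs k) x0 \<le> f x0" for k
    proof (cases k)
      case 0 then show ?thesis using f(2)[OF S(2)] by (simp add: P0 \<rho>xx)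
    next
      case (Suc m)
      then show ?thesis using PP(3)[of k] Tanti[of 1 k] by (intro close0) auto
    qed
  qed (use smb in \<open>auto simp: F_def\<close>)
qed

text \<open>Frechet superdifferentiability along \<open>Y\<close>, with superderivative \<open>t\<close>.\<close>

definition superdiff :: "'a::real_normed_vector set \<Rightarrow> ('a \<Rightarrow> real) \<Rightarrow> 'a \<Rightarrow> ('a \<Rightarrow> real) \<Rightarrow> bool" where
  "superdiff Y \<phi> y t \<longleftrightarrow> (\<forall>\<eta>>0. \<exists>\<delta>>0. \<forall>h\<in>Y. norm h < \<delta> \<longrightarrow> \<phi> (y + h) \<le> \<phi> y + t h + \<eta> * norm h)"

lemma superdiff_square:
  fixes p :: "'a::real_normed_vector \<Rightarrow> real"
  assumes p: "0 \<le> p y" "\<And>h. \<bar>p (y + h) - p y\<bar> \<le> norm h" and f: "superdiff Y p y f"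
  shows "superdiff Y (\<lambda>x. (p x)\<^sup>2) y (\<lambda>h. 2 * p y * f h)"
  unfolding superdiff_def
proof (intro allI impI)
  fix \<eta> :: real assume \<eta>: "\<eta> > 0"
  define \<eta>' where "\<eta>' = \<eta> / (4 * (p y + 1))"
  have \<eta>': "\<eta>' > 0" using \<eta> p(1) by (simp add: \<eta>'_def)
  then obtain \<delta> where \<delta>: "\<delta> > 0" "\<forall>h\<in>Y. norm h < \<delta> \<longrightarrow> p (y + h) \<le> p y + f h + \<eta>' * norm h"
    using f unfolding superdiff_def by blast
  have "(p (y + h))\<^sup>2 \<le> (p y)\<^sup>2 + 2 * p y * f h + \<eta> * norm h" if h: "h \<in> Y" "norm h < min \<delta> (\<eta> / 2)" for h
  proof -
    define d where "d = p (y + h) - p y"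
    have d: "\<bar>d\<bar> \<le> norm h" "d \<le> f h + \<eta>' * norm h" using p(2)[of h] \<delta>(2) h by (auto simp: d_def)
    have "\<bar>d\<bar>\<^sup>2 \<le> (norm h)\<^sup>2" using d(1) by (intro power_mono) auto
    also have "\<dots> \<le> \<eta> / 2 * norm h" unfolding power2_eq_square using h(2) by (intro mult_right_mono) auto
    finally have 1: "d\<^sup>2 \<le> \<eta> / 2 * norm h" by simp
    have 2: "2 * p y * d \<le> 2 * p y * (f h + \<eta>' * norm h)" using d(2) p(1) by (intro mult_left_mono) auto
    have "2 * p y * \<eta>' \<le> \<eta> / 2" using \<eta> p(1) by (simp add: \<eta>'_def field_simps)
    then have 3: "2 * p y * \<eta>' * norm h \<le> \<eta> / 2 * norm h" by (intro mult_right_mono) auto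
    have "(p (y + h))\<^sup>2 = (p y)\<^sup>2 + 2 * p y * d + d\<^sup>2" by (simp add: d_def power2_eq_square algebra_simps)
    then show ?thesis using 1 2 3 by (simp add: algebra_simps)
  qed
  then show "\<exists>\<delta>>0. \<forall>h\<in>Y. norm h < \<delta> \<longrightarrow> (p (y + h))\<^sup>2 \<le> (p y)\<^sup>2 + 2 * p y * f h + \<eta> * norm h"
    using \<delta>(1) \<eta> by (intro exI[of _ "min \<delta> (\<eta> / 2)"]) auto
qed

text \<open>Finitely many terms are estimated by their superderivatives and the tail by the common Lipschitz-type bound.\<close>

lemma superdiff_series:
  fixes \<phi> :: "nat \<Rightarrow> 'a::real_normed_vector \<Rightarrow> real"
  assumes w: "\<And>k. 0 \<le> w k" "summable w"
    and sd: "\<And>k. superdiff Y (\<phi> k) y (t k)"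
    and unif: "\<And>k h. norm h < 1 \<Longrightarrow> \<phi> k (y + h) \<le> \<phi> k y + t k h + C * norm h"
    and sm: "\<And>x. summable (\<lambda>k. w k * \<phi> k x)" "\<And>h. summable (\<lambda>k. w k * t k h)"
  shows "superdiff Y (\<lambda>x. \<Sum>k. w k * \<phi> k x) y (\<lambda>h. \<Sum>k. w k * t k h)"
  unfolding superdiff_def
proof (intro allI impI)
  fix \<eta> :: real assume \<eta>: "\<eta> > 0"
  define \<eta>' where "\<eta>' = \<eta> / (2 * (suminf w + 1))"
  have w0: "0 \<le> suminf w" using w by (intro suminf_nonneg) auto
  then have \<eta>': "\<eta>' > 0" using \<eta> by (simp add: \<eta>'_def)
  have "\<eta> / (2 * (\<bar>C\<bar> + 1)) > 0" using \<eta> by (simp add: add_nonneg_pos)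
  then obtain M where M: "\<And>n. n \<ge> M \<Longrightarrow> norm (\<Sum>i. w (i + n)) < \<eta> / (2 * (\<bar>C\<bar> + 1))"
    using suminf_exist_split[OF _ w(2)] by blast
  have "\<forall>k. \<exists>\<delta>>0. \<forall>h\<in>Y. norm h < \<delta> \<longrightarrow> \<phi> k (y + h) \<le> \<phi> k y + t k h + \<eta>' * norm h"
    using sd \<eta>' unfolding superdiff_def by blast
  then obtain \<delta> where \<delta>: "\<And>k. \<delta> k > 0"
    "\<And>k h. h \<in> Y \<Longrightarrow> norm h < \<delta> k \<Longrightarrow> \<phi> k (y + h) \<le> \<phi> k y + t k h + \<eta>' * norm h"
    by metis
  define d where "d = Min (insert 1 (\<delta> ` {..<M}))"
  have d: "d > 0" "d \<le> 1" "\<And>k. k < M \<Longrightarrow> d \<le> \<delta> k" using \<delta>(1) by (auto simp: d_def)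
  define \<beta> where "\<beta> = (\<lambda>k. w k * (if k < M then \<eta>' else \<bar>C\<bar>))"
  have \<beta>s: "summable \<beta>"
  proof (rule summable_comparison_test'[where N = 0])
    show "summable (\<lambda>k. w k * (\<eta>' + \<bar>C\<bar>))" by (intro summable_mult2 w)
    show "norm (\<beta> k) \<le> w k * (\<eta>' + \<bar>C\<bar>)" for k
      using w(1)[of k] \<eta>' by (auto simp: \<beta>_def abs_mult intro!: mult_left_mono)
  qed
  have \<beta>: "suminf \<beta> \<le> \<eta>"
  proof -
    have "suminf \<beta> = (\<Sum>k. \<beta> (k + M)) + sum \<beta> {..<M}" by (rule suminf_split_initial_segment[OF \<beta>s])
    also have "(\<Sum>k. \<beta> (k + M)) = (\<Sum>k. w (k + M)) * \<bar>C\<bar>"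
      unfolding \<beta>_def by (simp add: suminf_mult2[symmetric] summable_iff_shift w(2))
    also have "\<dots> \<le> \<eta> / (2 * (\<bar>C\<bar> + 1)) * \<bar>C\<bar>" using M[of M] by (intro mult_right_mono) auto
    also have "\<dots> \<le> \<eta> / 2" using \<eta> by (simp add: field_simps)
    also have "sum \<beta> {..<M} = sum w {..<M} * \<eta>'" by (simp add: \<beta>_def sum_distrib_right)
    also have "\<dots> \<le> suminf w * \<eta>'" using w \<eta>' by (intro mult_right_mono sum_le_suminf) auto
    also have "\<dots> \<le> \<eta> / 2" using w0 \<eta> by (simp add: \<eta>'_def field_simps)
    finally show ?thesis by simp
  qed
  have "(\<Sum>k. w k * \<phi> k (y + h)) \<le> (\<Sum>k. w k * \<phi> k y) + (\<Sum>k. w k * t k h) + \<eta> * norm h"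
    if h: "h \<in> Y" "norm h < d" for h
  proof -
    have "(\<Sum>k. w k * \<phi> k (y + h)) \<le> (\<Sum>k. w k * \<phi> k y + w k * t k h + \<beta> k * norm h)"
    proof (rule suminf_le)
      fix k
      have "\<phi> k (y + h) \<le> \<phi> k y + t k h + (if k < M then \<eta>' else \<bar>C\<bar>) * norm h"
      proof (cases "k < M")
        case True
        then show ?thesis using \<delta>(2)[of h k] h d(3)[of k] by simp
      next
        case False
        have "C * norm h \<le> \<bar>C\<bar> * norm h" by (intro mult_right_mono) auto
        then show ?thesis using False unif[of h k] h(2) d(2) by simp
      qed
      then have "w k * \<phi> k (y + h) \<le> w k * (\<phi> k y + t k h + (if k < M then \<eta>' else \<bar>C\<bar>) * norm h)"
        by (rule mult_left_mono[OF _ w(1)])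
      then show "w k * \<phi> k (y + h) \<le> w k * \<phi> k y + w k * t k h + \<beta> k * norm h"
        by (simp only: \<beta>_def distrib_left mult.assoc)
    qed (intro summable_add sm \<beta>s summable_mult2)+
    also have "\<dots> = (\<Sum>k. w k * \<phi> k y) + (\<Sum>k. w k * t k h) + suminf \<beta> * norm h"
      by (simp add: suminf_add[symmetric] suminf_mult2 sm \<beta>s summable_add summable_mult2)
    also have "\<dots> \<le> (\<Sum>k. w k * \<phi> k y) + (\<Sum>k. w k * t k h) + \<eta> * norm h"
      using \<beta> by (intro add_left_mono mult_right_mono) auto
    finally show ?thesis .
  qed
  then show "\<exists>\<delta>>0. \<forall>h\<in>Y. norm h < \<delta> \<longrightarrow>
      (\<Sum>k. w k * \<phi> k (y + h)) \<le> (\<Sum>k. w k * \<phi> k y) + (\<Sum>k. w k * t k h) + \<eta> * norm h"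
    using d(1) by blast
qed

text \<open>The condition of the Frechet normal cone for a plain functional. For a point and a set inside a subspace it concerns only
the values of \<open>f\<close> on this subspace.\<close>

definition normal_along :: "'a::real_normed_vector set \<Rightarrow> 'a \<Rightarrow> ('a \<Rightarrow> real) \<Rightarrow> bool" where
  "normal_along S x f \<longleftrightarrow> (\<forall>\<eta>>0. \<exists>\<delta>>0. \<forall>z\<in>S. norm (z - x) < \<delta> \<longrightarrow> f (z - x) \<le> \<eta> * norm (z - x))"

text \<open>Fermat's rule. The sign \<open>\<sigma>\<close> tells whether the variable enters \<open>\<phi>\<close> with a plus or a minus, which differs between the two
sets.\<close>

lemma normal_along_of_minimum:
  assumes Y: "subspace Y" and S: "S \<subseteq> Y" and x: "x \<in> Y"
    and sd: "superdiff Y \<phi> y t" "superdiff Y \<psi> x s"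
    and \<sigma>: "\<sigma> = 1 \<or> \<sigma> = -1"
    and min: "\<And>z. z \<in> S \<Longrightarrow> \<phi> y + \<psi> x \<le> \<phi> (y + \<sigma> *\<^sub>R (z - x)) + \<psi> z"
  shows "normal_along S x (\<lambda>h. - (t (\<sigma> *\<^sub>R h) + s h))"
  unfolding normal_along_def
proof (intro allI impI)
  fix \<eta> :: real assume "\<eta> > 0"
  then have "\<eta> / 2 > 0" by simp
  then obtain d1 d2 where d: "d1 > 0" "\<forall>h\<in>Y. norm h < d1 \<longrightarrow> \<phi> (y + h) \<le> \<phi> y + t h + \<eta> / 2 * norm h"
    "d2 > 0" "\<forall>h\<in>Y. norm h < d2 \<longrightarrow> \<psi> (x + h) \<le> \<psi> x + s h + \<eta> / 2 * norm h"
    using sd unfolding superdiff_def by blast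
  have "- (t (\<sigma> *\<^sub>R (z - x)) + s (z - x)) \<le> \<eta> * norm (z - x)" if z: "z \<in> S" "norm (z - x) < min d1 d2" for z
  proof -
    define h where "h = z - x"
    have h: "h \<in> Y" "\<sigma> *\<^sub>R h \<in> Y" using z(1) S x Y by (auto simp: h_def subspace_diff subspace_scale)
    have nh: "norm (\<sigma> *\<^sub>R h) = norm h" using \<sigma> by auto
    have "\<phi> (y + \<sigma> *\<^sub>R h) \<le> \<phi> y + t (\<sigma> *\<^sub>R h) + \<eta> / 2 * norm h"
      using d(2) h(2) z(2) nh by (metis h_def min_less_iff_conj)
    moreover have "\<psi> (x + h) \<le> \<psi> x + s h + \<eta> / 2 * norm h"
      using bspec[OF d(4) h(1)] z(2) by (simp add: h_def)
    moreover have "x + h = z" by (simp add: h_def)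
    ultimately show ?thesis using min[OF z(1)] by (simp add: h_def)
  qed
  then show "\<exists>\<delta>>0. \<forall>z\<in>S. norm (z - x) < \<delta> \<longrightarrow> - (t (\<sigma> *\<^sub>R (z - x)) + s (z - x)) \<le> \<eta> * norm (z - x)"
    using d(1,3) by (intro exI[of _ "min d1 d2"]) simp
qed

text \<open>The perturbation produced by the variational principle is superdifferentiable everywhere: the square of the gauge is so
also at the origin, where the gauge itself is not.\<close>

lemma superdiff_penalty:
  fixes p :: "'a::real_normed_vector \<Rightarrow> real"
  assumes p: "\<And>x. 0 \<le> p x" "\<And>x. p x \<le> norm x" "\<And>x y. \<bar>p x - p y\<bar> \<le> norm (x - y)"
    and sd: "\<And>y. y \<noteq> 0 \<Longrightarrow> \<exists>f\<in>dual_ball. superdiff Y p y f"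
    and \<mu>: "\<mu> > 0" and R: "\<And>k. norm (x - xs k) \<le> R"
    and sm: "\<And>x. summable (\<lambda>k. \<mu> * (1/2)^k * (p (x - xs k))\<^sup>2)"
  obtains s where "linear s" "\<And>h. \<bar>s h\<bar> \<le> 4 * \<mu> * R * norm h"
    "superdiff Y (\<lambda>x. \<Sum>k. \<mu> * (1/2)^k * (p (x - xs k))\<^sup>2) x s"
proof -
  have R0: "0 \<le> R" using R[of 0] norm_ge_zero order_trans by blast
  have "\<exists>f\<in>dual_ball. superdiff Y (\<lambda>x. (p x)\<^sup>2) y (\<lambda>h. 2 * p y * f h)" for y
  proof (cases "y = 0")
    case True
    obtain f :: "'a \<Rightarrow> real" where f: "linear f" "\<And>x. \<bar>f x\<bar> \<le> norm x" using norming_functional[of 0] by blast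
    have p0: "p 0 = 0" using p(1)[of 0] p(2)[of 0] by simp
    have "(p h)\<^sup>2 \<le> \<eta> * norm h" if "norm h < \<eta>" for \<eta> h
    proof -
      have "(p h)\<^sup>2 \<le> (norm h)\<^sup>2" by (intro power_mono p)
      also have "\<dots> \<le> \<eta> * norm h" unfolding power2_eq_square using that by (intro mult_right_mono) auto
      finally show ?thesis .
    qed
    then have "superdiff Y (\<lambda>x. (p x)\<^sup>2) y (\<lambda>h. 2 * p y * f h)"
      unfolding superdiff_def True p0 by auto
    then show ?thesis using dual_ballI[OF f] by blast
  next
    case False
    obtain f where f: "f \<in> dual_ball" "superdiff Y p y f" using sd[OF False] by blast
    have "\<bar>p (y + h) - p y\<bar> \<le> norm h" for h using p(3)[of "y + h" y] by simp
    from superdiff_square[OF p(1) this f(2)] show ?thesis using f(1) by blast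
  qed
  then obtain F where F: "\<And>y. F y \<in> dual_ball" "\<And>y. superdiff Y (\<lambda>x. (p x)\<^sup>2) y (\<lambda>h. 2 * p y * F y h)"
    by metis
  define t where "t = (\<lambda>k h. 2 * p (x - xs k) * F (x - xs k) h)"
  have tb: "\<bar>t k h\<bar> \<le> 2 * R * norm h" for k h
  proof -
    have "p (x - xs k) \<le> R" using p(2)[of "x - xs k"] R[of k] by simp
    then have "2 * p (x - xs k) * \<bar>F (x - xs k) h\<bar> \<le> 2 * R * norm h"
      using p(1) dual_ballD(2)[OF F(1)] R0 by (intro mult_mono) auto
    then show ?thesis using p(1) by (simp add: t_def abs_mult)
  qed
  have w: "summable (\<lambda>k. \<mu> * (1/2)^k)" "(\<Sum>k. \<mu> * (1/2)^k) = 2 * \<mu>"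
  proof -
    show "summable (\<lambda>k. \<mu> * (1/2)^k)" by (intro summable_mult summable_geometric) simp
    show "(\<Sum>k. \<mu> * (1/2)^k) = 2 * \<mu>"
      using suminf_mult[OF summable_geometric, of "1/2::real" \<mu>] suminf_geometric[of "1/2::real"] by simp
  qed
  have wb: "summable (\<lambda>k. \<mu> * (1/2)^k * (2 * R * norm h))" for h by (intro summable_mult2 w)
  have tn: "norm (\<mu> * (1/2)^k * t k h) \<le> \<mu> * (1/2)^k * (2 * R * norm h)" for k h
    using tb[of k h] \<mu> by (simp add: abs_mult)
  have ts: "summable (\<lambda>k. \<mu> * (1/2)^k * t k h)" for h
    by (rule summable_comparison_test'[OF wb[of h], where N = 0]) (rule tn)
  define s where "s = (\<lambda>h. \<Sum>k. \<mu> * (1/2)^k * t k h)"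
  show ?thesis
  proof (rule that[of s])
    show "linear s"
    proof (rule linearI)
      show "s (a + b) = s a + s b" for a b
        unfolding s_def suminf_add[OF ts ts]
        by (simp add: t_def dual_ballD(3)[OF F(1)] algebra_simps)
      show "s (c *\<^sub>R b) = c *\<^sub>R s b" for c b
        unfolding s_def real_scaleR_def suminf_mult[OF ts, symmetric]
        by (simp add: t_def dual_ballD(5)[OF F(1)] algebra_simps)
    qed
    show "\<bar>s h\<bar> \<le> 4 * \<mu> * R * norm h" for h
    proof -
      have "norm (s h) \<le> (\<Sum>k. \<mu> * (1/2)^k * (2 * R * norm h))"
        unfolding s_def by (rule norm_suminf_le[OF tn wb])
      also have "\<dots> = 4 * \<mu> * R * norm h" using suminf_mult2[OF w(1), of "2 * R * norm h"] w(2) by simp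
      finally show ?thesis by simp
    qed
    show "superdiff Y (\<lambda>x. \<Sum>k. \<mu> * (1/2)^k * (p (x - xs k))\<^sup>2) x s" unfolding s_def
    proof (rule superdiff_series[where C = "4 * R + 1"])
      show "0 \<le> \<mu> * (1/2)^k" for k :: nat using \<mu> by simp
      show "superdiff Y (\<lambda>z. (p (z - xs k))\<^sup>2) x (t k)" for k
        using F(2)[of "x - xs k"] unfolding superdiff_def t_def by (simp add: algebra_simps)
      show "(p (x + h - xs k))\<^sup>2 \<le> (p (x - xs k))\<^sup>2 + t k h + (4 * R + 1) * norm h" if h: "norm h < 1" for k h
      proof -
        have d: "\<bar>p (x + h - xs k) - p (x - xs k)\<bar> \<le> norm h"
          using p(3)[of "x + h - xs k" "x - xs k"] by simp
        have le: "p (x + h - xs k) + p (x - xs k) \<le> 2 * R + 1"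
          using d p(2)[of "x - xs k"] R[of k] h by simp
        have "(p (x + h - xs k))\<^sup>2 - (p (x - xs k))\<^sup>2
          = (p (x + h - xs k) - p (x - xs k)) * (p (x + h - xs k) + p (x - xs k))"
          by (simp add: power2_eq_square algebra_simps)
        also have "\<dots> \<le> norm h * (2 * R + 1)"
          using d le p(1) R0 by (intro mult_mono) auto
        finally have "(p (x + h - xs k))\<^sup>2 \<le> (p (x - xs k))\<^sup>2 + norm h * (2 * R + 1)" by simp
        moreover have "norm h * (2 * R + 1) = (4 * R + 1) * norm h - 2 * R * norm h" by (simp add: algebra_simps)
        ultimately show ?thesis using tb[of k h] by (simp add: abs_le_iff)
      qed
    qed (use w ts sm in auto)
  qed
qed

text \<open>The variational principle is applied to \<open>p (x - y - w)\<close> on \<open>(A \<inter> Y) \<times> (B \<inter> Y)\<close>, where \<open>w = a0 + u - b0 - v\<close>. Its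
value at \<open>(a0, b0)\<close> is at most \<open>2 e r\<close>. The choice \<open>\<mu> = 32 e / r\<close> keeps the minimum within \<open>r / 2\<close> of \<open>(a0, b0)\<close>
while the slope of the perturbation stays below \<open>4 \<mu> r = 128 e\<close>. Within this distance \<open>x - y - w\<close> cannot vanish, since otherwise the two
translated sets would have a common point in the ball of radius \<open>r\<close>.\<close>

lemma normals_along_separable_subspace:
  fixes A B :: "'a::banach set"
  assumes asp: "asplund_space TYPE('a)" and D: "countable D" and Y: "Y = closure D" "subspace Y"
    and cl: "closed A" "closed B" and pts: "a0 \<in> A" "a0 \<in> Y" "b0 \<in> B" "b0 \<in> Y" "u \<in> Y" "v \<in> Y"
    and e: "0 < e" "e \<le> 1 / 512" and r: "0 < r"
    and small: "norm u < e * r" "norm v < e * r"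
    and disj: "\<forall>a\<in>A. \<forall>b\<in>B. a - a0 - u = b - b0 - v \<longrightarrow> r < norm (b - b0 - v)"
  obtains a b f g y where "a \<in> A" "a \<in> Y" "b \<in> B" "b \<in> Y" "norm (a - a0) \<le> r / 2" "norm (b - b0) \<le> r / 2"
    "linear f" "linear g" "\<And>h. \<bar>f h\<bar> \<le> 2 * norm h" "\<And>h. \<bar>f h + g h\<bar> \<le> 256 * e * norm h"
    "y \<in> Y" "y \<noteq> 0" "f y \<ge> norm y / 4"
    "normal_along (A \<inter> Y) a f" "normal_along (B \<inter> Y) b g"
proof -
  obtain p :: "'a \<Rightarrow> real" where p: "\<And>x. norm x / 2 \<le> p x" "\<And>x. p x \<le> norm x"
    "\<And>x y. p (x + y) \<le> p x + p y" "\<And>x. p (- x) = p x" and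
    sd: "\<And>y. y \<noteq> 0 \<Longrightarrow> \<exists>f\<in>dual_ball. f y = p y \<and>
       (\<forall>\<eta>>0. \<exists>\<delta>>0. \<forall>h\<in>Y. norm h < \<delta> \<longrightarrow> p (y + h) \<le> p y + f h + \<eta> * norm h)"
    using smooth_gauge[OF asp D Y] by metis
  have p0: "0 \<le> p x" for x using p(1)[of x] norm_ge_zero[of x] by linarith
  have plip: "\<bar>p x - p z\<bar> \<le> norm (x - z)" for x z
    using p(3)[of "x - z" z] p(3)[of "z - x" x] p(2)[of "x - z"] p(2)[of "z - x"]
    by (simp add: norm_minus_commute)
  have pcont: "continuous_on UNIV p"
  proof (rule lipschitz_on_continuous_on[of 1])
    show "1-lipschitz_on UNIV p" by (rule lipschitz_onI) (use plip in \<open>auto simp: dist_norm\<close>)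
  qed
  have psd: "\<exists>f\<in>dual_ball. superdiff Y p y f" if "y \<noteq> 0" for y
    using sd[OF that] unfolding superdiff_def by blast
  have clY: "closed Y" using Y(1) by simp
  define w where "w = a0 + u - b0 - v"
  define S where "S = (A \<inter> Y) \<times> (B \<inter> Y)"
  define F where "F = (\<lambda>z::'a \<times> 'a. p (fst z - snd z - w))"
  define \<rho> where "\<rho> = (\<lambda>x z::'a \<times> 'a. (p (fst x - fst z))\<^sup>2 + (p (snd x - snd z))\<^sup>2)"
  define \<mu> where "\<mu> = 32 * e / r"
  have \<mu>: "\<mu> > 0" using e r by (simp add: \<mu>_def)
  have F0: "F (a0, b0) \<le> 2 * e * r"
  proof -
    have "F (a0, b0) = p (v - u)" by (simp add: F_def w_def algebra_simps)
    also have "\<dots> \<le> norm v + norm u" using p(2)[of "v - u"] norm_triangle_ineq4[of v u] by linarith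
    finally show ?thesis using small by simp
  qed
  have nsq: "(norm (x - z))\<^sup>2 = (norm (fst x - fst z))\<^sup>2 + (norm (snd x - snd z))\<^sup>2" for x z :: "'a \<times> 'a"
    by (simp add: norm_prod_def)
  have p4: "(norm x)\<^sup>2 \<le> 4 * (p x)\<^sup>2" for x
    using power_mono[OF p(1)[of x], of 2] by (simp add: power_divide)
  obtain z xs where z: "z \<in> S" "\<And>k. xs k \<in> S" "\<And>k. \<mu> * \<rho> (xs k) (a0, b0) \<le> F (a0, b0)"
      "\<mu> * \<rho> z (a0, b0) \<le> F (a0, b0)"
    and sm: "\<And>x. summable (\<lambda>k. \<mu> * (1/2)^k * \<rho> x (xs k))"
    and min: "\<And>x. x \<in> S \<Longrightarrow> F z + (\<Sum>k. \<mu> * (1/2)^k * \<rho> z (xs k)) \<le> F x + (\<Sum>k. \<mu> * (1/2)^k * \<rho> x (xs k))"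
  proof (rule Borwein_Preiss[of S "(a0, b0)" F \<rho> \<mu>])
    show "closed S" unfolding S_def by (intro closed_Times closed_Int cl clY)
    show "(a0, b0) \<in> S" using pts by (simp add: S_def)
    show "continuous_on UNIV F" unfolding F_def
      by (intro continuous_on_compose2[OF pcont] continuous_intros) auto
    show "0 \<le> F x" for x by (simp add: F_def p0)
    show "(norm (x - z))\<^sup>2 \<le> 4 * \<rho> x z" for x z
      unfolding nsq \<rho>_def using p4[of "fst x - fst z"] p4[of "snd x - snd z"] by simp
    show "\<rho> x z \<le> (norm (x - z))\<^sup>2" for x z
      unfolding nsq \<rho>_def by (intro add_mono power_mono p p0)
    show "continuous_on UNIV (\<lambda>x. \<rho> x z)" for z unfolding \<rho>_def
      by (intro continuous_intros continuous_on_compose2[OF pcont]) auto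
  qed (use \<mu> in auto)
  obtain a b where ab: "z = (a, b)" by (cases z)
  define as where "as = (\<lambda>k. fst (xs k))"
  define bs where "bs = (\<lambda>k. snd (xs k))"
  have near: "norm (fst x - a0) \<le> r / 2 \<and> norm (snd x - b0) \<le> r / 2"
    if "\<mu> * \<rho> x (a0, b0) \<le> F (a0, b0)" for x
  proof -
    have "\<mu> * \<rho> x (a0, b0) \<le> 2 * e * r" using that F0 by simp
    then have "\<rho> x (a0, b0) \<le> r\<^sup>2 / 16" using e r by (simp add: \<mu>_def field_simps power2_eq_square)
    then have "(norm (x - (a0, b0)))\<^sup>2 \<le> r\<^sup>2 / 4"
      unfolding nsq \<rho>_def using p4[of "fst x - a0"] p4[of "snd x - b0"] by simp
    then have "(norm (x - (a0, b0)))\<^sup>2 \<le> (r / 2)\<^sup>2" by (simp add: power_divide)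
    then have "norm (x - (a0, b0)) \<le> r / 2" by (rule power2_le_imp_le) (use r in simp)
    moreover have "x - (a0, b0) = (fst x - a0, snd x - b0)" by (simp add: prod_eq_iff)
    ultimately show ?thesis
      using norm_fst_le[of "fst x - a0" "snd x - b0"] norm_snd_le[of "snd x - b0" "fst x - a0"] by simp
  qed
  have na: "norm (a - a0) \<le> r / 2" "norm (b - b0) \<le> r / 2" using near[OF z(4)] ab by auto
  have nas: "norm (as k - a0) \<le> r / 2" "norm (bs k - b0) \<le> r / 2" for k
    using near[OF z(3)] by (auto simp: as_def bs_def)
  have Ra: "norm (a - as k) \<le> r" for k
    using norm_triangle_ineq4[of "a - a0" "as k - a0"] na nas(1)[of k] by simp
  have Rb: "norm (b - bs k) \<le> r" for k
    using norm_triangle_ineq4[of "b - b0" "bs k - b0"] na nas(2)[of k] by simp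
  have abS: "a \<in> A" "a \<in> Y" "b \<in> B" "b \<in> Y" using z(1) by (auto simp: S_def ab)
  have sma: "summable (\<lambda>k. \<mu> * (1/2)^k * (p (x - as k))\<^sup>2)" for x
    by (rule summable_comparison_test'[OF sm[of "(x, b)"], where N = 0])
      (use \<mu> p0 in \<open>simp add: \<rho>_def as_def\<close>)
  have smb: "summable (\<lambda>k. \<mu> * (1/2)^k * (p (x - bs k))\<^sup>2)" for x
    by (rule summable_comparison_test'[OF sm[of "(a, x)"], where N = 0])
      (use \<mu> p0 in \<open>simp add: \<rho>_def bs_def\<close>)
  define \<Phi> where "\<Phi> = (\<lambda>x. \<Sum>k. \<mu> * (1/2)^k * (p (x - as k))\<^sup>2)"
  define \<Psi> where "\<Psi> = (\<lambda>x. \<Sum>k. \<mu> * (1/2)^k * (p (x - bs k))\<^sup>2)"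
  have split: "(\<Sum>k. \<mu> * (1/2)^k * \<rho> (x, x') (xs k)) = \<Phi> x + \<Psi> x'" for x x'
    unfolding \<Phi>_def \<Psi>_def suminf_add[OF sma smb]
    by (simp add: \<rho>_def as_def bs_def distrib_left)
  obtain sa where sa: "linear sa" "\<And>h. \<bar>sa h\<bar> \<le> 4 * \<mu> * r * norm h" "superdiff Y \<Phi> a sa"
    using superdiff_penalty[OF p0 p(2) plip psd \<mu> Ra sma] unfolding \<Phi>_def by blast
  obtain sb where sb: "linear sb" "\<And>h. \<bar>sb h\<bar> \<le> 4 * \<mu> * r * norm h" "superdiff Y \<Psi> b sb"
    using superdiff_penalty[OF p0 p(2) plip psd \<mu> Rb smb] unfolding \<Psi>_def by blast
  have slope: "4 * \<mu> * r = 128 * e" using r by (simp add: \<mu>_def)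
  define y where "y = a - b - w"
  have wY: "w \<in> Y" unfolding w_def using pts by (intro subspace_diff subspace_add Y)
  have yY: "y \<in> Y" unfolding y_def using abS wY by (intro subspace_diff Y)
  have "y \<noteq> 0"
  proof
    assume "y = 0"
    then have "a - a0 - u = b - b0 - v" by (simp add: y_def w_def algebra_simps)
    then have "r < norm (b - b0 - v)" using disj abS(1,3) by blast
    also have "\<dots> \<le> norm (b - b0) + norm v" by (rule norm_triangle_ineq4)
    also have "\<dots> \<le> r / 2 + e * r" using na small by simp
    finally have "r / 2 < e * r" by simp
    moreover have "e * r \<le> 1 / 2 * r" using e r by (intro mult_right_mono) auto
    ultimately show False by simp
  qed
  then obtain t where t: "t \<in> dual_ball" "t y = p y" "superdiff Y p y t"
    using sd unfolding superdiff_def by blast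
  define f where "f = (\<lambda>h. - (t (1 *\<^sub>R h) + sa h))"
  define g where "g = (\<lambda>h. - (t ((-1) *\<^sub>R h) + sb h))"
  note tl = dual_ballD(1)[OF t(1)]
  have "normal_along (A \<inter> Y) a f" unfolding f_def
  proof (rule normal_along_of_minimum[OF Y(2) _ abS(2) t(3) sa(3)])
    fix x assume "x \<in> A \<inter> Y"
    then have "(x, b) \<in> S" using abS by (simp add: S_def)
    from min[OF this] have "p y + \<Phi> a \<le> p (x - b - w) + \<Phi> x" by (simp add: F_def ab split y_def)
    moreover have "x - b - w = y + 1 *\<^sub>R (x - a)" by (simp add: y_def)
    ultimately show "p y + \<Phi> a \<le> p (y + 1 *\<^sub>R (x - a)) + \<Phi> x" by simp
  qed auto
  moreover have "normal_along (B \<inter> Y) b g" unfolding g_def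
  proof (rule normal_along_of_minimum[OF Y(2) _ abS(4) t(3) sb(3)])
    fix x assume "x \<in> B \<inter> Y"
    then have "(a, x) \<in> S" using abS by (simp add: S_def)
    from min[OF this] have "p y + \<Psi> b \<le> p (a - x - w) + \<Psi> x" by (simp add: F_def ab split y_def)
    moreover have "a - x - w = y + (-1) *\<^sub>R (x - b)" by (simp add: y_def)
    ultimately show "p y + \<Psi> b \<le> p (y + (-1) *\<^sub>R (x - b)) + \<Psi> x" by simp
  qed auto
  moreover have "linear f" "linear g"
  proof -
    show "linear f" unfolding f_def
      by (rule linearI) (simp_all add: linear_add[OF tl] linear_add[OF sa(1)] linear_scale[OF tl] linear_scale[OF sa(1)] algebra_simps)
    show "linear g" unfolding g_def
      by (rule linearI) (simp_all add: linear_add[OF tl] linear_add[OF sb(1)] linear_scale[OF tl] linear_scale[OF sb(1)] linear_neg[OF tl] linear_diff[OF tl] algebra_simps)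
  qed
  moreover have f2: "\<bar>f h\<bar> \<le> 2 * norm h" for h
  proof -
    have "\<bar>sa h\<bar> \<le> 128 * e * norm h" using sa(2)[of h] slope by simp
    also have "\<dots> \<le> 1 * norm h" using e by (intro mult_right_mono) auto
    finally show ?thesis using dual_ballD(2)[OF t(1), of h] by (simp add: f_def abs_le_iff)
  qed
  moreover have "\<bar>f h + g h\<bar> \<le> 256 * e * norm h" for h
    using sa(2)[of h] sb(2)[of h] slope dual_ballD(6)[OF t(1), of h] by (simp add: f_def g_def abs_le_iff)
  moreover have "f (- y) \<ge> norm (- y) / 4"
  proof -
    have "\<bar>sa y\<bar> \<le> 128 * e * norm y" using sa(2)[of y] slope by simp
    also have "\<dots> \<le> 1 / 4 * norm y" using e by (intro mult_right_mono) auto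
    finally have "\<bar>sa y\<bar> \<le> norm y / 4" by simp
    moreover have "f (- y) = t y + sa y"
      using linear_neg[OF tl, of y] linear_neg[OF sa(1), of y] by (simp add: f_def)
    ultimately show ?thesis using t(2) p(1)[of y] by simp
  qed
  moreover have "- y \<in> Y" "- y \<noteq> 0" using yY \<open>y \<noteq> 0\<close> subspace_neg[OF Y(2)] by auto
  ultimately show ?thesis using that[of a b f g "- y"] abS na by blast
qed

section \<open>Separable reduction for Frechet normals\<close>

text \<open>An entry \<open>(l, n, m, c)\<close> is the constraint that a functional be at most \<open>norm (c - x) / (n + 1)\<close> at \<open>c - x\<close>, used with
the multiplier \<open>l\<close>. The radius \<open>1 / (m + 1)\<close> bounds the distance from the base point \<open>x\<close> to \<open>c\<close>; being a Frechet normal means satisfying, for each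
\<open>n\<close>, all the constraints of one radius. Lists make sums of systems concatenations.\<close>

type_synonym 'z system = "(real \<times> nat \<times> nat \<times> 'z) list"

definition mass :: "'z system \<Rightarrow> real" where
  "mass xs = sum_list (map (\<lambda>(l, n, m, c). l) xs)"

definition dirsum :: "'z::real_normed_vector \<Rightarrow> 'z system \<Rightarrow> 'z" where
  "dirsum x xs = sum_list (map (\<lambda>(l, n, m, c). l *\<^sub>R (c - x)) xs)"

definition err :: "'z::real_normed_vector \<Rightarrow> 'z system \<Rightarrow> real" where
  "err x xs = sum_list (map (\<lambda>(l, n, m, c). l * (norm (c - x) / (real n + 1))) xs)"

text \<open>With nonnegative multipliers, a negative value certifies that no linear functional \<open>L \<le> p\<close> satisfies both \<open>1 \<le> L e\<close>, used
with multiplier \<open>t\<close>, and the constraints in \<open>xs\<close>.\<close>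

definition viol :: "('z::real_normed_vector \<Rightarrow> real) \<Rightarrow> 'z \<Rightarrow> 'z \<Rightarrow> real \<Rightarrow> 'z system \<Rightarrow> real" where
  "viol p e x t xs = err x xs - t + p (t *\<^sub>R e - dirsum x xs)"

definition admissible :: "'z::real_normed_vector set \<Rightarrow> 'z \<Rightarrow> 'z system \<Rightarrow> bool" where
  "admissible C x xs \<longleftrightarrow> (\<forall>(l, n, m, c)\<in>set xs. 0 \<le> l \<and> c \<in> C \<and> norm (c - x) < 1 / (real m + 1))"

text \<open>The part of a system that ranges over a countable set.\<close>

definition pattern :: "'z system \<Rightarrow> (nat \<times> nat) list" where
  "pattern xs = map (\<lambda>(l, n, m, c). (n, m)) xs"

definition points :: "'z system \<Rightarrow> 'z set" where
  "points xs = (\<lambda>(l, n, m, c). c) ` set xs"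

definition rescale :: "real \<Rightarrow> 'z system \<Rightarrow> 'z system" where
  "rescale s xs = map (\<lambda>(l, n, m, c). (s * l, n, m, c)) xs"

lemmas system_defs = mass_def dirsum_def err_def

lemma system_append:
  "mass (xs @ ys) = mass xs + mass ys" "dirsum x (xs @ ys) = dirsum x xs + dirsum x ys"
  "err x (xs @ ys) = err x xs + err x ys"
  by (simp_all add: system_defs)

lemma system_rescale:
  "mass (rescale s xs) = s * mass xs" "dirsum x (rescale s xs) = s *\<^sub>R dirsum x xs"
  "err x (rescale s xs) = s * err x xs" "pattern (rescale s xs) = pattern xs"
  by (induction xs) (auto simp: system_defs rescale_def pattern_def algebra_simps)

lemma dirsum_shift: "dirsum x' xs = dirsum x xs + mass xs *\<^sub>R (x - x')"
  by (induction xs) (auto simp: system_defs algebra_simps)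

lemma err_shift:
  assumes "\<forall>(l, n, m, c)\<in>set xs. 0 \<le> l"
  shows "err x' xs \<le> err x xs + mass xs * norm (x - x')"
  using assms
proof (induction xs)
  case (Cons a xs)
  obtain l n m c where a: "a = (l, n, m, c)" by (cases a)
  have l: "0 \<le> l" using Cons.prems by (simp add: a)
  have "norm (c - x') \<le> norm (c - x) + norm (x - x')"
    using norm_triangle_ineq[of "c - x" "x - x'"] by simp
  then have "norm (c - x') / (real n + 1) \<le> norm (c - x) / (real n + 1) + norm (x - x') / (real n + 1)"
    by (simp add: add_divide_distrib[symmetric] divide_right_mono)
  also have "norm (x - x') / (real n + 1) \<le> norm (x - x') / 1"
    by (intro divide_left_mono) auto
  finally have "l * (norm (c - x') / (real n + 1)) \<le> l * (norm (c - x) / (real n + 1) + norm (x - x'))"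
    using l by (intro mult_left_mono) auto
  then show ?case using Cons by (simp add: a system_defs algebra_simps)
qed (simp add: system_defs)

text \<open>Certificates of bounded mass survive a small move of the base point. This allows base points in the closure of
a countable set.\<close>

lemma viol_shift:
  assumes p: "sublinear p" "\<And>x. p x \<le> K * norm x" and xs: "\<forall>(l, n, m, c)\<in>set xs. 0 \<le> l" "mass xs \<le> 1"
    and K: "0 \<le> K"
  shows "viol p e x' t xs \<le> viol p e x t xs + (1 + K) * norm (x - x')"
proof -
  have m0: "0 \<le> mass xs" unfolding mass_def using xs(1) by (intro sum_list_nonneg) auto
  have "t *\<^sub>R e - dirsum x' xs = (t *\<^sub>R e - dirsum x xs) + mass xs *\<^sub>R (x' - x)"
    by (simp add: dirsum_shift[of x' xs x] algebra_simps)
  then have "p (t *\<^sub>R e - dirsum x' xs) \<le> p (t *\<^sub>R e - dirsum x xs) + p (mass xs *\<^sub>R (x' - x))"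
    using sublinear_add[OF p(1), of "t *\<^sub>R e - dirsum x xs" "mass xs *\<^sub>R (x' - x)"] by (simp only:)
  also have "p (mass xs *\<^sub>R (x' - x)) \<le> mass xs * (K * norm (x - x'))"
    using p(2)[of "x' - x"] sublinear_scale[OF p(1) m0, of "x' - x"] m0
    by (simp add: mult_left_mono norm_minus_commute)
  also have "\<dots> \<le> 1 * (K * norm (x - x'))" using xs(2) K by (intro mult_right_mono) auto
  finally have 1: "p (t *\<^sub>R e - dirsum x' xs) \<le> p (t *\<^sub>R e - dirsum x xs) + K * norm (x - x')" by simp
  have "mass xs * norm (x - x') \<le> 1 * norm (x - x')" using xs(2) by (intro mult_right_mono) auto
  then have "err x' xs \<le> err x xs + norm (x - x')" using err_shift[OF xs(1), of x' x] by simp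
  then show ?thesis using 1 by (simp add: viol_def algebra_simps)
qed

text \<open>The easy half of the duality: a solution of the constraints excludes certificates.\<close>

lemma viol_nonneg:
  assumes z: "linear z" "\<And>x. z x \<le> p x" "1 \<le> z e" "0 \<le> t"
    and xs: "\<forall>(l, n, m, c)\<in>set xs. 0 \<le> l \<and> z (c - x) \<le> norm (c - x) / (real n + 1)"
  shows "0 \<le> viol p e x t xs"
proof -
  have "z (dirsum x xs) \<le> err x xs" using xs
  proof (induction xs)
    case Nil then show ?case using linear_0[OF z(1)] by (simp add: system_defs)
  next
    case (Cons a xs)
    obtain l n m c where a: "a = (l, n, m, c)" by (cases a)
    have "l * z (c - x) \<le> l * (norm (c - x) / (real n + 1))"
      using Cons.prems by (intro mult_left_mono) (auto simp: a)
    moreover have "z (l *\<^sub>R (c - x) + dirsum x xs) = l * z (c - x) + z (dirsum x xs)"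
      using linear_add[OF z(1)] linear_scale[OF z(1)] by simp
    ultimately show ?case using Cons by (simp add: a system_defs)
  qed
  moreover have "z (t *\<^sub>R e - dirsum x xs) = t * z e - z (dirsum x xs)"
    using linear_diff[OF z(1)] linear_scale[OF z(1)] by simp
  moreover have "t * 1 \<le> t * z e" using z(3,4) by (intro mult_left_mono) auto
  ultimately show ?thesis using z(2)[of "t *\<^sub>R e - dirsum x xs"] by (simp add: viol_def)
qed

definition infeasible ::
    "('z::real_normed_vector \<Rightarrow> real) \<Rightarrow> 'z set \<Rightarrow> 'z \<Rightarrow> 'z \<Rightarrow> (nat \<times> nat) list \<Rightarrow> nat \<Rightarrow> 'z system \<Rightarrow> bool" where
  "infeasible p C x e ds \<gamma> xs \<longleftrightarrow> pattern xs = ds \<and> admissible C x xs \<and> mass xs \<le> 1 \<and>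
     (\<exists>t\<ge>0. viol p e x t xs < - (1 / (real \<gamma> + 1)))"

text \<open>Whenever there is a certificate of a given pattern at a base point of \<open>R\<close>, there is one with all its points in \<open>R\<close>.
Multipliers are not prescribed, so countably many patterns and margins suffice.\<close>

definition rich :: "('z::real_normed_vector \<Rightarrow> real) \<Rightarrow> 'z set \<Rightarrow> 'z set \<Rightarrow> 'z set \<Rightarrow> bool" where
  "rich p C R E \<longleftrightarrow> (\<forall>x\<in>R. \<forall>e\<in>E. \<forall>ds \<gamma>. (\<exists>xs. infeasible p C x e ds \<gamma> xs) \<longrightarrow>
     (\<exists>xs. infeasible p C x e ds \<gamma> xs \<and> points xs \<subseteq> R))"

text \<open>By \<open>Hahn_Banach_consistency\<close>, it suffices that no certificate against the constraints of the normal cone of \<open>C\<close> at \<open>x\<close> exists,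
with suitable radii. A certificate, scaled to mass at most \<open>1\<close>, persists at a nearby base point \<open>x' \<in> R\<close>, can there be replaced
by one with points in \<open>R\<close>, and persists back at \<open>x\<close>, where it contradicts \<open>z\<close>. The radii start at a quarter of the range in
which \<open>z\<close> is controlled, which leaves room for the two moves.\<close>

theorem normal_functional_lifting:
  fixes p :: "'z::real_normed_vector \<Rightarrow> real"
  assumes p: "sublinear p" "\<And>x. p x \<le> K * norm x" "0 \<le> K"
    and rich: "rich p C R E" and e: "e \<in> E" and x: "x \<in> closure R"
    and z: "linear z" "\<And>x. z x \<le> p x" "1 \<le> z e" "normal_along (C \<inter> R) x z"
  obtains L where "linear L" "\<And>x. L x \<le> p x" "1 \<le> L e" "normal_along C x L"
proof -
  have "\<exists>m::nat. \<forall>c\<in>C \<inter> R. norm (c - x) < 2 / (real m + 1) \<longrightarrow> z (c - x) \<le> norm (c - x) / (real n + 1)" for n :: nat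
  proof -
    have "1 / (real n + 1) > 0" by simp
    then obtain \<delta> where \<delta>: "\<delta> > 0" "\<forall>c\<in>C \<inter> R. norm (c - x) < \<delta> \<longrightarrow> z (c - x) \<le> 1 / (real n + 1) * norm (c - x)"
      using z(4) unfolding normal_along_def by blast
    obtain m :: nat where m: "2 / \<delta> < real m" using reals_Archimedean2 by blast
    then have "2 < real m * \<delta>" using \<delta>(1) by (simp add: field_simps)
    then have "2 / (real m + 1) < \<delta>" using \<delta>(1) by (simp add: field_simps)
    then show ?thesis using \<delta>(2) by (intro exI[of _ m]) auto
  qed
  then obtain M :: "nat \<Rightarrow> nat" where
    M: "\<And>n c. c \<in> C \<Longrightarrow> c \<in> R \<Longrightarrow> norm (c - x) < 2 / (real (M n) + 1) \<Longrightarrow> z (c - x) \<le> norm (c - x) / (real n + 1)"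
    by (metis IntI)
  define adm where "adm = (\<lambda>xs :: 'z system. \<forall>(l, n, m, c)\<in>set xs. 0 \<le> l \<and> c \<in> C \<and> m = M n \<and> norm (c - x) < 1 / (2 * (real m + 1)))"
  have viol0: "0 \<le> viol p e x t xs" if xs: "adm xs" "0 \<le> t" for xs t
  proof (rule ccontr)
    assume neg: "\<not> 0 \<le> viol p e x t xs"
    have m0: "0 \<le> mass xs" unfolding mass_def using xs(1) by (intro sum_list_nonneg) (auto simp: adm_def)
    define s where "s = 1 / (1 + mass xs)"
    have s: "s > 0" using m0 by (simp add: s_def add_pos_nonneg)
    define ys where "ys = rescale s xs"
    have ys: "adm ys" using xs(1) s by (auto simp: adm_def ys_def rescale_def)
    have mys: "mass ys \<le> 1" using m0 by (simp add: ys_def system_rescale s_def field_simps)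
    have "viol p e x (s * t) ys = s * viol p e x t xs"
      using sublinear_scale[OF p(1), of s "t *\<^sub>R e - dirsum x xs"] s
      by (simp add: viol_def ys_def system_rescale algebra_simps)
    then have vneg: "viol p e x (s * t) ys < 0" using neg s by (simp add: mult_pos_neg)
    define V where "V = - viol p e x (s * t) ys"
    have V: "V > 0" using vneg by (simp add: V_def)
    obtain \<gamma> :: nat where "2 / V < real \<gamma>" using reals_Archimedean2 by blast
    then have "2 < real \<gamma> * V" using V by (simp add: field_simps)
    then have \<gamma>: "2 / (real \<gamma> + 1) < V" using V by (simp add: field_simps)
    \<comment> \<open>Half of the violation pays for the move to \<open>x'\<close>, and the remaining margin pays for the move back.\<close>
    define \<gamma>' where "\<gamma>' = 1 / (real \<gamma> + 1)"
    have \<gamma>': "\<gamma>' > 0" "2 * \<gamma>' < V" using \<gamma> by (simp_all add: \<gamma>'_def)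
    define d where "d = Min (insert (\<gamma>' / (1 + K)) ((\<lambda>(n, m). 1 / (2 * (real m + 1))) ` set (pattern ys)))"
    have "d > 0" unfolding d_def using \<gamma>' p(3) by (auto simp: Min_gr_iff)
    then obtain x' where x': "x' \<in> R" "dist x' x < d" using x unfolding closure_approachable by blast
    have nx: "norm (x - x') < \<gamma>' / (1 + K)"
      using x'(2) by (auto simp: d_def dist_norm norm_minus_commute)
    have nx2: "norm (x - x') < 1 / (2 * (real m + 1))" if "(n, m) \<in> set (pattern ys)" for n m
      using x'(2) that by (auto simp: d_def dist_norm norm_minus_commute)
    have sh: "(1 + K) * norm (x - x') < \<gamma>'" using nx p(3) by (simp add: field_simps)
    have pat: "(n, m) \<in> set (pattern ys)" if "(l, n, m, c) \<in> set ys" for l n m c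
      using that by (force simp: pattern_def)
    have half: "1 / (2 * (real m + 1)) + 1 / (2 * (real m + 1)) = 1 / (real m + 1)" for m :: nat
      by (simp add: field_simps)
    have "admissible C x' ys" unfolding admissible_def
    proof (clarify)
      fix l n m c assume a: "(l, n, m, c) \<in> set ys"
      have "norm (c - x') \<le> norm (c - x) + norm (x - x')"
        using norm_triangle_ineq[of "c - x" "x - x'"] by simp
      also have "\<dots> < 1 / (real m + 1)" using ys a nx2[OF pat[OF a]] half[of m] by (auto simp: adm_def)
      finally show "0 \<le> l \<and> c \<in> C \<and> norm (c - x') < 1 / (real m + 1)" using ys a by (auto simp: adm_def)
    qed
    moreover have "viol p e x' (s * t) ys < - (1 / (real \<gamma> + 1))"
    proof -
      have "viol p e x' (s * t) ys \<le> viol p e x (s * t) ys + (1 + K) * norm (x - x')"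
        by (rule viol_shift[OF p(1,2) _ mys p(3)]) (use ys in \<open>auto simp: adm_def\<close>)
      then show ?thesis using sh \<gamma>' by (simp add: V_def \<gamma>'_def)
    qed
    ultimately have "infeasible p C x' e (pattern ys) \<gamma> ys"
      using mys s xs(2) unfolding infeasible_def by (intro conjI refl exI[of _ "s * t"]) auto
    then obtain zs where zs: "infeasible p C x' e (pattern ys) \<gamma> zs" "points zs \<subseteq> R"
      using rich x'(1) e unfolding rich_def by blast
    from zs(1) obtain t' where zs': "pattern zs = pattern ys" "admissible C x' zs" "mass zs \<le> 1" "0 \<le> t'"
      "viol p e x' t' zs < - \<gamma>'"
      unfolding infeasible_def \<gamma>'_def by blast
    have "viol p e x t' zs \<le> viol p e x' t' zs + (1 + K) * norm (x' - x)"
      by (rule viol_shift[OF p(1,2) _ zs'(3) p(3)]) (use zs'(2) in \<open>auto simp: admissible_def\<close>)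
    then have "viol p e x t' zs < 0" using zs'(5) sh by (simp add: norm_minus_commute)
    moreover have "0 \<le> viol p e x t' zs"
    proof (rule viol_nonneg[OF z(1,2,3) zs'(4)], clarify)
      fix l n m c assume a: "(l, n, m, c) \<in> set zs"
      then have pz: "(n, m) \<in> set (pattern ys)" unfolding zs'(1)[symmetric] by (force simp: pattern_def)
      then have mM: "m = M n" using ys by (force simp: pattern_def adm_def)
      have "c \<in> C" "c \<in> R" "0 \<le> l" "norm (c - x') < 1 / (real m + 1)"
        using zs'(2) zs(2) a by (force simp: admissible_def points_def)+
      moreover have "norm (c - x) \<le> norm (c - x') + norm (x - x')"
        using norm_triangle_ineq[of "c - x'" "x' - x"] by (simp add: norm_minus_commute)
      moreover have "1 / (real m + 1) + 1 / (2 * (real m + 1)) < 2 / (real m + 1)"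
      proof -
        have "1 / (2 * (real m + 1)) < 1 / (real m + 1)" by (intro divide_strict_left_mono) auto
        moreover have "2 / (real m + 1) = 1 / (real m + 1) + 1 / (real m + 1)" by (simp add: add_divide_distrib[symmetric])
        ultimately show ?thesis by simp
      qed
      ultimately show "0 \<le> l \<and> z (c - x) \<le> norm (c - x) / (real n + 1)"
        using M[of c n] nx2[OF pz] mM by auto
    qed
    ultimately show False by simp
  qed
  define Q where "Q = {(dirsum x xs - t *\<^sub>R e, err x xs - t) | xs t. adm xs \<and> 0 \<le> t}"
  have "(0, 0) \<in> Q" unfolding Q_def
    by (rule CollectI, rule exI[of _ "[]"], rule exI[of _ 0]) (simp add: system_defs adm_def)
  moreover have "g + h \<in> Q" if gh: "g \<in> Q" "h \<in> Q" for g h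
  proof -
    obtain xs t ys t' where a: "g = (dirsum x xs - t *\<^sub>R e, err x xs - t)" "adm xs" "0 \<le> t"
      "h = (dirsum x ys - t' *\<^sub>R e, err x ys - t')" "adm ys" "0 \<le> t'" using gh unfolding Q_def by blast
    show ?thesis unfolding Q_def
      by (rule CollectI, rule exI[of _ "xs @ ys"], rule exI[of _ "t + t'"])
        (use a in \<open>auto simp: system_append adm_def algebra_simps\<close>)
  qed
  moreover have "s *\<^sub>R g \<in> Q" if sg: "s > 0" "g \<in> Q" for s g
  proof -
    obtain xs t where a: "g = (dirsum x xs - t *\<^sub>R e, err x xs - t)" "adm xs" "0 \<le> t"
      using sg(2) unfolding Q_def by blast
    have "adm (rescale s xs)" using a(2) sg(1) by (auto simp: adm_def rescale_def)
    then show ?thesis unfolding Q_def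
      by (intro CollectI exI[of _ "rescale s xs"] exI[of _ "s * t"])
        (use a sg(1) in \<open>auto simp: system_rescale algebra_simps\<close>)
  qed
  moreover have "0 \<le> r + p (- g)" if "(g, r) \<in> Q" for g r
    using that viol0 unfolding Q_def viol_def by auto
  ultimately obtain L where L: "linear L" "\<And>x. L x \<le> p x" "\<And>g r. (g, r) \<in> Q \<Longrightarrow> L g \<le> r"
    using Hahn_Banach_consistency[OF p(1), of Q] by blast
  show ?thesis
  proof (rule that[OF L(1,2)])
    have "(- e, - 1) \<in> Q" unfolding Q_def
      by (rule CollectI, rule exI[of _ "[]"], rule exI[of _ 1]) (simp add: system_defs adm_def)
    then show "1 \<le> L e" using L(3) linear_neg[OF L(1), of e] by force
    show "normal_along C x L" unfolding normal_along_def
    proof (intro allI impI)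
      fix \<eta> :: real assume "\<eta> > 0"
      then obtain n :: nat where "1 / (real n + 1) < \<eta>"
        using reals_Archimedean[of \<eta>] by (auto simp: inverse_eq_divide add.commute)
      have "L (c - x) \<le> \<eta> * norm (c - x)" if c: "c \<in> C" "norm (c - x) < 1 / (2 * (real (M n) + 1))" for c
      proof -
        have "(c - x, norm (c - x) / (real n + 1)) \<in> Q" unfolding Q_def
          by (rule CollectI, rule exI[of _ "[(1, n, M n, c)]"], rule exI[of _ 0])
            (use c in \<open>simp add: system_defs adm_def\<close>)
        then have "L (c - x) \<le> 1 / (real n + 1) * norm (c - x)" using L(3) by force
        also have "\<dots> \<le> \<eta> * norm (c - x)"
          using \<open>1 / (real n + 1) < \<eta>\<close> by (intro mult_right_mono) auto
        finally show ?thesis .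
      qed
      then show "\<exists>\<delta>>0. \<forall>z\<in>C. norm (z - x) < \<delta> \<longrightarrow> L (z - x) \<le> \<eta> * norm (z - x)"
        by (intro exI[of _ "1 / (2 * (real (M n) + 1))"]) simp
    qed
  qed
qed

text \<open>Countably many stages suffice, because every finite list over their union lies in one of them.\<close>

lemma countable_closed_superset:
  fixes F :: "'a list \<Rightarrow> 'a set"
  assumes D0: "countable D0" and F: "\<And>xs. countable (F xs)"
  obtains D where "countable D" "D0 \<subseteq> D" "\<And>xs. set xs \<subseteq> D \<Longrightarrow> F xs \<subseteq> D"
proof -
  define E where "E = rec_nat D0 (\<lambda>_ D. D \<union> (\<Union>xs\<in>lists D. F xs))"
  have E: "E 0 = D0" "E (Suc n) = E n \<union> (\<Union>xs\<in>lists (E n). F xs)" for n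
    by (simp_all add: E_def)
  have cnt: "countable (E n)" for n
    by (induction n) (auto simp: E D0 F intro!: countable_UN countable_lists)
  have mono: "E m \<subseteq> E n" if "m \<le> n" for m n
    using that by (induction rule: dec_induct) (auto simp: E)
  have "\<exists>n. set xs \<subseteq> E n" if "set xs \<subseteq> (\<Union>n. E n)" for xs
    using that
  proof (induction xs)
    case (Cons a xs)
    then obtain m n where "set xs \<subseteq> E m" "a \<in> E n" by auto
    then have "set (a # xs) \<subseteq> E (max m n)" using mono[of m "max m n"] mono[of n "max m n"] by auto
    then show ?case by blast
  qed simp
  then have "F xs \<subseteq> (\<Union>n. E n)" if "set xs \<subseteq> (\<Union>n. E n)" for xs
  proof -
    obtain n where "set xs \<subseteq> E n" using \<open>\<And>xs. set xs \<subseteq> (\<Union>n. E n) \<Longrightarrow> \<exists>n. set xs \<subseteq> E n\<close> \<open>set xs \<subseteq> (\<Union>n. E n)\<close> by blast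
    then have "F xs \<subseteq> E (Suc n)" by (auto simp: E)
    then show ?thesis by blast
  qed
  then show ?thesis using that[of "\<Union>n. E n"] cnt E(1) by blast
qed

lemma subspace_closure_rational:
  fixes D :: "'a::real_normed_vector set"
  assumes "0 \<in> D" and add: "\<And>x y. x \<in> D \<Longrightarrow> y \<in> D \<Longrightarrow> x + y \<in> D"
    and scale: "\<And>q x. x \<in> D \<Longrightarrow> of_rat q *\<^sub>R x \<in> D"
  shows "subspace (closure D)"
proof (rule subspaceI)
  show "0 \<in> closure D" using assms(1) closure_subset by blast
  show "x + y \<in> closure D" if xy: "x \<in> closure D" "y \<in> closure D" for x y
  proof -
    obtain f g where "\<And>n::nat. f n \<in> D" "f \<longlonglongrightarrow> x" "\<And>n::nat. g n \<in> D" "g \<longlonglongrightarrow> y"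
      using xy unfolding closure_sequential by blast
    then have "\<forall>n. f n + g n \<in> D" "(\<lambda>n. f n + g n) \<longlonglongrightarrow> x + y" by (auto intro: add tendsto_add)
    then show ?thesis unfolding closure_sequential by (intro exI[of _ "\<lambda>n. f n + g n"]) simp
  qed
  show "c *\<^sub>R x \<in> closure D" if x: "x \<in> closure D" for c x
  proof -
    obtain f where f: "\<And>n::nat. f n \<in> D" "f \<longlonglongrightarrow> x" using x unfolding closure_sequential by blast
    have "\<exists>q::rat. c < of_rat q \<and> of_rat q < c + inverse (real (Suc n))" for n
      using of_rat_dense[of c "c + inverse (real (Suc n))"] by simp
    then have "\<forall>n. \<exists>q::rat. c < of_rat q \<and> of_rat q < c + inverse (real (Suc n))" by (rule allI)
    from choice[OF this] obtain q :: "nat \<Rightarrow> rat" where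
      "\<forall>n. c < of_rat (q n) \<and> of_rat (q n) < c + inverse (real (Suc n))" by (rule exE)
    then have q: "\<And>n. c < of_rat (q n)" "\<And>n. of_rat (q n) < c + inverse (real (Suc n))" by simp_all
    have "(\<lambda>n. c + inverse (real (Suc n))) \<longlonglongrightarrow> c + 0"
      by (intro tendsto_intros LIMSEQ_inverse_real_of_nat)
    then have lim: "(\<lambda>n. c + inverse (real (Suc n))) \<longlonglongrightarrow> c" by simp
    have "(\<lambda>n. of_rat (q n) :: real) \<longlonglongrightarrow> c"
      by (rule tendsto_sandwich[OF _ _ tendsto_const[of c] lim])
        (intro always_eventually allI less_imp_le q)+
    then have "(\<lambda>n. of_rat (q n) *\<^sub>R f n) \<longlonglongrightarrow> c *\<^sub>R x" by (intro tendsto_scaleR f)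
    moreover have "\<forall>n. of_rat (q n) *\<^sub>R f n \<in> D" using scale f(1) by blast
    ultimately show ?thesis unfolding closure_sequential
      by (intro exI[of _ "\<lambda>n. of_rat (q n) *\<^sub>R f n"]) simp
  qed
qed

text \<open>The witness operation reads a list of three points: the two coordinates of the base point and the direction. Addition and
rational scaling use the first two entries. In shorter lists the missing entries have unspecified values, which only adds
points.\<close>

lemma countable_rich_set:
  fixes p :: "'a::real_normed_vector \<times> 'a \<Rightarrow> real" and D0 :: "'a set"
  assumes "countable D0"
  obtains D where "countable D" "D0 \<subseteq> D" "subspace (closure D)" "rich p C (D \<times> D) (D \<times> {0})"
proof -
  define W where "W = (\<lambda>x e ds \<gamma>. SOME xs. infeasible p C x e ds \<gamma> xs)"
  define F where "F = (\<lambda>xs::'a list. {xs ! 0 + xs ! 1} \<union> range (\<lambda>q::rat. of_rat q *\<^sub>R (xs ! 0)) \<union>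
    (\<Union>ds. \<Union>\<gamma>. fst ` points (W (xs ! 0, xs ! 1) (xs ! 2, 0) ds \<gamma>) \<union> snd ` points (W (xs ! 0, xs ! 1) (xs ! 2, 0) ds \<gamma>)))"
  have fp: "countable (points xs)" for xs :: "('a \<times> 'a) system" by (simp add: points_def countable_finite)
  have cF: "countable (F xs)" for xs unfolding F_def
    by (intro countable_Un countable_UN countable_image fp) auto
  obtain D where D: "countable D" "insert 0 D0 \<subseteq> D" "\<And>xs. set xs \<subseteq> D \<Longrightarrow> F xs \<subseteq> D"
    using countable_closed_superset[of "insert 0 D0" F] assms cF by auto
  show ?thesis
  proof (rule that[OF D(1)])
    show "D0 \<subseteq> D" using D(2) by blast
    show "subspace (closure D)"
    proof (rule subspace_closure_rational)
      show "0 \<in> D" using D(2) by blast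
      show "x + y \<in> D" if "x \<in> D" "y \<in> D" for x y
        using D(3)[of "[x, y]"] that by (simp add: F_def)
      show "of_rat q *\<^sub>R x \<in> D" if "x \<in> D" for q x
      proof -
        have "range (\<lambda>q::rat. of_rat q *\<^sub>R x) \<subseteq> D" using D(3)[of "[x]"] that by (simp add: F_def)
        then show ?thesis by blast
      qed
    qed
    show "rich p C (D \<times> D) (D \<times> {0})" unfolding rich_def
    proof (intro ballI allI impI)
      fix x e ds \<gamma>
      assume x: "x \<in> D \<times> D" and e: "e \<in> D \<times> {0::'a}" and ex: "\<exists>xs. infeasible p C x e ds \<gamma> xs"
      obtain x1 x2 e1 where eq: "x = (x1, x2)" "e = (e1, 0)" "x1 \<in> D" "x2 \<in> D" "e1 \<in> D" using x e by auto
      have inf: "infeasible p C x e ds \<gamma> (W x e ds \<gamma>)" unfolding W_def using ex by (rule someI_ex)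
      have FD: "F [x1, x2, e1] \<subseteq> D" using D(3)[of "[x1, x2, e1]"] eq by simp
      have ix: "[x1, x2, e1] ! 0 = x1" "[x1, x2, e1] ! 1 = x2" "[x1, x2, e1] ! 2 = e1" by simp_all
      have "fst ` points (W x e ds \<gamma>) \<union> snd ` points (W x e ds \<gamma>) \<subseteq> F [x1, x2, e1]"
        unfolding F_def ix eq(1,2) by (rule subset_trans[OF _ Un_upper2]) blast
      then have "fst ` points (W x e ds \<gamma>) \<subseteq> D" "snd ` points (W x e ds \<gamma>) \<subseteq> D"
        using FD by blast+
      then have "points (W x e ds \<gamma>) \<subseteq> D \<times> D" by force
      then show "\<exists>xs. infeasible p C x e ds \<gamma> xs \<and> points xs \<subseteq> D \<times> D" using inf by blast
    qed
  qed
qed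

section \<open>The extremal principle\<close>

lemma frechet_normal_cone_normal_along:
  assumes "a \<in> A"
  shows "x' \<in> frechet_normal_cone A a \<longleftrightarrow> normal_along A a (blinfun_apply x')"
  unfolding frechet_normal_cone_iff[OF assms] normal_along_def
  by (simp add: Ball_def mem_ball dist_norm norm_minus_commute imp_conjL)

lemma frechet_normal_cone_scale:
  assumes a: "a \<in> A" and x': "x' \<in> frechet_normal_cone A a" and c: "0 \<le> c"
  shows "c *\<^sub>R x' \<in> frechet_normal_cone A a"
  unfolding frechet_normal_cone_normal_along[OF a] normal_along_def
proof (intro allI impI)
  fix \<eta> :: real assume \<eta>: "\<eta> > 0"
  then have "\<eta> / (c + 1) > 0" using c by simp
  then obtain \<delta> where \<delta>: "\<delta> > 0"
    "\<forall>z\<in>A. norm (z - a) < \<delta> \<longrightarrow> blinfun_apply x' (z - a) \<le> \<eta> / (c + 1) * norm (z - a)"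
    using x' unfolding frechet_normal_cone_normal_along[OF a] normal_along_def by blast
  have "blinfun_apply (c *\<^sub>R x') (z - a) \<le> \<eta> * norm (z - a)" if z: "z \<in> A" "norm (z - a) < \<delta>" for z
  proof -
    have "c * blinfun_apply x' (z - a) \<le> c * (\<eta> / (c + 1) * norm (z - a))"
      using \<delta>(2) z c by (intro mult_left_mono) auto
    also have "\<dots> = c * (\<eta> / (c + 1)) * norm (z - a)" by simp
    also have "\<dots> \<le> \<eta> * norm (z - a)"
      using c \<eta> by (intro mult_right_mono) (auto simp: field_simps)
    finally show ?thesis by (simp add: blinfun.scaleR_left)
  qed
  then show "\<exists>\<delta>>0. \<forall>z\<in>A. norm (z - a) < \<delta> \<longrightarrow> blinfun_apply (c *\<^sub>R x') (z - a) \<le> \<eta> * norm (z - a)"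
    using \<delta>(1) by blast
qed

lemma frechet_normal_cone_nonempty:
  assumes "a \<in> A" shows "frechet_normal_cone A a \<noteq> {}"
proof -
  have "0 \<in> frechet_normal_cone A a"
    unfolding frechet_normal_cone_normal_along[OF assms] normal_along_def by (auto intro: exI[of _ 1])
  then show ?thesis by blast
qed

lemma infdist_lessE:
  assumes "infdist x S < \<epsilon>" "S \<noteq> {}"
  obtains y where "y \<in> S" "dist x y < \<epsilon>"
proof -
  have "(INF y\<in>S. dist x y) < \<epsilon>" using assms by (simp add: infdist_notempty)
  then obtain y where "y \<in> S" "dist x y < \<epsilon>"
    using cINF_less_iff[of S "\<lambda>y. dist x y"] assms(2) by (auto intro: bdd_belowI2[of _ 0])
  then show ?thesis by (rule that)
qed

abbreviation unit_normal_condition :: "'a::real_normed_vector set \<Rightarrow> 'a set \<Rightarrow> 'a \<Rightarrow> 'a \<Rightarrow> bool" where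
  "unit_normal_condition A B a b \<equiv>
    (\<forall>\<epsilon>>0. \<exists>a' \<in> A \<inter> ball a \<epsilon>. \<exists>b' \<in> B \<inter> ball b \<epsilon>. \<exists>x' :: 'a \<Rightarrow>\<^sub>L real.
        norm x' = 1 \<and>
        infdist x' (frechet_normal_cone A a') < \<epsilon> \<and>
        infdist (- x') (frechet_normal_cone B b') < \<epsilon>)"

abbreviation normal_pair_condition :: "'a::real_normed_vector set \<Rightarrow> 'a set \<Rightarrow> 'a \<Rightarrow> 'a \<Rightarrow> bool" where
  "normal_pair_condition A B a b \<equiv>
    (\<forall>\<epsilon>>0. \<exists>a' \<in> A \<inter> ball a \<epsilon>. \<exists>b' \<in> B \<inter> ball b \<epsilon>.
        \<exists>x' \<in> frechet_normal_cone A a'. \<exists>y' \<in> frechet_normal_cone B b'.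
        norm x' + norm y' = 1 \<and> norm (x' + y') < \<epsilon>)"

lemma normal_pair_normalise:
  assumes a: "a \<in> A" and b: "b \<in> B"
    and x: "x' \<in> frechet_normal_cone A a" and y: "y' \<in> frechet_normal_cone B b"
    and s: "0 < norm x' + norm y'" and le: "norm (x' + y') < \<epsilon> * (norm x' + norm y')"
  shows "\<exists>x' \<in> frechet_normal_cone A a. \<exists>y' \<in> frechet_normal_cone B b.
    norm x' + norm y' = 1 \<and> norm (x' + y') < \<epsilon>"
proof (intro bexI conjI)
  let ?s = "norm x' + norm y'"
  show "inverse ?s *\<^sub>R x' \<in> frechet_normal_cone A a" "inverse ?s *\<^sub>R y' \<in> frechet_normal_cone B b"
    using s by (intro frechet_normal_cone_scale a b x y; simp)+
  have "norm (inverse ?s *\<^sub>R x') + norm (inverse ?s *\<^sub>R y') = inverse ?s * ?s"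
    using s by (simp add: distrib_left)
  then show "norm (inverse ?s *\<^sub>R x') + norm (inverse ?s *\<^sub>R y') = 1" using s by simp
  have "norm (inverse ?s *\<^sub>R x' + inverse ?s *\<^sub>R y') = inverse ?s * norm (x' + y')"
    using s by (simp add: scaleR_add_right[symmetric])
  also have "\<dots> < \<epsilon>" using le s by (simp add: field_simps)
  finally show "norm (inverse ?s *\<^sub>R x' + inverse ?s *\<^sub>R y') < \<epsilon>" .
qed

text \<open>From left to right, normals close to \<open>x'\<close> and \<open>- x'\<close> are scaled. From right to left, \<open>x'\<close> is scaled to norm \<open>1\<close>;
its norm is more than \<open>1 / 4\<close>, because the two norms add up to \<open>1\<close> and differ by less than \<open>1 / 4\<close>.\<close>

lemma unit_normal_condition_iff_normal_pair_condition:
  "unit_normal_condition A B a b \<longleftrightarrow> normal_pair_condition A B a b"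
proof
  assume i: "unit_normal_condition A B a b"
  show "normal_pair_condition A B a b"
  proof (intro allI impI)
    fix \<epsilon> :: real assume \<epsilon>: "\<epsilon> > 0"
    define e where "e = min (\<epsilon> / 4) (1 / 4)"
    have e: "e > 0" "e \<le> \<epsilon> / 4" "e \<le> 1 / 4" using \<epsilon> by (auto simp: e_def)
    obtain a' b' x' where ab: "a' \<in> A \<inter> ball a e" "b' \<in> B \<inter> ball b e" and x': "norm x' = 1"
      "infdist x' (frechet_normal_cone A a') < e" "infdist (- x') (frechet_normal_cone B b') < e"
      using i e(1) by blast
    have a'A: "a' \<in> A" and b'B: "b' \<in> B" using ab by auto
    obtain n m where n: "n \<in> frechet_normal_cone A a'" "dist x' n < e"
      and m: "m \<in> frechet_normal_cone B b'" "dist (- x') m < e"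
      using infdist_lessE[OF x'(2) frechet_normal_cone_nonempty[OF a'A]]
        infdist_lessE[OF x'(3) frechet_normal_cone_nonempty[OF b'B]] by metis
    have "norm x' \<le> norm n + norm (x' - n)" "norm (- x') \<le> norm m + norm (- x' - m)"
      using norm_triangle_ineq[of n "x' - n"] norm_triangle_ineq[of m "- x' - m"] by simp_all
    then have s: "1 \<le> norm n + norm m" using x'(1) n(2) m(2) e by (simp add: dist_norm)
    have "n + m = - (x' - n) - (- x' - m)" by simp
    then have "norm (n + m) \<le> norm (x' - n) + norm (- x' - m)"
      by (metis norm_triangle_ineq4 norm_minus_cancel)
    then have "norm (n + m) < \<epsilon> * 1" using n(2) m(2) e \<epsilon> by (simp add: dist_norm)
    also have "\<epsilon> * 1 \<le> \<epsilon> * (norm n + norm m)" using s \<epsilon> by (intro mult_left_mono) auto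
    finally have "\<exists>x' \<in> frechet_normal_cone A a'. \<exists>y' \<in> frechet_normal_cone B b'.
        norm x' + norm y' = 1 \<and> norm (x' + y') < \<epsilon>"
      using s by (intro normal_pair_normalise[OF a'A b'B n(1) m(1)]) auto
    moreover have "a' \<in> A \<inter> ball a \<epsilon>" "b' \<in> B \<inter> ball b \<epsilon>" using ab e \<epsilon> by auto
    ultimately show "\<exists>a' \<in> A \<inter> ball a \<epsilon>. \<exists>b' \<in> B \<inter> ball b \<epsilon>.
        \<exists>x' \<in> frechet_normal_cone A a'. \<exists>y' \<in> frechet_normal_cone B b'.
        norm x' + norm y' = 1 \<and> norm (x' + y') < \<epsilon>" by blast
  qed
next
  assume ii: "normal_pair_condition A B a b"
  show "unit_normal_condition A B a b"
  proof (intro allI impI)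
    fix \<epsilon> :: real assume \<epsilon>: "\<epsilon> > 0"
    define e where "e = min (\<epsilon> / 4) (1 / 4)"
    have e: "e > 0" "e \<le> \<epsilon> / 4" "e \<le> 1 / 4" using \<epsilon> by (auto simp: e_def)
    obtain a' b' x' y' where ab: "a' \<in> A \<inter> ball a e" "b' \<in> B \<inter> ball b e"
      and n: "x' \<in> frechet_normal_cone A a'" "y' \<in> frechet_normal_cone B b'"
      and s: "norm x' + norm y' = 1" "norm (x' + y') < e"
      using ii e(1) by blast
    have a'A: "a' \<in> A" and b'B: "b' \<in> B" using ab by auto
    have "norm y' \<le> norm (x' + y') + norm x'" using norm_triangle_ineq4[of "x' + y'" x'] by simp
    then have x14: "norm x' > 1 / 4" using s e by simp
    define z where "z = inverse (norm x') *\<^sub>R x'"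
    have "z \<in> frechet_normal_cone A a'" unfolding z_def by (intro frechet_normal_cone_scale a'A n) simp
    then have "infdist z (frechet_normal_cone A a') < \<epsilon>" using \<epsilon> by simp
    moreover have "infdist (- z) (frechet_normal_cone B b') < \<epsilon>"
    proof -
      have "inverse (norm x') *\<^sub>R y' \<in> frechet_normal_cone B b'" by (intro frechet_normal_cone_scale b'B n) simp
      then have "infdist (- z) (frechet_normal_cone B b') \<le> dist (- z) (inverse (norm x') *\<^sub>R y')"
        by (rule infdist_le)
      also have "\<dots> = norm (inverse (norm x') *\<^sub>R (x' + y'))"
        by (simp add: dist_norm z_def scaleR_add_right norm_minus_commute[of "- _"] add.commute)
      also have "\<dots> = norm (x' + y') / norm x'" by (simp add: divide_inverse mult.commute)
      also have "\<dots> < \<epsilon>"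
      proof -
        have "norm (x' + y') < \<epsilon> * (1 / 4)" using s e by simp
        also have "\<dots> \<le> \<epsilon> * norm x'" using x14 \<epsilon> by (intro mult_left_mono) auto
        finally show ?thesis using x14 \<epsilon> by (simp add: divide_less_eq)
      qed
      finally show ?thesis .
    qed
    moreover have "norm z = 1"
    proof -
      have "norm x' \<noteq> 0" using x14 by linarith
      then show ?thesis by (simp add: z_def)
    qed
    moreover have "a' \<in> A \<inter> ball a \<epsilon>" "b' \<in> B \<inter> ball b \<epsilon>" using ab e \<epsilon> by auto
    ultimately show "\<exists>a' \<in> A \<inter> ball a \<epsilon>. \<exists>b' \<in> B \<inter> ball b \<epsilon>. \<exists>x' :: 'a \<Rightarrow>\<^sub>L real. norm x' = 1 \<and>
        infdist x' (frechet_normal_cone A a') < \<epsilon> \<and> infdist (- x') (frechet_normal_cone B b') < \<epsilon>" by blast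
  qed
qed

lemma blinfun_almost_norming:
  fixes x' :: "'a::real_normed_vector \<Rightarrow>\<^sub>L real"
  assumes "0 \<le> c" "c < norm x'"
  obtains u where "norm u \<le> 1" "c < blinfun_apply x' u"
proof -
  have "\<exists>h. c * norm h < norm (blinfun_apply x' h)"
  proof (rule ccontr)
    assume "\<not> ?thesis"
    then have "\<And>h. norm (blinfun_apply x' h) \<le> c * norm h" by (simp add: not_less)
    then have "norm x' \<le> c" by (intro norm_blinfun_bound assms(1))
    then show False using assms(2) by simp
  qed
  then obtain h where h: "c * norm h < \<bar>blinfun_apply x' h\<bar>" by auto
  then have "h \<noteq> 0" by auto
  define u where "u = (sgn (blinfun_apply x' h) / norm h) *\<^sub>R h"
  have "norm u \<le> 1" using \<open>h \<noteq> 0\<close> by (simp add: u_def sgn_if)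
  moreover have eq: "blinfun_apply x' u = \<bar>blinfun_apply x' h\<bar> / norm h"
    by (simp add: u_def blinfun.scaleR_right sgn_if)
  have "c < blinfun_apply x' u" unfolding eq using h \<open>h \<noteq> 0\<close> by (simp add: pos_less_divide_eq)
  ultimately show ?thesis by (rule that)
qed

text \<open>Only \<open>A\<close> has to be translated. The vector \<open>u\<close> of length about \<open>\<epsilon> \<rho> / 2\<close> satisfies \<open>x' u > \<epsilon> \<rho> / 8\<close>,
whereas a common point of the translated sets would force \<open>x' u\<close> to be at most \<open>\<epsilon> \<rho> / 16\<close>, because of the two normal
inequalities and the smallness of \<open>x' + y'\<close>.\<close>

lemma approximately_stationary_if_normal_pairs:
  assumes ii: "normal_pair_condition A B a b"
  shows "approximately_stationary A B a b"
  unfolding approximately_stationary_def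
proof (intro allI impI)
  fix \<epsilon> :: real assume \<epsilon>: "\<epsilon> > 0"
  define e where "e = min (\<epsilon> / 32) (1 / 32)"
  have e: "e > 0" "e \<le> \<epsilon> / 32" "e \<le> 1 / 32" using \<epsilon> by (auto simp: e_def)
  obtain a' b' x' y' where ab: "a' \<in> A \<inter> ball a e" "b' \<in> B \<inter> ball b e"
    and n: "x' \<in> frechet_normal_cone A a'" "y' \<in> frechet_normal_cone B b'"
    and s: "norm x' + norm y' = 1" "norm (x' + y') < e"
    using ii e(1) by blast
  have a'A: "a' \<in> A" and b'B: "b' \<in> B" using ab by auto
  have "norm y' \<le> norm (x' + y') + norm x'" using norm_triangle_ineq4[of "x' + y'" x'] by simp
  then have "1 / 4 < norm x'" using s e by simp
  then obtain w where w: "norm w \<le> 1" "1 / 4 < blinfun_apply x' w"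
    using blinfun_almost_norming[of "1/4" x'] by auto
  define \<eta> where "\<eta> = \<epsilon> / (64 * (1 + \<epsilon>))"
  have \<eta>: "\<eta> > 0" using \<epsilon> by (simp add: \<eta>_def add_pos_pos)
  obtain d1 d2 where d1: "d1 > 0" "\<forall>z\<in>A. norm (z - a') < d1 \<longrightarrow> blinfun_apply x' (z - a') \<le> \<eta> * norm (z - a')"
    and d2: "d2 > 0" "\<forall>z\<in>B. norm (z - b') < d2 \<longrightarrow> blinfun_apply y' (z - b') \<le> \<eta> * norm (z - b')"
    using n \<eta> unfolding frechet_normal_cone_normal_along[OF a'A] frechet_normal_cone_normal_along[OF b'B]
      normal_along_def by blast
  define \<rho> where "\<rho> = min \<epsilon> (min d1 d2) / (2 * (1 + \<epsilon>))"
  have \<rho>: "\<rho> > 0" using \<epsilon> d1 d2 by (simp add: \<rho>_def add_pos_pos)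
  have \<rho>2: "(1 + \<epsilon>) * \<rho> = min \<epsilon> (min d1 d2) / 2" using \<epsilon> by (simp add: \<rho>_def field_simps)
  then have \<rho>d: "(1 + \<epsilon>) * \<rho> < d1" "(1 + \<epsilon>) * \<rho> < d2" "(1 + \<epsilon>) * \<rho> < \<epsilon>" using \<epsilon> d1 d2 by auto
  have "\<rho> \<le> (1 + \<epsilon>) * \<rho>" using \<epsilon> \<rho> by simp
  then have \<rho>\<epsilon>: "\<rho> < \<epsilon>" using \<rho>d(3) by simp
  define u where "u = (\<epsilon> * \<rho> / 2) *\<^sub>R w"
  have er: "\<epsilon> * \<rho> > 0" using \<epsilon> \<rho> by simp
  have nu: "norm u \<le> \<epsilon> * \<rho> / 2" using w(1) er mult_left_mono[OF w(1), of "\<epsilon> * \<rho> / 2"] by (simp add: u_def)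
  have xu: "\<epsilon> * \<rho> / 8 < blinfun_apply x' u"
    using w(2) er mult_strict_left_mono[OF w(2), of "\<epsilon> * \<rho> / 2"] by (simp add: u_def blinfun.scaleR_right)
  have "(\<lambda>x. x - a' - u) ` A \<inter> (\<lambda>x. x - b' - 0) ` B \<inter> cball 0 \<rho> = {}"
  proof (rule ccontr)
    assume "\<not> ?thesis"
    then obtain z where zz: "z \<in> (\<lambda>x. x - a' - u) ` A" "z \<in> (\<lambda>x. x - b' - 0) ` B" "z \<in> cball 0 \<rho>" by blast
    obtain c1 where c1: "c1 \<in> A" "z = c1 - a' - u" using zz(1) by blast
    obtain c2 where c2: "c2 \<in> B" "z = c2 - b' - 0" using zz(2) by blast
    have z: "norm z \<le> \<rho>" "c1 \<in> A" "c2 \<in> B" "z = c1 - a' - u" "z = c2 - b'" using zz(3) c1 c2 by simp_all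
    have n1: "norm (c1 - a') \<le> (1 + \<epsilon>) * \<rho>"
    proof -
      have "c1 - a' = z + u" using z by simp
      then have "norm (c1 - a') \<le> norm z + norm u" by (metis norm_triangle_ineq)
      then show ?thesis using z(1) nu er by (simp add: algebra_simps)
    qed
    have n2: "norm (c2 - b') \<le> (1 + \<epsilon>) * \<rho>" using z(1,5) \<open>\<rho> \<le> (1 + \<epsilon>) * \<rho>\<close> by simp
    have \<eta>r: "\<eta> * ((1 + \<epsilon>) * \<rho>) = \<epsilon> * \<rho> / 64" using \<epsilon> by (simp add: \<eta>_def field_simps)
    have "blinfun_apply x' (c1 - a') \<le> \<eta> * norm (c1 - a')" using d1(2) z(2) n1 \<rho>d(1) by auto
    also have "\<dots> \<le> \<epsilon> * \<rho> / 64" using mult_left_mono[OF n1, of \<eta>] \<eta> \<eta>r by simp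
    finally have 1: "blinfun_apply x' z + blinfun_apply x' u \<le> \<epsilon> * \<rho> / 64"
      using z(4) by (simp add: blinfun.diff_right)
    have "blinfun_apply y' (c2 - b') \<le> \<eta> * norm (c2 - b')" using d2(2) z(3) n2 \<rho>d(2) by auto
    also have "\<dots> \<le> \<epsilon> * \<rho> / 64" using mult_left_mono[OF n2, of \<eta>] \<eta> \<eta>r by simp
    finally have 2: "blinfun_apply y' z \<le> \<epsilon> * \<rho> / 64" using z(5) by simp
    have "\<bar>blinfun_apply (x' + y') z\<bar> \<le> norm (x' + y') * norm z"
      using norm_blinfun[of "x' + y'" z] by simp
    also have "\<dots> \<le> (\<epsilon> / 32) * \<rho>" using s(2) e z(1) \<epsilon> by (intro mult_mono) auto
    finally have "\<bar>blinfun_apply x' z + blinfun_apply y' z\<bar> \<le> \<epsilon> * \<rho> / 32"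
      by (simp add: blinfun.add_left)
    then have 3: "- (\<epsilon> * \<rho> / 32) \<le> blinfun_apply x' z + blinfun_apply y' z" by linarith
    show False using 1 2 3 xu er by simp
  qed
  moreover have "max (norm u) (norm (0::'a)) < \<epsilon> * \<rho>" using nu er by simp
  moreover have "\<rho> \<in> {0<..<\<epsilon>}" using \<rho> \<rho>\<epsilon> by simp
  moreover have "a' \<in> A \<inter> ball a \<epsilon>" "b' \<in> B \<inter> ball b \<epsilon>" using ab e \<epsilon> by auto
  ultimately show "\<exists>\<rho>\<in>{0<..<\<epsilon>}. \<exists>a' \<in> A \<inter> ball a \<epsilon>. \<exists>b' \<in> B \<inter> ball b \<epsilon>. \<exists>u v.
        (\<lambda>x. x - a' - u) ` A \<inter> (\<lambda>x. x - b' - v) ` B \<inter> cball 0 \<rho> = {} \<and>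
        max (norm u) (norm v) < \<epsilon> * \<rho>" by blast
qed

lemma blinfun_of_linear:
  fixes f :: "'a::real_normed_vector \<Rightarrow> real"
  assumes "linear f" "\<And>x. f x \<le> K * norm x"
  obtains x' :: "'a \<Rightarrow>\<^sub>L real" where "blinfun_apply x' = f"
proof -
  have "norm (f x) \<le> norm x * K" for x
    using assms(2)[of x] assms(2)[of "- x"] linear_neg[OF assms(1), of x]
    by (simp add: abs_le_iff mult.commute)
  then have "bounded_linear f"
    using linear_add[OF assms(1)] linear_scale[OF assms(1)] by (intro bounded_linear_intro) auto
  then show ?thesis using that bounded_linear_Blinfun_apply by blast
qed

text \<open>The sublinear bound \<open>p\<close> on the product space encodes that the first functional has norm at most \<open>2\<close> and the sum of the two
has norm at most \<open>256 e\<close>. Both bounds are known before the separable subspace is chosen, which is essential: the subspace has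
to be rich for this \<open>p\<close>. The direction \<open>d\<close>, taken from the countable set, keeps the lifted functional away from zero.\<close>

lemma normal_pairs_if_approximately_stationary:
  fixes A B :: "'a::banach set"
  assumes asp: "asplund_space TYPE('a)" and cl: "closed A" "closed B"
    and st: "approximately_stationary A B a b"
  shows "normal_pair_condition A B a b"
proof (intro allI impI)
  fix \<epsilon> :: real assume \<epsilon>: "\<epsilon> > 0"
  \<comment> \<open>In the end the sum of the normals is at most \<open>256 e\<close> and their norms add up to at least \<open>1 / 9\<close>.\<close>
  define e where "e = min (1 / 512) (\<epsilon> / 4096)"
  have e: "0 < e" "e \<le> 1 / 512" "e \<le> \<epsilon> / 4096" using \<epsilon> by (auto simp: e_def)
  obtain r a0 b0 u v where r: "0 < r" "r < e" and a0: "a0 \<in> A" "dist a a0 < e" and b0: "b0 \<in> B" "dist b b0 < e"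
    and emp: "(\<lambda>x. x - a0 - u) ` A \<inter> (\<lambda>x. x - b0 - v) ` B \<inter> cball 0 r = {}"
    and uv: "max (norm u) (norm v) < e * r"
    using st[unfolded approximately_stationary_def, rule_format, OF e(1)] by auto
  define p where "p = (\<lambda>z::'a \<times> 'a. 2 * norm (fst z - snd z) + 256 * e * norm (snd z))"
  define K where "K = 4 + 256 * e"
  have psub: "sublinear p" unfolding sublinear_def
  proof (intro conjI allI impI)
    fix x y :: "'a \<times> 'a"
    have "norm (fst (x + y) - snd (x + y)) \<le> norm (fst x - snd x) + norm (fst y - snd y)"
      using norm_triangle_ineq[of "fst x - snd x" "fst y - snd y"] by (simp add: algebra_simps)
    moreover have "256 * e * norm (snd (x + y)) \<le> 256 * e * (norm (snd x) + norm (snd y))"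
      using e norm_triangle_ineq[of "snd x" "snd y"] by (intro mult_left_mono) auto
    ultimately show "p (x + y) \<le> p x + p y" unfolding p_def distrib_left by linarith
  next
    fix c :: real and x :: "'a \<times> 'a" assume "0 \<le> c"
    then show "p (c *\<^sub>R x) = c * p x"
      by (simp add: p_def scaleR_diff_right[symmetric] distrib_left mult.left_commute)
  qed
  have pK: "p z \<le> K * norm z" for z
  proof -
    have "norm (fst z) \<le> norm z" "norm (snd z) \<le> norm z"
      using norm_fst_le[of "fst z" "snd z"] norm_snd_le[of "snd z" "fst z"] by simp_all
    moreover from this have "256 * e * norm (snd z) \<le> 256 * e * norm z" using e by (intro mult_left_mono) auto
    ultimately show ?thesis using norm_triangle_ineq4[of "fst z" "snd z"] by (simp add: p_def K_def distrib_right)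
  qed
  have K0: "0 \<le> K" using e by (simp add: K_def)
  obtain D where D: "countable D" "{a0, b0, u, v} \<subseteq> D" "subspace (closure D)" "rich p (A \<times> B) (D \<times> D) (D \<times> {0})"
    using countable_rich_set[of "{a0, b0, u, v}" p "A \<times> B"] by auto
  define Y where "Y = closure D"
  have DY: "D \<subseteq> Y" by (simp add: Y_def closure_subset)
  have "r < norm (d - b0 - v)" if "c \<in> A" "d \<in> B" "c - a0 - u = d - b0 - v" for c d
  proof (rule ccontr)
    assume "\<not> ?thesis"
    then have "d - b0 - v \<in> (\<lambda>x. x - a0 - u) ` A \<inter> (\<lambda>x. x - b0 - v) ` B \<inter> cball 0 r"
      using that by (auto simp: image_iff not_less) metis+
    then show False using emp by blast
  qed
  then have disj: "\<forall>c\<in>A. \<forall>d\<in>B. c - a0 - u = d - b0 - v \<longrightarrow> r < norm (d - b0 - v)" by blast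
  have subY: "subspace Y" using D(3) by (simp add: Y_def)
  have memY: "a0 \<in> Y" "b0 \<in> Y" "u \<in> Y" "v \<in> Y" using D(2) DY by auto
  have small: "norm u < e * r" "norm v < e * r" using uv by auto
  obtain a' b' f g y where ab: "a' \<in> A" "a' \<in> Y" "b' \<in> B" "b' \<in> Y" "norm (a' - a0) \<le> r / 2" "norm (b' - b0) \<le> r / 2"
    and fg: "linear f" "linear g" "\<And>h. \<bar>f h\<bar> \<le> 2 * norm h" "\<And>h. \<bar>f h + g h\<bar> \<le> 256 * e * norm h"
    and y: "y \<in> Y" "y \<noteq> 0" "f y \<ge> norm y / 4"
    and nor: "normal_along (A \<inter> Y) a' f" "normal_along (B \<inter> Y) b' g"
    using normals_along_separable_subspace[OF asp D(1) Y_def subY cl a0(1) memY(1) b0(1) memY(2,3,4) e(1,2) r(1) small disj]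
    by metis
  \<comment> \<open>At the multiple of \<open>y\<close> of norm \<open>8\<close> the functional is at least \<open>2\<close>; approximation within \<open>1 / 2\<close> costs at most \<open>1\<close>.\<close>
  obtain d where d: "d \<in> D" "1 \<le> f d" "norm d \<le> 9"
  proof -
    define w where "w = (8 / norm y) *\<^sub>R y"
    have nw: "norm w = 8" using y(2) by (simp add: w_def)
    have "f w = 8 / norm y * f y" using linear_scale[OF fg(1)] by (simp add: w_def)
    also have "\<dots> \<ge> 8 / norm y * (norm y / 4)" using y(3) by (intro mult_left_mono) auto
    finally have fw: "f w \<ge> 2" using y(2) by simp
    have "subspace Y" using D(3) by (simp add: Y_def)
    then have "w \<in> closure D" using y(1) subspace_scale unfolding w_def Y_def by blast
    then obtain d where d: "d \<in> D" "dist d w < 1 / 2" unfolding closure_approachable by (metis half_gt_zero_iff zero_less_one)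
    have "f d = f w + f (d - w)" using linear_diff[OF fg(1)] by simp
    moreover have "\<bar>f (d - w)\<bar> \<le> 1" using fg(3)[of "d - w"] d(2) by (simp add: dist_norm)
    ultimately have "1 \<le> f d" using fw by simp
    moreover have "norm d \<le> 9" using norm_triangle_ineq[of w "d - w"] d(2) nw by (simp add: dist_norm)
    ultimately show ?thesis using that d(1) by blast
  qed
  define z where "z = (\<lambda>x::'a \<times> 'a. f (fst x) + g (snd x))"
  obtain L where L: "linear L" "\<And>x. L x \<le> p x" "1 \<le> L (d, 0)" "normal_along (A \<times> B) (a', b') L"
  proof (rule normal_functional_lifting[OF psub pK K0 D(4)])
    show "(d, 0) \<in> D \<times> {0}" using d by simp
    show "(a', b') \<in> closure (D \<times> D)" using ab by (simp add: closure_Times Y_def)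
    show "linear z" unfolding z_def
      by (rule linearI) (simp_all add: linear_add[OF fg(1)] linear_add[OF fg(2)] linear_scale[OF fg(1)] linear_scale[OF fg(2)] algebra_simps)
    show "z x \<le> p x" for x
    proof -
      have "z x = f (fst x - snd x) + (f (snd x) + g (snd x))" using linear_diff[OF fg(1)] by (simp add: z_def)
      then show ?thesis using fg(3)[of "fst x - snd x"] fg(4)[of "snd x"] by (simp add: p_def)
    qed
    show "1 \<le> z (d, 0)" using d linear_0[OF fg(2)] by (simp add: z_def)
    show "normal_along (A \<times> B \<inter> D \<times> D) (a', b') z" unfolding normal_along_def
    proof (intro allI impI)
      fix \<eta> :: real assume "\<eta> > 0"
      then have "\<eta> / 2 > 0" by simp
      then obtain d1 d2 where dd: "d1 > 0" "\<forall>z\<in>A \<inter> Y. norm (z - a') < d1 \<longrightarrow> f (z - a') \<le> \<eta> / 2 * norm (z - a')"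
        "d2 > 0" "\<forall>z\<in>B \<inter> Y. norm (z - b') < d2 \<longrightarrow> g (z - b') \<le> \<eta> / 2 * norm (z - b')"
        using nor unfolding normal_along_def by blast
      have "z (x - (a', b')) \<le> \<eta> * norm (x - (a', b'))"
        if x: "x \<in> A \<times> B \<inter> D \<times> D" "norm (x - (a', b')) < min d1 d2" for x
      proof -
        obtain x1 x2 where eq: "x = (x1, x2)" by (cases x)
        have le: "norm (x1 - a') \<le> norm (x - (a', b'))" "norm (x2 - b') \<le> norm (x - (a', b'))"
          using norm_fst_le[of "x1 - a'" "x2 - b'"] norm_snd_le[of "x2 - b'" "x1 - a'"] by (simp_all add: eq)
        have "f (x1 - a') \<le> \<eta> / 2 * norm (x1 - a')" using dd(2) x le(1) DY by (auto simp: eq)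
        moreover have "g (x2 - b') \<le> \<eta> / 2 * norm (x2 - b')" using dd(4) x le(2) DY by (auto simp: eq)
        moreover have "\<eta> / 2 * norm (x1 - a') \<le> \<eta> / 2 * norm (x - (a', b'))"
          "\<eta> / 2 * norm (x2 - b') \<le> \<eta> / 2 * norm (x - (a', b'))"
          using le \<open>\<eta> / 2 > 0\<close> by (auto intro: mult_left_mono)
        ultimately show ?thesis by (simp add: z_def eq)
      qed
      then show "\<exists>\<delta>>0. \<forall>x\<in>A \<times> B \<inter> D \<times> D. norm (x - (a', b')) < \<delta> \<longrightarrow>
          z (x - (a', b')) \<le> \<eta> * norm (x - (a', b'))"
        using dd(1,3) by (intro exI[of _ "min d1 d2"]) auto
    qed
  qed metis
  have Lsum: "L (h, k) = L (h, 0) + L (0, k)" for h k using linear_add[OF L(1), of "(h, 0)" "(0, k)"] by simp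
  obtain x' :: "'a \<Rightarrow>\<^sub>L real" where x': "blinfun_apply x' = (\<lambda>h. L (h, 0))"
  proof (rule blinfun_of_linear)
    show "linear (\<lambda>h. L (h, 0))"
    proof (rule linearI)
      show "L (h + k, 0) = L (h, 0) + L (k, 0)" for h k using linear_add[OF L(1), of "(h, 0)" "(k, 0)"] by simp
      show "L (c *\<^sub>R h, 0) = c *\<^sub>R L (h, 0)" for c h using linear_scale[OF L(1), of c "(h, 0)"] by simp
    qed
    show "L (h, 0) \<le> K * norm h" for h using L(2)[of "(h, 0)"] pK[of "(h, 0)"] by simp
  qed
  obtain y' :: "'a \<Rightarrow>\<^sub>L real" where y': "blinfun_apply y' = (\<lambda>h. L (0, h))"
  proof (rule blinfun_of_linear)
    show "linear (\<lambda>h. L (0, h))"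
    proof (rule linearI)
      show "L (0, h + k) = L (0, h) + L (0, k)" for h k using linear_add[OF L(1), of "(0, h)" "(0, k)"] by simp
      show "L (0, c *\<^sub>R h) = c *\<^sub>R L (0, h)" for c h using linear_scale[OF L(1), of c "(0, h)"] by simp
    qed
    show "L (0, h) \<le> K * norm h" for h using L(2)[of "(0, h)"] pK[of "(0, h)"] by simp
  qed
  have L00: "L (0, 0) = 0" using linear_0[OF L(1)] by (simp add: zero_prod_def)
  have xN: "x' \<in> frechet_normal_cone A a'"
    unfolding frechet_normal_cone_normal_along[OF ab(1)] normal_along_def x'
  proof (intro allI impI)
    fix \<eta> :: real assume "\<eta> > 0"
    then obtain \<delta> where \<delta>: "\<delta> > 0" "\<forall>z\<in>A \<times> B. norm (z - (a', b')) < \<delta> \<longrightarrow> L (z - (a', b')) \<le> \<eta> * norm (z - (a', b'))"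
      using L(4) unfolding normal_along_def by blast
    have "L (z - a', 0) \<le> \<eta> * norm (z - a')" if "z \<in> A" "norm (z - a') < \<delta>" for z
      using bspec[OF \<delta>(2), of "(z, b')"] that ab(3) by simp
    then show "\<exists>\<delta>>0. \<forall>z\<in>A. norm (z - a') < \<delta> \<longrightarrow> L (z - a', 0) \<le> \<eta> * norm (z - a')" using \<delta>(1) by blast
  qed
  have yN: "y' \<in> frechet_normal_cone B b'"
    unfolding frechet_normal_cone_normal_along[OF ab(3)] normal_along_def y'
  proof (intro allI impI)
    fix \<eta> :: real assume "\<eta> > 0"
    then obtain \<delta> where \<delta>: "\<delta> > 0" "\<forall>z\<in>A \<times> B. norm (z - (a', b')) < \<delta> \<longrightarrow> L (z - (a', b')) \<le> \<eta> * norm (z - (a', b'))"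
      using L(4) unfolding normal_along_def by blast
    have "L (0, z - b') \<le> \<eta> * norm (z - b')" if "z \<in> B" "norm (z - b') < \<delta>" for z
      using bspec[OF \<delta>(2), of "(a', z)"] that ab(1) by simp
    then show "\<exists>\<delta>>0. \<forall>z\<in>B. norm (z - b') < \<delta> \<longrightarrow> L (0, z - b') \<le> \<eta> * norm (z - b')" using \<delta>(1) by blast
  qed
  have sum: "norm (x' + y') \<le> 256 * e"
  proof (rule norm_blinfun_bound)
    show "norm (blinfun_apply (x' + y') h) \<le> 256 * e * norm h" for h
    proof -
      have "L (h, h) \<le> 256 * e * norm h" using L(2)[of "(h, h)"] by (simp add: p_def)
      moreover have "L (- h, - h) \<le> 256 * e * norm h" using L(2)[of "(- h, - h)"] by (simp add: p_def)
      moreover have "L (- h, - h) = - L (h, h)" using linear_neg[OF L(1), of "(h, h)"] by simp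
      moreover have "blinfun_apply (x' + y') h = L (h, h)" using Lsum[of h h] by (simp add: blinfun.add_left x' y')
      ultimately show ?thesis by (simp add: abs_le_iff)
    qed
  qed (use e in simp)
  have "1 \<le> blinfun_apply x' d" using L(3) by (simp add: x')
  also have "\<dots> \<le> norm x' * norm d" using norm_blinfun[of x' d] by simp
  also have "\<dots> \<le> norm x' * 9" using d(3) by (intro mult_left_mono) auto
  finally have s: "1 / 9 \<le> norm x' + norm y'" using norm_ge_zero[of y'] by linarith
  have "norm (x' + y') < \<epsilon> * (1 / 9)" using sum e \<epsilon> by simp
  also have "\<dots> \<le> \<epsilon> * (norm x' + norm y')" using s \<epsilon> by (intro mult_left_mono) auto
  finally have "\<exists>x' \<in> frechet_normal_cone A a'. \<exists>y' \<in> frechet_normal_cone B b'.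
      norm x' + norm y' = 1 \<and> norm (x' + y') < \<epsilon>"
    using s by (intro normal_pair_normalise[OF ab(1,3) xN yN]) auto
  moreover have "a' \<in> A \<inter> ball a \<epsilon>" "b' \<in> B \<inter> ball b \<epsilon>"
  proof -
    have "dist a a' \<le> dist a a0 + norm (a' - a0)" "dist b b' \<le> dist b b0 + norm (b' - b0)"
      using dist_triangle[of a a' a0] dist_triangle[of b b' b0] by (simp_all add: dist_norm norm_minus_commute)
    then show "a' \<in> A \<inter> ball a \<epsilon>" "b' \<in> B \<inter> ball b \<epsilon>" using ab a0(2) b0(2) r e \<epsilon> by auto
  qed
  ultimately show "\<exists>a' \<in> A \<inter> ball a \<epsilon>. \<exists>b' \<in> B \<inter> ball b \<epsilon>.
      \<exists>x' \<in> frechet_normal_cone A a'. \<exists>y' \<in> frechet_normal_cone B b'.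
      norm x' + norm y' = 1 \<and> norm (x' + y') < \<epsilon>" by blast
qed

theorem theorem5:
  fixes A B :: "'a::banach set" and a b :: 'a
  assumes "asplund_space TYPE('a)"
    and "closed A" and "closed B"
    and "a \<in> A" and "b \<in> B"
  shows "(approximately_stationary A B a b \<longleftrightarrow>
           (\<forall>\<epsilon>>0. \<exists>a' \<in> A \<inter> ball a \<epsilon>. \<exists>b' \<in> B \<inter> ball b \<epsilon>. \<exists>x' :: 'a \<Rightarrow>\<^sub>L real.
              norm x' = 1 \<and>
              infdist x' (frechet_normal_cone A a') < \<epsilon> \<and>
              infdist (- x') (frechet_normal_cone B b') < \<epsilon>))
       \<and> ((\<forall>\<epsilon>>0. \<exists>a' \<in> A \<inter> ball a \<epsilon>. \<exists>b' \<in> B \<inter> ball b \<epsilon>. \<exists>x' :: 'a \<Rightarrow>\<^sub>L real.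
              norm x' = 1 \<and>
              infdist x' (frechet_normal_cone A a') < \<epsilon> \<and>
              infdist (- x') (frechet_normal_cone B b') < \<epsilon>)
          \<longleftrightarrow>
          (\<forall>\<epsilon>>0. \<exists>a' \<in> A \<inter> ball a \<epsilon>. \<exists>b' \<in> B \<inter> ball b \<epsilon>.
              \<exists>x' \<in> frechet_normal_cone A a'. \<exists>y' \<in> frechet_normal_cone B b'.
              norm x' + norm y' = 1 \<and> norm (x' + y') < \<epsilon>))"
proof -
  note unit_pair = unit_normal_condition_iff_normal_pair_condition[where A = A and B = B and a = a and b = b]
  have "approximately_stationary A B a b \<longleftrightarrow> normal_pair_condition A B a b"
    using normal_pairs_if_approximately_stationary[OF assms(1-3)] approximately_stationary_if_normal_pairs
    by (rule iffI)
  with unit_pair show ?thesis by (simp only:)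
qed

end
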